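(* Let $X$ be a locally semiconcave G-space. Then $X$ is a topological manifold admitting a canonical atlas that is both $C^{1,1/2}$ and DC, and a continuous Finsler metric $F:TX\to\mathbb R$ that is compatible with the original distance $d$ of $X$. Furthermore, $F$ is locally $1/2$-Hölder continuous in the base direction.
   Context: A shortest path is an isometric embedding of an interval into a metric space (so it has unit speed); a geodesic space is a metric space in which any two points are joined by a shortest path. Write $|xy|=d(x,y)$. G-space: a metric space $X$ such that (1) for any distinct $x,y\in X$ there is $z\in X\setminus\{x,y\}$ with $|xz|+|zy|=|xy|$; (2) every bounded infinite subset of $X$ has an accumulation point; (3) every point has an open neighborhood $U$ such that for any $x,y\in U$ there is $z\in U\setminus\{x,y\}$ with $|xy|+|yz|=|xz|$; (4) for any distinct $x,y\in X$, if $z_1,z_2\in X$ satisfy $|xy|+|yz_i|=|xz_i|$ and $|yz_1|=|yz_2|$, then $z_1=z_2$. Equivalently: a complete, locally compact geodesic space in which every point has an open neighborhood $U$ such that any shortest path in $U$ admits a unique maximal extension (as a shortest path) reaching $\partial U$. Locally semiconcave: a geodesic space $X$ is locally semiconcave if for every $x\in X$ there exist $\lambda\in\mathbb R$ and a neighborhood $U$ of $x$ such that for any $p\in U$ and any unit-speed shortest path $\gamma(t)$ in $U$, the function $t\mapsto |p\gamma(t)|^2-\lambda t^2$ is concave. A function on an open subset of $\mathbb R^n$ is $C^{1,1/2}$ if it is $C^1$ with locally $1/2$-Hölder continuous derivative. It is semiconcave if it is locally Lipschitz and every point has a neighborhood on which, for some $\lambda>0$, $f\circ\gamma(t)-\lambda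 t^2$ is concave for every unit-speed line segment $\gamma$; it is DC if it is locally a difference of two semiconcave functions. An atlas of a topological manifold is $C^{1,1/2}$ (resp. DC) if the coordinate transformations (and their inverses) preserve the class of $C^{1,1/2}$ (resp. DC) functions, i.e. they are $C^{1,1/2}$ diffeomorphisms (resp. locally bi-Lipschitz homeomorphisms that are DC in both directions). The atlas on the geodesic space $X$ is canonical if every point of $X$ has a neighborhood $U$ such that for every $p\in U$ the squared distance function $d(p,\cdot)^2$ on $U$ is $C^{1,1/2}$ and DC in the local coordinates of the atlas. For a $C^1$ manifold $X$, a Finsler metric is a function $F:TX\to\mathbb R$ on the tangent bundle whose restriction to each fiber $T_xX$ is a norm. It is continuous if it is continuous on $TX$. It is compatible with $d$ if $d(p,q)=\inf_c\int_0^1F(c(t),c'(t))\,dt$ for all $p,q$, where $c:[0,1]\to X$ runs over all $C^1$ curves from $p$ to $q$. It is locally $1/2$-Hölder continuous in the base direction if, in the local coordinates of the atlas, the function $x\mapsto F(x,v)$ is locally $1/2$-Hölder continuous for each fixed $v\in\mathbb R^n$. *)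

theory Defs
  imports "HOL-Analysis.Analysis"
begin

section \<open>G-spaces and local semiconcavity\<close>

definition G_space :: "'a::metric_space itself \<Rightarrow> bool" where
  "G_space _ \<longleftrightarrow>
    (\<forall>x y :: 'a. x \<noteq> y \<longrightarrow> (\<exists>z. z \<noteq> x \<and> z \<noteq> y \<and> dist x z + dist z y = dist x y)) \<and>
    (\<forall>S :: 'a set. bounded S \<and> infinite S \<longrightarrow> (\<exists>x. x islimpt S)) \<and>
    (\<forall>p :: 'a. \<exists>U. open U \<and> p \<in> U \<and>
       (\<forall>x\<in>U. \<forall>y\<in>U. \<exists>z\<in>U - {x, y}. dist x y + dist y z = dist x z)) \<and>
    (\<forall>x y z1 z2 :: 'a. x \<noteq> y \<and>
       dist x y + dist y z1 = dist x z1 \<and> dist x y + dist y z2 = dist x z2 \<and>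
       dist y z1 = dist y z2 \<longrightarrow> z1 = z2)"

definition shortest_path :: "real \<Rightarrow> real \<Rightarrow> (real \<Rightarrow> 'a::metric_space) \<Rightarrow> bool" where
  "shortest_path a b \<gamma> \<longleftrightarrow>
    a \<le> b \<and> (\<forall>s\<in>{a..b}. \<forall>t\<in>{a..b}. dist (\<gamma> s) (\<gamma> t) = \<bar>s - t\<bar>)"

definition geodesic_space :: "'a::metric_space itself \<Rightarrow> bool" where
  "geodesic_space _ \<longleftrightarrow>
    (\<forall>x y :: 'a. \<exists>a b \<gamma>. shortest_path a b \<gamma> \<and> \<gamma> a = x \<and> \<gamma> b = y)"

definition locally_semiconcave_space :: "'a::metric_space itself \<Rightarrow> bool" where
  "locally_semiconcave_space T \<longleftrightarrow> geodesic_space T \<and>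
    (\<forall>x :: 'a. \<exists>(l::real) U. open U \<and> x \<in> U \<and>
      (\<forall>p\<in>U. \<forall>a b \<gamma>. shortest_path a b \<gamma> \<and> \<gamma> ` {a..b} \<subseteq> U \<longrightarrow>
        concave_on {a..b} (\<lambda>t. (dist p (\<gamma> t))\<^sup>2 - l * t\<^sup>2)))"

section \<open>Functions on open subsets of Euclidean space\<close>

text \<open>The dimension is existentially quantified in the main statement, so Euclidean \<open>n\<close>-space
  is \<^const>\<open>Euclidean_space\<close>: the sequences \<open>x :: nat \<Rightarrow> real\<close> with \<open>x i = 0\<close> for \<open>i \<ge> n\<close>,
  whose topology is the usual one. The type class metric on \<open>nat \<Rightarrow> real\<close> is not the Euclidean
  one and is never used; distances are given by \<open>edist\<close>. In all definitions below
  \<open>\<Omega>\<close> is meant to be an open subset of Euclidean \<open>n\<close>-space.\<close>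

definition edist :: "nat \<Rightarrow> (nat \<Rightarrow> real) \<Rightarrow> (nat \<Rightarrow> real) \<Rightarrow> real" where
  "edist n x y = L2_set (\<lambda>i. x i - y i) {..<n}"

definition locally_Holder ::
  "nat \<Rightarrow> real \<Rightarrow> (nat \<Rightarrow> real) set \<Rightarrow> ((nat \<Rightarrow> real) \<Rightarrow> real) \<Rightarrow> bool" where
  "locally_Holder n \<alpha> \<Omega> f \<longleftrightarrow>
    (\<forall>x\<in>\<Omega>. \<exists>N C. openin (Euclidean_space n) N \<and> x \<in> N \<and> N \<subseteq> \<Omega> \<and>
      (\<forall>y\<in>N. \<forall>z\<in>N. \<bar>f y - f z\<bar> \<le> C * edist n y z powr \<alpha>))"

definition locally_Lipschitz ::
  "nat \<Rightarrow> (nat \<Rightarrow> real) set \<Rightarrow> ((nat \<Rightarrow> real) \<Rightarrow> real) \<Rightarrow> bool" where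
  "locally_Lipschitz n \<Omega> f \<longleftrightarrow>
    (\<forall>x\<in>\<Omega>. \<exists>N C. openin (Euclidean_space n) N \<and> x \<in> N \<and> N \<subseteq> \<Omega> \<and>
      (\<forall>y\<in>N. \<forall>z\<in>N. \<bar>f y - f z\<bar> \<le> C * edist n y z))"

definition partial_deriv ::
  "nat \<Rightarrow> ((nat \<Rightarrow> real) \<Rightarrow> real) \<Rightarrow> (nat \<Rightarrow> real) \<Rightarrow> real" where
  "partial_deriv i f x = deriv (\<lambda>t. f (x(i := t))) (x i)"

definition C1_on ::
  "nat \<Rightarrow> (nat \<Rightarrow> real) set \<Rightarrow> ((nat \<Rightarrow> real) \<Rightarrow> real) \<Rightarrow> bool" where
  "C1_on n \<Omega> f \<longleftrightarrow>
    (\<forall>i<n. (\<forall>x\<in>\<Omega>. (\<lambda>t. f (x(i := t))) field_differentiable at (x i)) \<and>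
      continuous_map (subtopology (Euclidean_space n) \<Omega>) euclideanreal (partial_deriv i f))"

text \<open>Local Hoelder continuity of the derivative, a map into a space of dimension \<open>n\<close>, is
  local Hoelder continuity of its components.\<close>

definition C1_half_on ::
  "nat \<Rightarrow> (nat \<Rightarrow> real) set \<Rightarrow> ((nat \<Rightarrow> real) \<Rightarrow> real) \<Rightarrow> bool" where
  "C1_half_on n \<Omega> f \<longleftrightarrow>
    C1_on n \<Omega> f \<and> (\<forall>i<n. locally_Holder n (1/2) \<Omega> (partial_deriv i f))"

definition semiconcave_on ::
  "nat \<Rightarrow> (nat \<Rightarrow> real) set \<Rightarrow> ((nat \<Rightarrow> real) \<Rightarrow> real) \<Rightarrow> bool" where
  "semiconcave_on n \<Omega> f \<longleftrightarrow> locally_Lipschitz n \<Omega> f \<and>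
    (\<forall>x\<in>\<Omega>. \<exists>N. openin (Euclidean_space n) N \<and> x \<in> N \<and> N \<subseteq> \<Omega> \<and>
      (\<exists>l>0. \<forall>p u a b.
        L2_set u {..<n} = 1 \<and> a \<le> b \<and> (\<forall>t\<in>{a..b}. (\<lambda>i. p i + t * u i) \<in> N) \<longrightarrow>
        concave_on {a..b} (\<lambda>t. f (\<lambda>i. p i + t * u i) - l * t\<^sup>2)))"

definition DC_on ::
  "nat \<Rightarrow> (nat \<Rightarrow> real) set \<Rightarrow> ((nat \<Rightarrow> real) \<Rightarrow> real) \<Rightarrow> bool" where
  "DC_on n \<Omega> f \<longleftrightarrow>
    (\<forall>x\<in>\<Omega>. \<exists>N g h. openin (Euclidean_space n) N \<and> x \<in> N \<and> N \<subseteq> \<Omega> \<and>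
      semiconcave_on n N g \<and> semiconcave_on n N h \<and> (\<forall>y\<in>N. f y = g y - h y))"

text \<open>A map into Euclidean space is of class \<open>C\<^sup>1\<^sup>,\<^sup>1\<^sup>/\<^sup>2\<close> or DC if its components are.\<close>

definition C1_half_diffeo ::
  "nat \<Rightarrow> (nat \<Rightarrow> real) set \<Rightarrow> (nat \<Rightarrow> real) set \<Rightarrow> ((nat \<Rightarrow> real) \<Rightarrow> nat \<Rightarrow> real) \<Rightarrow> bool" where
  "C1_half_diffeo n \<Omega> \<Omega>' \<tau> \<longleftrightarrow> bij_betw \<tau> \<Omega> \<Omega>' \<and>
    (\<forall>i<n. C1_half_on n \<Omega> (\<lambda>x. \<tau> x i)) \<and>
    (\<forall>i<n. C1_half_on n \<Omega>' (\<lambda>y. inv_into \<Omega> \<tau> y i))"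

definition locally_bi_Lipschitz ::
  "nat \<Rightarrow> (nat \<Rightarrow> real) set \<Rightarrow> ((nat \<Rightarrow> real) \<Rightarrow> nat \<Rightarrow> real) \<Rightarrow> bool" where
  "locally_bi_Lipschitz n \<Omega> \<tau> \<longleftrightarrow>
    (\<forall>x\<in>\<Omega>. \<exists>N L. openin (Euclidean_space n) N \<and> x \<in> N \<and> N \<subseteq> \<Omega> \<and>
      (\<forall>y\<in>N. \<forall>z\<in>N. edist n (\<tau> y) (\<tau> z) \<le> L * edist n y z \<and>
                      edist n y z \<le> L * edist n (\<tau> y) (\<tau> z)))"

definition DC_homeomorphism ::
  "nat \<Rightarrow> (nat \<Rightarrow> real) set \<Rightarrow> (nat \<Rightarrow> real) set \<Rightarrow> ((nat \<Rightarrow> real) \<Rightarrow> nat \<Rightarrow> real) \<Rightarrow> bool" where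
  "DC_homeomorphism n \<Omega> \<Omega>' \<tau> \<longleftrightarrow>
    homeomorphic_map (subtopology (Euclidean_space n) \<Omega>) (subtopology (Euclidean_space n) \<Omega>') \<tau> \<and>
    locally_bi_Lipschitz n \<Omega> \<tau> \<and>
    (\<forall>i<n. DC_on n \<Omega> (\<lambda>x. \<tau> x i)) \<and>
    (\<forall>i<n. DC_on n \<Omega>' (\<lambda>y. inv_into \<Omega> \<tau> y i))"

section \<open>Manifolds and atlases\<close>

definition topological_manifold :: "nat \<Rightarrow> 'a topology \<Rightarrow> bool" where
  "topological_manifold n X \<longleftrightarrow> Hausdorff_space X \<and> second_countable X \<and>
    (\<forall>x\<in>topspace X. \<exists>U V. openin X U \<and> x \<in> U \<and> openin (Euclidean_space n) V \<and>
      subtopology X U homeomorphic_space subtopology (Euclidean_space n) V)"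

text \<open>A chart \<open>(U, \<phi>)\<close> consists of its domain and its coordinate map; the values of \<open>\<phi>\<close>
  outside \<open>U\<close> are irrelevant.\<close>

type_synonym 'a chart = "'a set \<times> ('a \<Rightarrow> nat \<Rightarrow> real)"

definition atlas :: "nat \<Rightarrow> 'a::topological_space chart set \<Rightarrow> bool" where
  "atlas n A \<longleftrightarrow>
    (\<forall>(U, \<phi>)\<in>A. open U \<and> openin (Euclidean_space n) (\<phi> ` U) \<and>
      homeomorphic_map (top_of_set U) (subtopology (Euclidean_space n) (\<phi> ` U)) \<phi>) \<and>
    (\<Union>(U, \<phi>)\<in>A. U) = UNIV"

definition transition :: "'a chart \<Rightarrow> 'a chart \<Rightarrow> (nat \<Rightarrow> real) \<Rightarrow> nat \<Rightarrow> real" where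
  "transition c c' = snd c' \<circ> inv_into (fst c) (snd c)"

definition C1_half_atlas :: "nat \<Rightarrow> 'a::topological_space chart set \<Rightarrow> bool" where
  "C1_half_atlas n A \<longleftrightarrow> atlas n A \<and>
    (\<forall>(U, \<phi>)\<in>A. \<forall>(V, \<psi>)\<in>A.
      C1_half_diffeo n (\<phi> ` (U \<inter> V)) (\<psi> ` (U \<inter> V)) (transition (U, \<phi>) (V, \<psi>)))"

definition DC_atlas :: "nat \<Rightarrow> 'a::topological_space chart set \<Rightarrow> bool" where
  "DC_atlas n A \<longleftrightarrow> atlas n A \<and>
    (\<forall>(U, \<phi>)\<in>A. \<forall>(V, \<psi>)\<in>A.
      DC_homeomorphism n (\<phi> ` (U \<inter> V)) (\<psi> ` (U \<inter> V)) (transition (U, \<phi>) (V, \<psi>)))"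

definition canonical_atlas :: "nat \<Rightarrow> 'a::metric_space chart set \<Rightarrow> bool" where
  "canonical_atlas n A \<longleftrightarrow> atlas n A \<and>
    (\<forall>x. \<exists>U. open U \<and> x \<in> U \<and>
      (\<forall>p\<in>U. \<forall>(V, \<phi>)\<in>A.
        C1_half_on n (\<phi> ` (U \<inter> V)) (\<lambda>y. (dist p (inv_into V \<phi> y))\<^sup>2) \<and>
        DC_on n (\<phi> ` (U \<inter> V)) (\<lambda>y. (dist p (inv_into V \<phi> y))\<^sup>2)))"

section \<open>The tangent bundle of a \<open>C\<^sup>1\<close> atlas\<close>

text \<open>A tangent vector at \<open>p\<close> is the family of its coordinate vectors in all charts of the
  atlas around \<open>p\<close>, which transform by the derivatives of the transition maps. The family is
  set to zero at all other charts, so that tangent vectors at \<open>p\<close> form a vector space under the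
  pointwise operations, isomorphic to Euclidean space by evaluation at any chart around \<open>p\<close>.\<close>

type_synonym 'a tvec = "'a chart \<Rightarrow> nat \<Rightarrow> real"

definition differential ::
  "nat \<Rightarrow> ((nat \<Rightarrow> real) \<Rightarrow> nat \<Rightarrow> real) \<Rightarrow> (nat \<Rightarrow> real) \<Rightarrow> (nat \<Rightarrow> real) \<Rightarrow> nat \<Rightarrow> real" where
  "differential n \<tau> x v =
    (\<lambda>i. if i < n then \<Sum>j<n. partial_deriv j (\<lambda>y. \<tau> y i) x * v j else 0)"

definition tangent_space :: "nat \<Rightarrow> 'a chart set \<Rightarrow> 'a \<Rightarrow> 'a tvec set" where
  "tangent_space n A p =
    {v. (\<forall>c\<in>A. p \<in> fst c \<longrightarrow> v c \<in> topspace (Euclidean_space n)) \<and>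
        (\<forall>c\<in>A. \<forall>c'\<in>A. p \<in> fst c \<inter> fst c' \<longrightarrow>
          v c' = differential n (transition c c') (snd c p) (v c)) \<and>
        (\<forall>c. c \<notin> A \<or> p \<notin> fst c \<longrightarrow> v c = (\<lambda>_. 0))}"

definition tangent_bundle :: "nat \<Rightarrow> 'a chart set \<Rightarrow> ('a \<times> 'a tvec) set" where
  "tangent_bundle n A = (SIGMA p:UNIV. tangent_space n A p)"

text \<open>The topology for which \<open>(p, v) \<mapsto> (\<phi> p, v (U, \<phi>))\<close> is a homeomorphism from the bundle
  over \<open>U\<close>, itself open, onto \<open>\<phi> ` U\<close> times Euclidean space, for each chart \<open>(U, \<phi>)\<close>.\<close>

definition tangent_topology :: "nat \<Rightarrow> 'a chart set \<Rightarrow> ('a \<times> 'a tvec) topology" where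
  "tangent_topology n A = topology_generated_by
    {{(p, v) \<in> tangent_bundle n A. p \<in> fst c \<and> (snd c p, v c) \<in> W} | c W.
      c \<in> A \<and> openin (prod_topology (Euclidean_space n) (Euclidean_space n)) W}"

definition tangent_vector :: "nat \<Rightarrow> 'a chart set \<Rightarrow> 'a chart \<Rightarrow> 'a \<Rightarrow> (nat \<Rightarrow> real) \<Rightarrow> 'a tvec" where
  \<comment> \<open>the tangent vector at \<open>p\<close> with coordinates \<open>v\<close> in the chart \<open>c\<close>\<close>
  "tangent_vector n A c p v =
    (\<lambda>c'. if c' \<in> A \<and> p \<in> fst c' then differential n (transition c c') (snd c p) v else (\<lambda>_. 0))"

definition velocity :: "'a chart set \<Rightarrow> (real \<Rightarrow> 'a) \<Rightarrow> real \<Rightarrow> 'a tvec" where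
  "velocity A \<gamma> t =
    (\<lambda>c. if c \<in> A \<and> \<gamma> t \<in> fst c
         then (\<lambda>i. vector_derivative (\<lambda>s. snd c (\<gamma> s) i) (at t within {0..1}))
         else (\<lambda>_. 0))"

definition C1_curve :: "nat \<Rightarrow> 'a::topological_space chart set \<Rightarrow> (real \<Rightarrow> 'a) \<Rightarrow> bool" where
  "C1_curve n A \<gamma> \<longleftrightarrow> continuous_on {0..1} \<gamma> \<and>
    (\<forall>c\<in>A. \<forall>i<n.
      (\<forall>t\<in>{0..1}. \<gamma> t \<in> fst c \<longrightarrow>
        (\<lambda>s. snd c (\<gamma> s) i) differentiable (at t within {0..1})) \<and>
      continuous_on {t\<in>{0..1}. \<gamma> t \<in> fst c} (\<lambda>t. velocity A \<gamma> t c i))"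

section \<open>Finsler metrics\<close>

definition norm_on :: "'a tvec set \<Rightarrow> ('a tvec \<Rightarrow> real) \<Rightarrow> bool" where
  "norm_on V N \<longleftrightarrow>
    (\<forall>v\<in>V. 0 \<le> N v \<and> (N v = 0 \<longleftrightarrow> v = (\<lambda>_ _. 0))) \<and>
    (\<forall>v\<in>V. \<forall>r. N (\<lambda>c i. r * v c i) = \<bar>r\<bar> * N v) \<and>
    (\<forall>v\<in>V. \<forall>w\<in>V. N (\<lambda>c i. v c i + w c i) \<le> N v + N w)"

definition Finsler_metric :: "nat \<Rightarrow> 'a chart set \<Rightarrow> ('a \<times> 'a tvec \<Rightarrow> real) \<Rightarrow> bool" where
  "Finsler_metric n A F \<longleftrightarrow> (\<forall>p. norm_on (tangent_space n A p) (\<lambda>v. F (p, v)))"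

definition continuous_Finsler_metric :: "nat \<Rightarrow> 'a chart set \<Rightarrow> ('a \<times> 'a tvec \<Rightarrow> real) \<Rightarrow> bool" where
  "continuous_Finsler_metric n A F \<longleftrightarrow>
    Finsler_metric n A F \<and> continuous_map (tangent_topology n A) euclideanreal F"

text \<open>The infimum is taken in the extended reals, where the empty set has infimum \<open>\<infinity>\<close>.\<close>

definition compatible_Finsler_metric ::
  "nat \<Rightarrow> 'a::metric_space chart set \<Rightarrow> ('a \<times> 'a tvec \<Rightarrow> real) \<Rightarrow> bool" where
  "compatible_Finsler_metric n A F \<longleftrightarrow>
    (\<forall>p q. ereal (dist p q) =
      (INF \<gamma>\<in>{\<gamma>. C1_curve n A \<gamma> \<and> \<gamma> 0 = p \<and> \<gamma> 1 = q}.
        ereal (integral {0..1} (\<lambda>t. F (\<gamma> t, velocity A \<gamma> t)))))"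

definition base_locally_half_Holder :: "nat \<Rightarrow> 'a chart set \<Rightarrow> ('a \<times> 'a tvec \<Rightarrow> real) \<Rightarrow> bool" where
  "base_locally_half_Holder n A F \<longleftrightarrow>
    (\<forall>(U, \<phi>)\<in>A. \<forall>v\<in>topspace (Euclidean_space n).
      locally_Holder n (1/2) (\<phi> ` U)
        (\<lambda>x. let p = inv_into U \<phi> x in F (p, tangent_vector n A (U, \<phi>) p v)))"

end

theory Submission
  imports Defs "HOL-Homology.Invariance_of_Domain"
begin

text \<open>The semiconcavity estimate for \<open>dist p\<close> at a point \<open>m\<close> is two-sided: if \<open>q\<close> lies beyond \<open>m\<close> on a
  shortest path from \<open>p\<close>, then \<open>dist p \<ge> dist p q - dist q\<close> with equality at \<open>m\<close>, and \<open>dist q\<close> is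
  semiconcave as well. Hence distance functions are affine along shortest paths up to a quadratic
  error, uniformly near every point. A minimal finite set of points of a small sphere whose distance
  functions distinguish the directions at the centre gives a bi-Lipschitz chart: by minimality each
  coordinate can be changed independently to first order, so a point of the image nearest to a given
  point is that point. Since such a chart maps midpoints to midpoints up to a quadratic error, a
  function that is affine along shortest paths up to a quadratic error has quadratically small second
  differences in the chart, so it is of class \<open>C\<^sup>1\<^sup>,\<^sup>1\<close>, in particular \<open>C\<^sup>1\<^sup>,\<^sup>1\<^sup>/\<^sup>2\<close>
  and DC. The distance of two nearby points is a supremum of differences of such functions, which
  yields the Finsler norm as the derivative of the distance, with Lipschitz dependence on the base
  point.\<close>

section \<open>Second differences on an interval\<close>

text \<open>Charts do not map shortest paths to segments, and no angles or tangent cones are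
  available at the outset. Regularity is therefore expressed by second differences over midpoints:
  such a condition makes sense on the space and in coordinates alike, and for a Lipschitz function
  it survives a quadratic displacement of the midpoint. Derivatives come out as consequences.

  All bounds are uniform over the points of a sphere. This is what lets them pass from single
  distance functions to a supremum, hence to the distance itself. Prolonging shortest paths up to
  the sphere makes that supremum attained, and it also allows a direction at a point to be reversed.

  A chart found at a point has as many coordinates as the minimal separating set there has elements,
  a number that might vary from point to point; invariance of domain and connectedness exclude this.
  The norm does not depend on the chart because it is the first-order part of one and the same
  distance.\<close>

lemma midpoint_bound_imp_below_chord:
  fixes g :: "real \<Rightarrow> real"
  assumes cont: "continuous_on {a..b} g"
    and mid: "\<And>s h. h > 0 \<Longrightarrow> a \<le> s - h \<Longrightarrow> s + h \<le> b \<Longrightarrow> - 2 * K * h\<^sup>2 \<le> g (s + h) + g (s - h) - 2 * g s"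
    and t: "t \<in> {a..b}"
  shows "(b - a) * g t - (b - t) * g a - (t - a) * g b \<le> K * (t - a) * (b - t) * (b - a)"
\<comment> \<open>Maximum principle: if the bound failed, the excess \<open>e\<close> over it would
  have an interior maximum, where its second difference is at most 0, while the hypothesis makes
  that second difference positive.\<close>
proof (rule ccontr)
  assume neg: "\<not> ?thesis"
  have ab: "a < b"
    using t neg by (cases "a = b") auto
  define e where "e K' x = (b - a) * g x - (b - x) * g a - (x - a) * g b - K' * (x - a) * (b - x) * (b - a)" for K' x
  have "e K t > 0" using neg by (simp add: e_def)
  have "a \<noteq> t" "b \<noteq> t" using \<open>e K t > 0\<close> by (auto simp: e_def)
  then have tt: "(t - a) * (b - t) * (b - a) > 0" using t ab by auto
  \<comment> \<open>Strictness is gained by raising \<open>K\<close> just so far that half of the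
    excess at \<open>t\<close> is left.\<close>
  define K' where "K' = K + e K t / (2 * ((t - a) * (b - t) * (b - a)))"
  have K': "K' > K" unfolding K'_def using tt \<open>e K t > 0\<close> by simp
  have "e K' t = e K t - (K' - K) * ((t - a) * (b - t) * (b - a))"
    by (simp add: e_def algebra_simps)
  also have "\<dots> = e K t / 2" unfolding K'_def using tt by (simp add: field_simps)
  finally have epos: "e K' t > 0" using \<open>e K t > 0\<close> by simp
  have "continuous_on {a..b} (e K')"
    unfolding e_def by (intro continuous_intros cont)
  then obtain x where x: "x \<in> {a..b}" "\<And>y. y \<in> {a..b} \<Longrightarrow> e K' y \<le> e K' x"
    using continuous_attains_sup[of "{a..b}" "e K'"] t by auto
  have "e K' x > 0" using x(2)[of t] t epos by simp
  then have "x \<noteq> a" "x \<noteq> b" by (auto simp: e_def)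
  define h where "h = min (x - a) (b - x)"
  have h: "h > 0" "a \<le> x - h" "x + h \<le> b" using x(1) \<open>x \<noteq> a\<close> \<open>x \<noteq> b\<close> by (auto simp: h_def)
  have "e K' (x + h) \<le> e K' x" "e K' (x - h) \<le> e K' x"
    using x h by auto
  then have "e K' (x + h) + e K' (x - h) - 2 * e K' x \<le> 0" by simp
  moreover have "e K' (x + h) + e K' (x - h) - 2 * e K' x
      = (b - a) * (g (x + h) + g (x - h) - 2 * g x + 2 * K' * h\<^sup>2)"
    by (simp add: e_def algebra_simps power2_eq_square)
  moreover have "g (x + h) + g (x - h) - 2 * g x + 2 * K' * h\<^sup>2 > 0"
  proof -
    have "K * h\<^sup>2 < K' * h\<^sup>2" using K' h by simp
    then show ?thesis using mid[OF h] by linarith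
  qed
  ultimately show False using ab by (simp add: mult_le_0_iff)
qed

text \<open>For continuous functions this amounts to a derivative with Lipschitz constant
  \<open>2 * K\<close>; no derivative is mentioned, so the condition can be read off from midpoints
  in a metric space.\<close>

definition midpoint_bounded :: "real \<Rightarrow> real \<Rightarrow> real \<Rightarrow> (real \<Rightarrow> real) \<Rightarrow> bool" where
  "midpoint_bounded K a b g \<longleftrightarrow> continuous_on {a..b} g \<and>
    (\<forall>s h. h > 0 \<longrightarrow> a \<le> s - h \<longrightarrow> s + h \<le> b \<longrightarrow> \<bar>g (s + h) + g (s - h) - 2 * g s\<bar> \<le> 2 * K * h\<^sup>2)"

lemma midpoint_bounded_subinterval:
  "midpoint_bounded K a b g \<Longrightarrow> a \<le> a' \<Longrightarrow> b' \<le> b \<Longrightarrow> midpoint_bounded K a' b' g"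
  unfolding midpoint_bounded_def by (auto intro: continuous_on_subset)

lemma midpoint_bounded_chord:
  assumes "midpoint_bounded K a b g" "t \<in> {a..b}"
  shows "\<bar>(b - a) * g t - (b - t) * g a - (t - a) * g b\<bar> \<le> K * (t - a) * (b - t) * (b - a)"
proof -
  have c: "continuous_on {a..b} g" "continuous_on {a..b} (\<lambda>x. - g x)"
    using assms unfolding midpoint_bounded_def by (auto intro: continuous_intros)
  have m: "\<bar>g (s + h) + g (s - h) - 2 * g s\<bar> \<le> 2 * K * h\<^sup>2" if "h > 0" "a \<le> s - h" "s + h \<le> b" for s h
    using assms that unfolding midpoint_bounded_def by blast
  have "(b - a) * g t - (b - t) * g a - (t - a) * g b \<le> K * (t - a) * (b - t) * (b - a)"
    by (rule midpoint_bound_imp_below_chord[OF c(1) _ assms(2)]) (use m in \<open>fastforce simp: abs_le_iff\<close>)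
  moreover have "(b - a) * - g t - (b - t) * - g a - (t - a) * - g b \<le> K * (t - a) * (b - t) * (b - a)"
    by (rule midpoint_bound_imp_below_chord[OF c(2) _ assms(2)]) (use m in \<open>fastforce simp: abs_le_iff\<close>)
  ultimately show ?thesis by (simp add: abs_le_iff)
qed

lemma midpoint_bounded_chord':
  assumes "midpoint_bounded K 0 T g" "0 < t" "t \<le> T"
  shows "\<bar>(g t - g 0) / t - (g T - g 0) / T\<bar> \<le> K * (T - t)"
proof -
  have T: "T > 0" using assms by simp
  have "\<bar>T * g t - (T - t) * g 0 - t * g T\<bar> \<le> K * t * (T - t) * T"
    using midpoint_bounded_chord[OF assms(1), of t] assms by simp
  moreover have "T * g t - (T - t) * g 0 - t * g T = (t * T) * ((g t - g 0) / t - (g T - g 0) / T)"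
    using assms T by (simp add: field_simps)
  moreover have "\<bar>(t * T) * ((g t - g 0) / t - (g T - g 0) / T)\<bar> = (t * T) * \<bar>(g t - g 0) / t - (g T - g 0) / T\<bar>"
    using assms T by (simp add: abs_mult)
  ultimately have "(t * T) * \<bar>(g t - g 0) / t - (g T - g 0) / T\<bar> \<le> (t * T) * (K * (T - t))"
    by (simp add: mult_ac)
  then show ?thesis using assms T by (simp add: mult_le_cancel_left)
qed

lemma midpoint_bounded_shift_reflect:
  assumes "midpoint_bounded K a b g" 
  shows "midpoint_bounded K (a - c) (b - c) (\<lambda>t. g (c + t))"
    "midpoint_bounded K (c - b) (c - a) (\<lambda>t. g (c - t))"
proof -
  have c: "continuous_on {a..b} g" and m: "\<And>s h. h > 0 \<Longrightarrow> a \<le> s - h \<Longrightarrow> s + h \<le> b \<Longrightarrow> \<bar>g (s + h) + g (s - h) - 2 * g s\<bar> \<le> 2 * K * h\<^sup>2"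
    using assms unfolding midpoint_bounded_def by auto
  have "continuous_on {a - c..b - c} (\<lambda>t. g (c + t))"
    by (rule continuous_on_compose2[OF c]) (auto intro: continuous_intros)
  moreover have "\<bar>g (c + (s + h)) + g (c + (s - h)) - 2 * g (c + s)\<bar> \<le> 2 * K * h\<^sup>2"
    if "h > 0" "a - c \<le> s - h" "s + h \<le> b - c" for s h
    using m[of h "c + s"] that by (simp add: algebra_simps)
  ultimately show "midpoint_bounded K (a - c) (b - c) (\<lambda>t. g (c + t))"
    unfolding midpoint_bounded_def by blast
  have "continuous_on {c - b..c - a} (\<lambda>t. g (c - t))"
    by (rule continuous_on_compose2[OF c]) (auto intro: continuous_intros)
  moreover have "\<bar>g (c - (s + h)) + g (c - (s - h)) - 2 * g (c - s)\<bar> \<le> 2 * K * h\<^sup>2"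
    if "h > 0" "c - b \<le> s - h" "s + h \<le> c - a" for s h
    using m[of h "c - s"] that by (simp add: algebra_simps)
  ultimately show "midpoint_bounded K (c - b) (c - a) (\<lambda>t. g (c - t))"
    unfolding midpoint_bounded_def by blast
qed

text \<open>On one side of \<open>t0\<close> both quotients come from chords issuing from
  \<open>t0\<close>, the left side being reflected to the right; on opposite sides the chord between
  \<open>s\<close> and \<open>t\<close> passes over \<open>t0\<close>. The proof gives
  \<open>K * \<bar>t - s\<bar>\<close>, which is then weakened to a form that does not distinguish
  the sides.\<close>

lemma midpoint_bounded_quotient:
  assumes g: "midpoint_bounded K a b g" and K: "K \<ge> 0" and t0: "t0 \<in> {a..b}"
    and s: "s \<in> {a..b}" "s \<noteq> t0" and t: "t \<in> {a..b}" "t \<noteq> t0" 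
  shows "\<bar>(g t - g t0) / (t - t0) - (g s - g t0) / (s - t0)\<bar> \<le> 2 * K * max \<bar>t - t0\<bar> \<bar>s - t0\<bar>"
proof -
  define q where "q u = (g u - g t0) / (u - t0)" for u
  have r: "\<bar>q u - q v\<bar> \<le> K * (v - u)" if "t0 < u" "u \<le> v" "v \<le> b" for u v
  proof -
    have "midpoint_bounded K 0 (v - t0) (\<lambda>t. g (t0 + t))"
      using midpoint_bounded_shift_reflect(1)[OF midpoint_bounded_subinterval[OF g, of t0 v], of t0] that t0 by simp
    from midpoint_bounded_chord'[OF this, of "u - t0"] that show ?thesis by (simp add: q_def)
  qed
  have l: "\<bar>q u - q v\<bar> \<le> K * (u - v)" if "u < t0" "v \<le> u" "a \<le> v" for u v
  proof -
    have "midpoint_bounded K 0 (t0 - v) (\<lambda>t. g (t0 - t))"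
      using midpoint_bounded_shift_reflect(2)[OF midpoint_bounded_subinterval[OF g, of v t0], of t0] that t0 by simp
    from midpoint_bounded_chord'[OF this, of "t0 - u"] that 
    have "\<bar>(g u - g t0) / (t0 - u) - (g v - g t0) / (t0 - v)\<bar> \<le> K * (u - v)" by simp
    moreover have "(g w - g t0) / (t0 - w) = - q w" for w unfolding q_def 
      by (metis minus_diff_eq minus_divide_right)
    ultimately show ?thesis by (simp add: abs_minus_commute)
  qed
  have o: "\<bar>q u - q v\<bar> \<le> K * (v - u)" if "u < t0" "t0 < v" "v \<le> b" "a \<le> u" for u v
  proof -
    have "\<bar>(v - u) * g t0 - (v - t0) * g u - (t0 - u) * g v\<bar> \<le> K * (t0 - u) * (v - t0) * (v - u)"
      using midpoint_bounded_chord[OF midpoint_bounded_subinterval[OF g, of u v], of t0] that by simp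
    moreover have "(v - u) * g t0 - (v - t0) * g u - (t0 - u) * g v = ((t0 - u) * (v - t0)) * (q u - q v)"
      unfolding q_def using that
      by (simp add: divide_simps) (simp add: algebra_simps)
    ultimately have "((t0 - u) * (v - t0)) * \<bar>q u - q v\<bar> \<le> ((t0 - u) * (v - t0)) * (K * (v - u))"
      using that by (simp add: abs_mult mult_ac)
    then show ?thesis using that by (simp add: mult_le_cancel_left zero_less_mult_iff)
  qed
  have "\<bar>q t - q s\<bar> \<le> K * \<bar>t - s\<bar>"
  proof -
    consider "t0 < s" "s \<le> t" | "t0 < t" "t \<le> s" | "t < t0" "s \<le> t" | "s < t0" "t \<le> s"
      | "s < t0" "t0 < t" | "t < t0" "t0 < s"
      using s(2) t(2) by linarith
    then show ?thesis
      using r[of s t] r[of t s] l[of s t] l[of t s] o[of s t] o[of t s] s t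
      by cases (simp_all add: abs_minus_commute)
  qed
  also have "\<dots> \<le> K * (2 * max \<bar>t - t0\<bar> \<bar>s - t0\<bar>)"
    using K by (intro mult_left_mono) (auto simp: max_def abs_if)
  finally show ?thesis unfolding q_def by (simp add: mult_ac)
qed

text \<open>The quotients at \<open>t0\<close> oscillate linearly, so every lower estimate
  \<open>q s - 2 * K * \<bar>s - t0\<bar>\<close> lies below every upper one, and the supremum
  \<open>A\<close> of the lower ones serves as derivative. No limit is taken, and end points of the
  interval are covered as well.\<close>

lemma midpoint_bounded_expansion:
  assumes g: "midpoint_bounded K a b g" and K: "K \<ge> 0" and t0: "t0 \<in> {a..b}"
  obtains A where "\<And>t. t \<in> {a..b} \<Longrightarrow> \<bar>g t - g t0 - A * (t - t0)\<bar> \<le> 2 * K * (t - t0)\<^sup>2"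
proof -
  define q where "q u = (g u - g t0) / (u - t0)" for u
  define S where "S = {a..b} - {t0}"
  define A where "A = (SUP s\<in>S. q s - 2 * K * \<bar>s - t0\<bar>)"
  have le: "q s - 2 * K * \<bar>s - t0\<bar> \<le> q t + 2 * K * \<bar>t - t0\<bar>" if "s \<in> S" "t \<in> S" for s t
  proof -
    have "\<bar>q t - q s\<bar> \<le> 2 * K * max \<bar>t - t0\<bar> \<bar>s - t0\<bar>"
      unfolding q_def using midpoint_bounded_quotient[OF g K t0, of s t] that by (auto simp: S_def)
    also have "\<dots> \<le> 2 * K * (\<bar>t - t0\<bar> + \<bar>s - t0\<bar>)" using K by (intro mult_left_mono) auto
    finally show ?thesis by (simp add: algebra_simps)
  qed
  have A: "q t - 2 * K * \<bar>t - t0\<bar> \<le> A" "A \<le> q t + 2 * K * \<bar>t - t0\<bar>" if "t \<in> S" for t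
    unfolding A_def using le that
    by (auto intro!: cSUP_upper cSUP_least bdd_aboveI2)
  have "\<bar>g t - g t0 - A * (t - t0)\<bar> \<le> 2 * K * (t - t0)\<^sup>2" if t: "t \<in> {a..b}" for t
  proof (cases "t = t0")
    case False
    then have "\<bar>q t - A\<bar> \<le> 2 * K * \<bar>t - t0\<bar>" using A[of t] t by (auto simp: S_def)
    then have "\<bar>q t - A\<bar> * \<bar>t - t0\<bar> \<le> 2 * K * \<bar>t - t0\<bar> * \<bar>t - t0\<bar>" by (intro mult_right_mono) auto
    moreover have "g t - g t0 - A * (t - t0) = (q t - A) * (t - t0)"
      unfolding q_def using False by (simp add: field_simps)
    ultimately show ?thesis by (simp add: abs_mult power2_eq_square)
  qed simp
  then show thesis by (rule that)
qed

section \<open>Euclidean balls\<close>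

lemma L2_set_scale: "L2_set (\<lambda>i. t * w i) A = \<bar>t\<bar> * L2_set w A"
  by (simp add: L2_set_def power_mult_distrib sum_distrib_left[symmetric] real_sqrt_mult)

lemma L2_set_component_le: "(i::nat) < n \<Longrightarrow> \<bar>u i\<bar> \<le> L2_set u {..<n}"
  using member_le_L2_set[OF finite_lessThan, of i n "\<lambda>i. \<bar>u i\<bar>"] by (simp add: L2_set_def)

lemma edist_nonneg [simp]: "0 \<le> edist n x y"
  by (simp add: edist_def)

lemma edist_self [simp]: "edist n x x = 0"
  by (simp add: edist_def L2_set_def)

lemma edist_commute: "edist n x y = edist n y x"
  by (simp add: edist_def L2_set_def power2_commute)

lemma edist_triangle: "edist n x z \<le> edist n x y + edist n y z"
  using L2_set_triangle_ineq[of "\<lambda>i. x i - y i" "\<lambda>i. y i - z i" "{..<n}"]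
  by (simp add: edist_def)

lemma edist_component_le: "i < n \<Longrightarrow> \<bar>x i - y i\<bar> \<le> edist n x y"
  unfolding edist_def using L2_set_component_le[of i n "\<lambda>i. x i - y i"] by simp

lemma edist_le_sum: "edist n x y \<le> (\<Sum>i<n. \<bar>x i - y i\<bar>)"
  unfolding edist_def by (rule L2_set_le_sum_abs)

lemma edist_eq_0_iff:
  assumes "x \<in> topspace (Euclidean_space n)" "y \<in> topspace (Euclidean_space n)"
  shows "edist n x y = 0 \<longleftrightarrow> x = y"
proof
  assume "edist n x y = 0"
  then have "x i = y i" for i
    using edist_component_le[of i n x y] assms by (cases "i < n") (auto simp: topspace_Euclidean_space)
  then show "x = y" by auto
qed simp

lemma edist_ray: "edist n (\<lambda>i. u i + t * w i) (\<lambda>i. u i + s * w i) = \<bar>t - s\<bar> * L2_set w {..<n}"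
proof -
  have "(\<lambda>i. u i + t * w i - (u i + s * w i)) = (\<lambda>i. (t - s) * w i)" by (auto simp: algebra_simps)
  then show ?thesis unfolding edist_def by (simp add: L2_set_scale)
qed

lemma edist_add: "edist n u (\<lambda>i. u i + w i) = L2_set w {..<n}"
  using edist_ray[of n u 0 w 1] by simp

lemma edist_add_scale: "edist n u (\<lambda>i. u i + t * w i) = \<bar>t\<bar> * L2_set w {..<n}"
  using edist_ray[of n u 0 w t] by simp

definition euclid_ball :: "nat \<Rightarrow> (nat \<Rightarrow> real) \<Rightarrow> real \<Rightarrow> (nat \<Rightarrow> real) set" where
  "euclid_ball n a e = {u \<in> topspace (Euclidean_space n). edist n a u < e}"

lemma euclid_ball_mono: "e \<le> e' \<Longrightarrow> euclid_ball n a e \<subseteq> euclid_ball n a e'"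
  by (auto simp: euclid_ball_def)

lemma center_in_euclid_ball [simp]: "a \<in> topspace (Euclidean_space n) \<Longrightarrow> e > 0 \<Longrightarrow> a \<in> euclid_ball n a e"
  by (simp add: euclid_ball_def)

lemma euclid_ball_add:
  assumes "u \<in> euclid_ball n a e" "w \<in> topspace (Euclidean_space n)" "L2_set w {..<n} \<le> d"
  shows "(\<lambda>i. u i + w i) \<in> euclid_ball n a (e + d)"
proof -
  have "edist n a (\<lambda>i. u i + w i) \<le> edist n a u + L2_set w {..<n}"
    using edist_triangle[of n a "\<lambda>i. u i + w i" u] by (simp add: edist_add)
  then show ?thesis using assms by (auto simp: euclid_ball_def topspace_Euclidean_space)
qed

lemma euclid_ball_segment:
  assumes "u \<in> euclid_ball n a e" "v \<in> euclid_ball n a e" "t \<in> {0..1}"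
  shows "(\<lambda>i. u i + t * (v i - u i)) \<in> euclid_ball n a e"
proof -
  have "edist n a (\<lambda>i. u i + t * (v i - u i)) = L2_set (\<lambda>i. (1 - t) * (a i - u i) + t * (a i - v i)) {..<n}"
    unfolding edist_def by (rule L2_set_cong) (auto simp: algebra_simps)
  also have "\<dots> \<le> L2_set (\<lambda>i. (1 - t) * (a i - u i)) {..<n} + L2_set (\<lambda>i. t * (a i - v i)) {..<n}"
    by (rule L2_set_triangle_ineq)
  also have "\<dots> = (1 - t) * edist n a u + t * edist n a v"
    using assms(3) by (simp add: L2_set_scale edist_def)
  also have "\<dots> < e" using assms 
    by (intro convex_bound_lt) (auto simp: euclid_ball_def)
  finally show ?thesis using assms by (auto simp: euclid_ball_def topspace_Euclidean_space)
qed

lemma Euclidean_space_top_of_set: "Euclidean_space n = top_of_set {x. \<forall>i\<ge>n. x i = 0}"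
  by (simp add: Euclidean_space_def euclidean_product_topology)

lemma continuous_on_edist: "continuous_on S (edist n x)"
proof -
  have "continuous_on S (\<lambda>y::nat \<Rightarrow> real. y i)" for i
    using continuous_on_subset[OF continuous_on_product_coordinates subset_UNIV] .
  then show ?thesis
  unfolding edist_def L2_set_def
  by (intro continuous_intros)
qed

lemma openin_euclid_ball: "openin (Euclidean_space n) (euclid_ball n x e)"
proof -
  have "euclid_ball n x e = {x. \<forall>i\<ge>n. x i = 0} \<inter> {y. edist n x y < e}"
    by (auto simp: euclid_ball_def topspace_Euclidean_space)
  moreover have "open {y. edist n x y < e}"
    by (rule open_Collect_less[of "edist n x" "\<lambda>_. e", OF continuous_on_edist continuous_on_const])
  ultimately show ?thesis
    by (simp only: Euclidean_space_top_of_set openin_open_Int)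
qed

text \<open>Only the coordinates below \<open>n\<close> matter, since all others vanish on the whole
  space; hence a product neighbourhood contains a Euclidean ball although the product has infinitely
  many factors.\<close>

lemma openin_Euclidean_space_iff:
  "openin (Euclidean_space n) S \<longleftrightarrow>
    S \<subseteq> topspace (Euclidean_space n) \<and> (\<forall>x\<in>S. \<exists>e>0. euclid_ball n x e \<subseteq> S)"
proof (intro iffI conjI ballI)
  fix x assume S: "openin (Euclidean_space n) S" and x: "x \<in> S"
  obtain T where T: "openin (powertop_real UNIV) T" "S = T \<inter> {x. \<forall>i\<ge>n. x i = 0}"
    using S unfolding Euclidean_space_def by (auto simp: openin_subtopology)
  then obtain U where U: "\<And>i. open (U i)" "x \<in> Pi\<^sub>E UNIV U" "Pi\<^sub>E UNIV U \<subseteq> T"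
    using x unfolding openin_product_topology_alt by force
  have "\<exists>d>0. \<forall>y. \<bar>x i - y\<bar> < d \<longrightarrow> y \<in> U i" for i
  proof -
    have "x i \<in> U i" using U(2) by auto
    then show ?thesis using U(1)[of i] unfolding open_dist dist_real_def by (metis abs_minus_commute)
  qed
  then obtain d where d: "\<And>i. d i > 0" "\<And>i y. \<bar>x i - y\<bar> < d i \<Longrightarrow> y \<in> U i" by metis
  \<comment> \<open>The element 1 keeps the set nonempty when \<open>n\<close> is 0.\<close>
  define e where "e = Min (insert 1 (d ` {..<n}))"
  have "e > 0" unfolding e_def using d(1) by (subst Min_gr_iff) auto
  have ed: "e \<le> d i" if "i < n" for i unfolding e_def using that by (intro Min_le) auto
  have "euclid_ball n x e \<subseteq> S"
  proof
    fix y assume y: "y \<in> euclid_ball n x e"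
    have "y i \<in> U i" for i
    proof (cases "i < n")
      case True
      then show ?thesis using edist_component_le[OF True, of x y] ed[OF True] y
        by (intro d(2)) (auto simp: euclid_ball_def)
    next
      case False
      then have "y i = x i" using y x T by (auto simp: euclid_ball_def topspace_Euclidean_space)
      then show ?thesis using d by simp
    qed
    then have "y \<in> T" using U(3) by auto
    then show "y \<in> S" using y T(2) by (auto simp: euclid_ball_def topspace_Euclidean_space)
  qed
  then show "\<exists>e>0. euclid_ball n x e \<subseteq> S" using \<open>e > 0\<close> by blast
next
  assume "openin (Euclidean_space n) S"
  then show "S \<subseteq> topspace (Euclidean_space n)" by (rule openin_subset)
next
  assume S: "S \<subseteq> topspace (Euclidean_space n) \<and> (\<forall>x\<in>S. \<exists>e>0. euclid_ball n x e \<subseteq> S)"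
  show "openin (Euclidean_space n) S"
  proof (subst openin_subopen, intro ballI)
    fix x assume "x \<in> S"
    then obtain e where "e > 0" "euclid_ball n x e \<subseteq> S" using S by blast
    then show "\<exists>T. openin (Euclidean_space n) T \<and> x \<in> T \<and> T \<subseteq> S"
      using \<open>x \<in> S\<close> S by (intro exI[of _ "euclid_ball n x e"]) (auto simp: openin_euclid_ball)
  qed
qed

lemma continuous_map_Euclidean_subspace:
  fixes f :: "(nat \<Rightarrow> real) \<Rightarrow> 'b::metric_space"
  assumes "\<And>x e. x \<in> S \<Longrightarrow> e > 0 \<Longrightarrow> \<exists>d>0. \<forall>y\<in>S. edist n x y < d \<longrightarrow> dist (f x) (f y) < e"
  shows "continuous_map (subtopology (Euclidean_space n) S) euclidean f"
  unfolding continuous_map_def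
proof (intro conjI allI impI)
  fix U assume "openin euclidean (U :: 'b set)"
  then have U: "open U" by simp
  have *: "\<exists>T. openin (Euclidean_space n) T \<and> x \<in> T \<and> T \<inter> S \<subseteq> {x. f x \<in> U}"
    if x: "x \<in> S" "x \<in> topspace (Euclidean_space n)" "f x \<in> U" for x
  proof -
    obtain e where e: "e > 0" "ball (f x) e \<subseteq> U" using U x open_contains_ball by blast
    obtain d where "d > 0" "\<forall>y\<in>S. edist n x y < d \<longrightarrow> dist (f x) (f y) < e"
      using assms[OF x(1) e(1)] by blast
    then show ?thesis using x e openin_euclid_ball[of n x d]
      by (intro exI[of _ "euclid_ball n x d"]) (auto simp: euclid_ball_def subset_iff)
  qed
  then show "openin (subtopology (Euclidean_space n) S) {x \<in> topspace (subtopology (Euclidean_space n) S). f x \<in> U}"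
  proof (subst openin_subopen, intro ballI)
    fix x assume x: "x \<in> {x \<in> topspace (subtopology (Euclidean_space n) S). f x \<in> U}"
    then obtain T where T: "openin (Euclidean_space n) T" "x \<in> T" "T \<inter> S \<subseteq> {x. f x \<in> U}"
      using * by auto
    then have "openin (subtopology (Euclidean_space n) S) (T \<inter> S)"
      by (simp add: openin_subtopology_Int)
    then show "\<exists>T. openin (subtopology (Euclidean_space n) S) T \<and> x \<in> T \<and>
      T \<subseteq> {x \<in> topspace (subtopology (Euclidean_space n) S). f x \<in> U}"
      using T x openin_subset[of "Euclidean_space n" T] by (intro exI[of _ "T \<inter> S"]) auto
  qed
qed simp

section \<open>Functions of class \<open>C\<^sup>1\<^sup>,\<^sup>1\<close>\<close>

text \<open>The functions of class \<open>C\<^sup>1\<^sup>,\<^sup>1\<close> on a ball: those whose second differences are quadratically small.\<close>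

definition C11_ball :: "nat \<Rightarrow> (nat \<Rightarrow> real) \<Rightarrow> real \<Rightarrow> real \<Rightarrow> ((nat \<Rightarrow> real) \<Rightarrow> real) \<Rightarrow> bool" where
  "C11_ball n a e K h \<longleftrightarrow> 0 \<le> K \<and> (\<forall>u\<in>euclid_ball n a e. \<forall>v\<in>euclid_ball n a e.
    \<bar>h u - h v\<bar> \<le> K * edist n u v \<and>
    \<bar>h u + h v - 2 * h (\<lambda>i. (u i + v i) / 2)\<bar> \<le> K * (edist n u v)\<^sup>2)"

lemma C11_ballD:
  assumes "C11_ball n a e K h" 
  shows "0 \<le> K" "u \<in> euclid_ball n a e \<Longrightarrow> v \<in> euclid_ball n a e \<Longrightarrow> \<bar>h u - h v\<bar> \<le> K * edist n u v"
   "u \<in> euclid_ball n a e \<Longrightarrow> v \<in> euclid_ball n a e \<Longrightarrow>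
    \<bar>h u + h v - 2 * h (\<lambda>i. (u i + v i) / 2)\<bar> \<le> K * (edist n u v)\<^sup>2"
  using assms unfolding C11_ball_def by auto

lemma C11_ball_ray:
  assumes h: "C11_ball n a e K h" and ray: "\<And>t. t \<in> {c..d} \<Longrightarrow> (\<lambda>i. u i + t * w i) \<in> euclid_ball n a e"
  shows "midpoint_bounded (2 * K * (L2_set w {..<n})\<^sup>2) c d (\<lambda>t. h (\<lambda>i. u i + t * w i))"
  unfolding midpoint_bounded_def
proof (intro conjI allI impI)
  define l where "l = L2_set w {..<n}"
  have "(K * l)-lipschitz_on {c..d} (\<lambda>t. h (\<lambda>i. u i + t * w i))"
  proof (rule lipschitz_onI)
    fix s t assume "s \<in> {c..d}" "t \<in> {c..d}"
    then show "dist (h (\<lambda>i. u i + s * w i)) (h (\<lambda>i. u i + t * w i)) \<le> K * l * dist s t"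
      using C11_ballD(2)[OF h ray ray, of s t] 
      by (simp add: edist_ray dist_real_def l_def mult_ac)
  qed (use C11_ballD(1)[OF h] in \<open>auto simp: l_def\<close>)
  then show "continuous_on {c..d} (\<lambda>t. h (\<lambda>i. u i + t * w i))"
    by (rule lipschitz_on_continuous_on)
next
  fix s r :: real assume r: "r > 0" "c \<le> s - r" "s + r \<le> d"
  have "(\<lambda>i. (u i + (s + r) * w i + (u i + (s - r) * w i)) / 2) = (\<lambda>i. u i + s * w i)"
    by (auto simp: field_simps)
  then show "\<bar>h (\<lambda>i. u i + (s + r) * w i) + h (\<lambda>i. u i + (s - r) * w i) - 2 * h (\<lambda>i. u i + s * w i)\<bar>
      \<le> 2 * (2 * K * (L2_set w {..<n})\<^sup>2) * r\<^sup>2"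
    using C11_ballD(3)[OF h ray ray, of "s + r" "s - r"] r
    unfolding edist_ray by (simp add: power_mult_distrib mult.assoc) (simp add: mult_ac)
qed

lemma C11_ball_chord:
  assumes h: "C11_ball n a e K h" and u: "u \<in> euclid_ball n a e" "(\<lambda>i. u i + w i) \<in> euclid_ball n a e"
    and t: "t \<in> {0..1}"
  shows "\<bar>h (\<lambda>i. u i + t * w i) - (1 - t) * h u - t * h (\<lambda>i. u i + w i)\<bar>
    \<le> 2 * K * (L2_set w {..<n})\<^sup>2 * t * (1 - t)"
proof -
  have "midpoint_bounded (2 * K * (L2_set w {..<n})\<^sup>2) 0 1 (\<lambda>t. h (\<lambda>i. u i + t * w i))"
    using euclid_ball_segment[OF u] by (intro C11_ball_ray[OF h]) simp
  from midpoint_bounded_chord[OF this t] show ?thesis by simp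
qed

text \<open>The two diagonals of a parallelogram have a common midpoint, so subtracting the two
  midpoint estimates gives a bound by the square of the sum of the side lengths. When
  \<open>w\<close> is the shorter side this is too weak; then \<open>w\<close> is stretched to the
  length of the other side and the result is scaled back along chords, which makes the bound linear
  in the length of \<open>w\<close>.\<close>

lemma C11_ball_parallelogram:
  assumes h: "C11_ball n a e K h" and u: "u \<in> euclid_ball n a (e / 4)" "u' \<in> euclid_ball n a (e / 4)"
    and w: "w \<in> topspace (Euclidean_space n)" "L2_set w {..<n} < e / 4"
  shows "\<bar>h (\<lambda>i. u i + w i) - h u - (h (\<lambda>i. u' i + w i) - h u')\<bar>
     \<le> 12 * K * L2_set w {..<n} * (L2_set w {..<n} + edist n u u')"
proof -
  define D where "D = edist n u u'"
  define l where "l = L2_set w {..<n}"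
  have K: "K \<ge> 0" using h by (rule C11_ballD)
  have l0: "l \<ge> 0" and D0: "D \<ge> 0" by (auto simp: l_def D_def)
  have e: "e > 0" using w l0 unfolding l_def by linarith
  have De: "D < e / 2" using u edist_triangle[of n u u' a] edist_commute[of n a u]
    unfolding D_def euclid_ball_def by auto
  have uu: "u \<in> euclid_ball n a e" "u' \<in> euclid_ball n a e" using u euclid_ball_mono[of "e/4" e] e by auto
  have add: "(\<lambda>i. x i + v i) \<in> euclid_ball n a e" 
    if "x \<in> euclid_ball n a (e / 4)" "v \<in> topspace (Euclidean_space n)" "L2_set v {..<n} < e / 2" for x v
    using euclid_ball_add[OF that(1,2), of "e/2"] that(3) euclid_ball_mono[of "e/4 + e/2" e] e by auto
  have base: "\<bar>h (\<lambda>i. u i + v i) - h u - (h (\<lambda>i. u' i + v i) - h u')\<bar> \<le> 2 * K * (L2_set v {..<n} + D)\<^sup>2"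
    if v: "v \<in> topspace (Euclidean_space n)" "L2_set v {..<n} < e / 2" for v
  proof -
    define m where "m = (\<lambda>i. (u i + v i + u' i) / 2)"
    have "\<bar>h (\<lambda>i. u i + v i) + h u' - 2 * h m\<bar> \<le> K * (edist n (\<lambda>i. u i + v i) u')\<^sup>2"
      using C11_ballD(3)[OF h add[OF u(1) v] uu(2)] unfolding m_def .
    moreover have "edist n (\<lambda>i. u i + v i) u' \<le> L2_set v {..<n} + D"
      using edist_triangle[of n "\<lambda>i. u i + v i" u' u] edist_add[of n u v] edist_commute D_def by metis
    moreover have "\<bar>h u + h (\<lambda>i. u' i + v i) - 2 * h m\<bar> \<le> K * (edist n u (\<lambda>i. u' i + v i))\<^sup>2"
      using C11_ballD(3)[OF h uu(1) add[OF u(2) v]] unfolding m_def by (simp add: add_ac)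
    moreover have "edist n u (\<lambda>i. u' i + v i) \<le> L2_set v {..<n} + D"
      using edist_triangle[of n u "\<lambda>i. u' i + v i" u'] edist_add[of n u' v] D_def by simp
    moreover have "K * x\<^sup>2 \<le> K * (L2_set v {..<n} + D)\<^sup>2" if "0 \<le> x" "x \<le> L2_set v {..<n} + D" for x
      using that K by (intro mult_left_mono power_mono) auto
    ultimately have "\<bar>h (\<lambda>i. u i + v i) + h u' - 2 * h m\<bar> \<le> K * (L2_set v {..<n} + D)\<^sup>2"
      "\<bar>h u + h (\<lambda>i. u' i + v i) - 2 * h m\<bar> \<le> K * (L2_set v {..<n} + D)\<^sup>2"
      by (meson edist_nonneg order_trans)+
    then show ?thesis by (simp add: abs_le_iff)
  qed
  show ?thesis
  proof (cases "D \<le> l")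
    case True
    have "\<bar>h (\<lambda>i. u i + w i) - h u - (h (\<lambda>i. u' i + w i) - h u')\<bar> \<le> 2 * K * (l + D)\<^sup>2"
      unfolding l_def using w e by (intro base) auto
    also have "\<dots> = 2 * K * (l + D) * (l + D)" by (simp add: power2_eq_square)
    also have "\<dots> \<le> 2 * K * (6 * l) * (l + D)"
      using True K l0 D0 by (intro mult_right_mono mult_left_mono) auto
    also have "\<dots> = 12 * K * l * (l + D)" by simp
    finally show ?thesis unfolding l_def D_def .
  next
    case False
    then have D: "D > l" "D > 0" using l0 by auto
    show ?thesis
    proof (cases "l = 0")
      case True
      then have "w i = 0" for i
        using w L2_set_component_le[of i n w] by (cases "i < n") (auto simp: l_def topspace_Euclidean_space)
      then have "w = (\<lambda>_. 0)" by auto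
      then show ?thesis by (simp add: L2_set_def)
    next
      case False
      then have l: "l > 0" using l0 by simp
      \<comment> \<open>Stretched to length \<open>D\<close>, which is still below
        \<open>e / 2\<close>, so the end points remain in the ball.\<close>
      define v where "v = (\<lambda>i. D / l * w i)"
      define th where "th = l / D"
      have th: "th \<in> {0..1}" using D l by (auto simp: th_def)
      have lv: "L2_set v {..<n} = D" using l D unfolding v_def L2_set_scale l_def by auto
      have v: "v \<in> topspace (Euclidean_space n)" "L2_set v {..<n} < e / 2"
        using w lv De by (auto simp: v_def topspace_Euclidean_space)
      have thv: "th * v i = w i" for i using l D by (simp add: th_def v_def)
      have c: "\<bar>h (\<lambda>i. x i + w i) - (1 - th) * h x - th * h (\<lambda>i. x i + v i)\<bar> \<le> 2 * K * l * D" 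
        if x: "x \<in> euclid_ball n a (e / 4)" for x
      proof -
        have "x \<in> euclid_ball n a e" using x euclid_ball_mono[of "e/4" e] e by auto
        from C11_ball_chord[OF h this add[OF x v] th]
        have "\<bar>h (\<lambda>i. x i + w i) - (1 - th) * h x - th * h (\<lambda>i. x i + v i)\<bar> \<le> 2 * K * D\<^sup>2 * th * (1 - th)"
          by (simp add: thv lv)
        also have "\<dots> \<le> 2 * K * D\<^sup>2 * th * 1"
          using th K by (intro mult_left_mono) auto
        also have "\<dots> = 2 * K * l * D" using D by (simp add: th_def power2_eq_square)
        finally show ?thesis .
      qed
      have b: "th * \<bar>h (\<lambda>i. u i + v i) - h u - (h (\<lambda>i. u' i + v i) - h u')\<bar> \<le> 8 * K * l * D"
      proof -
        have "\<bar>h (\<lambda>i. u i + v i) - h u - (h (\<lambda>i. u' i + v i) - h u')\<bar> \<le> 2 * K * (D + D)\<^sup>2"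
          using base[OF v] by (simp add: lv)
        then have "th * \<bar>h (\<lambda>i. u i + v i) - h u - (h (\<lambda>i. u' i + v i) - h u')\<bar> \<le> th * (2 * K * (D + D)\<^sup>2)"
          using th by (intro mult_left_mono) auto
        also have "\<dots> = 8 * K * l * D" using D by (simp add: th_def power2_eq_square)
        finally show ?thesis .
      qed
      define X where "X = h (\<lambda>i. u i + v i) - h u - (h (\<lambda>i. u' i + v i) - h u')"
      have "h (\<lambda>i. u i + w i) - h u - (h (\<lambda>i. u' i + w i) - h u')
        = (h (\<lambda>i. u i + w i) - (1 - th) * h u - th * h (\<lambda>i. u i + v i))
         - (h (\<lambda>i. u' i + w i) - (1 - th) * h u' - th * h (\<lambda>i. u' i + v i)) + th * X"
        unfolding X_def by (simp add: algebra_simps)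
      moreover have "\<bar>th * X\<bar> \<le> 8 * K * l * D" using b th unfolding X_def by (simp add: abs_mult)
      ultimately have "\<bar>h (\<lambda>i. u i + w i) - h u - (h (\<lambda>i. u' i + w i) - h u')\<bar> \<le> 12 * K * l * D"
        using c[OF u(1)] c[OF u(2)] by (simp add: abs_le_iff)
      also have "\<dots> \<le> 12 * K * l * (l + D)" using K l by (intro mult_left_mono) auto
      finally show ?thesis unfolding l_def D_def .
    qed
  qed
qed

lemma le_powr_half: "0 \<le> x \<Longrightarrow> x \<le> 1 \<Longrightarrow> x \<le> x powr (1 / 2)" for x :: real
  by (metis powr_half_sqrt real_sqrt_ge_zero real_sqrt_le_1_iff real_sqrt_pow2 mult_left_le power2_eq_square)

text \<open>Serves to discard second-order terms: after division by the step length \<open>t\<close>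
  they are proportional to \<open>t\<close>.\<close>

lemma linear_bound_limit:
  fixes x y c :: real
  assumes "d > 0" "\<And>t. 0 < t \<Longrightarrow> t < d \<Longrightarrow> x \<le> c * t + y"
  shows "x \<le> y"
proof (rule tendsto_le)
  show "((\<lambda>t. c * t + y) \<longlongrightarrow> y) (at_right 0)"
    by (rule tendsto_eq_intros refl | simp)+
  show "((\<lambda>_. x) \<longlongrightarrow> x) (at_right (0::real))" by simp
  show "eventually (\<lambda>t. x \<le> c * t + y) (at_right 0)"
    using eventually_at_right_real[OF assms(1)] assms(2) by (auto elim!: eventually_mono)
qed simp

lemma has_field_derivative_of_quadratic_error:
  fixes g :: "real \<Rightarrow> real"
  assumes "\<And>t. t \<in> S \<Longrightarrow> \<bar>t - t0\<bar> < d \<Longrightarrow> \<bar>g t - g t0 - A * (t - t0)\<bar> \<le> C * (t - t0)\<^sup>2" and "d > 0"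
  shows "(g has_real_derivative A) (at t0 within S)"
  unfolding has_field_derivative_def has_derivative_within_alt
proof (intro conjI allI impI)
  show "bounded_linear ((*) A)" by (rule bounded_linear_mult_right)
  fix e :: real assume e: "e > 0"
  define d' where "d' = min d (e / (\<bar>C\<bar> + 1))"
  have "norm (g y - g t0 - A * (y - t0)) \<le> e * norm (y - t0)" if y: "y \<in> S" "norm (y - t0) < d'" for y
  proof -
    have "\<bar>g y - g t0 - A * (y - t0)\<bar> \<le> C * (y - t0)\<^sup>2" using assms(1) y unfolding d'_def by simp
    also have "\<dots> \<le> (\<bar>C\<bar> + 1) * \<bar>y - t0\<bar> * \<bar>y - t0\<bar>"
      unfolding power2_eq_square mult.assoc abs_mult_self_eq by (intro mult_right_mono) auto
    also have "\<dots> \<le> e * \<bar>y - t0\<bar>"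
    proof (rule mult_right_mono)
      have "\<bar>y - t0\<bar> \<le> e / (\<bar>C\<bar> + 1)" using y unfolding d'_def by simp
      then show "(\<bar>C\<bar> + 1) * \<bar>y - t0\<bar> \<le> e" by (simp add: field_simps)
    qed simp
    finally show ?thesis by simp
  qed
  then show "\<exists>d>0. \<forall>y\<in>S. norm (y - t0) < d \<longrightarrow> norm (g y - g t0 - A * (y - t0)) \<le> e * norm (y - t0)"
    using e assms(2) by (intro exI[of _ d']) (auto simp: d'_def)
qed

section \<open>Partial and total derivatives from second differences\<close>

lemma fun_upd_ray: "x(i := t) = (\<lambda>j. x j + (t - x i) * (if j = i then 1 else 0))"
  for x :: "nat \<Rightarrow> real"
  by auto

lemma L2_set_unit: "(i::nat) < n \<Longrightarrow> L2_set (\<lambda>j. if j = i then 1 else 0) {..<n} = 1"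
  unfolding L2_set_def by (subst sum.remove[of "{..<n}" i]) auto

lemma fun_upd_euclid_ball:
  assumes "u \<in> topspace (Euclidean_space n)" "edist n a u + d < e" "i < n" "\<bar>t - u i\<bar> \<le> d"
  shows "u(i := t) \<in> euclid_ball n a e"
proof -
  have "edist n u (u(i := t)) = \<bar>t - u i\<bar>"
    unfolding fun_upd_ray edist_add_scale using assms(3) by (simp add: L2_set_unit)
  then show ?thesis using edist_triangle[of n a "u(i := t)" u] assms
    by (auto simp: euclid_ball_def topspace_Euclidean_space)
qed

text \<open>On a coordinate line \<open>h\<close> is midpoint bounded with constant
  \<open>2 * K\<close>, whence the error \<open>4 * K\<close>. The slope obtained depends at first
  on the interval considered; uniqueness of derivatives identifies it with
  \<open>partial_deriv\<close>.\<close>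

lemma C11_ball_partial_deriv:
  assumes h: "C11_ball n a e K h" and u: "u \<in> euclid_ball n a e" and i: "i < n"
  shows "(\<lambda>t. h (u(i := t))) field_differentiable at (u i)"
    and "edist n a u + \<bar>t - u i\<bar> < e \<Longrightarrow>
      \<bar>h (u(i := t)) - h u - partial_deriv i h u * (t - u i)\<bar> \<le> 4 * K * (t - u i)\<^sup>2"
proof -
  have K: "K \<ge> 0" using h by (rule C11_ballD)
  define g where "g t = h (u(i := t))" for t
  define w where "w = (\<lambda>j. if j = i then 1 else (0::real))"
  have uT: "u \<in> topspace (Euclidean_space n)" using u by (simp add: euclid_ball_def)
  have ex: "\<exists>A. \<forall>t. \<bar>t - u i\<bar> \<le> d \<longrightarrow> \<bar>g t - g (u i) - A * (t - u i)\<bar> \<le> 4 * K * (t - u i)\<^sup>2"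
    if d: "d \<ge> 0" "edist n a u + d < e" for d
  proof -
    have "midpoint_bounded (2 * K * (L2_set w {..<n})\<^sup>2) (- d) d (\<lambda>t. h (\<lambda>j. u j + t * w j))"
    proof (rule C11_ball_ray[OF h])
      fix t assume "t \<in> {- d..d}"
      then show "(\<lambda>j. u j + t * w j) \<in> euclid_ball n a e"
        using fun_upd_euclid_ball[OF uT d(2) i, of "u i + t"] unfolding fun_upd_ray w_def by auto
    qed
    then have "midpoint_bounded (2 * K) (- d) d (\<lambda>t. h (\<lambda>j. u j + t * w j))"
      using i by (simp add: w_def L2_set_unit)
    from midpoint_bounded_shift_reflect(1)[OF this, of "- u i"]
    have "midpoint_bounded (2 * K) (u i - d) (u i + d) g"
      unfolding g_def fun_upd_ray w_def by (simp add: add.commute)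
    from midpoint_bounded_expansion[OF this, of "u i"] d K obtain A where
      "\<And>t. t \<in> {u i - d..u i + d} \<Longrightarrow> \<bar>g t - g (u i) - A * (t - u i)\<bar> \<le> 2 * (2 * K) * (t - u i)\<^sup>2" by auto
    then show ?thesis by (intro exI[of _ A]) (auto simp: abs_le_iff)
  qed
  have deriv: "(g has_real_derivative A) (at (u i))"
    if "d > 0" "\<And>t. \<bar>t - u i\<bar> \<le> d \<Longrightarrow> \<bar>g t - g (u i) - A * (t - u i)\<bar> \<le> 4 * K * (t - u i)\<^sup>2" for A d
    by (rule has_field_derivative_of_quadratic_error[of _ _ d _ _ "4 * K"]) (use that in auto)
  have dd: "(e - edist n a u) / 2 > 0" "edist n a u + (e - edist n a u) / 2 < e"
    using u by (auto simp: euclid_ball_def field_simps)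
  from ex[OF less_imp_le[OF dd(1)] dd(2)] deriv[OF dd(1)] 
  show "(\<lambda>t. h (u(i := t))) field_differentiable at (u i)"
    unfolding g_def[symmetric] by (auto simp: field_differentiable_def)
  assume t: "edist n a u + \<bar>t - u i\<bar> < e"
  show "\<bar>h (u(i := t)) - h u - partial_deriv i h u * (t - u i)\<bar> \<le> 4 * K * (t - u i)\<^sup>2"
  proof (cases "t = u i")
    case False
    then have d: "\<bar>t - u i\<bar> > 0" by simp
    obtain A where A: "\<And>s. \<bar>s - u i\<bar> \<le> \<bar>t - u i\<bar> \<Longrightarrow> \<bar>g s - g (u i) - A * (s - u i)\<bar> \<le> 4 * K * (s - u i)\<^sup>2"
      using ex[OF _ t] by auto
    have "partial_deriv i h u = A"
      using DERIV_imp_deriv[OF deriv[OF d A]] unfolding partial_deriv_def g_def by simp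
    then show ?thesis using A[of t] by (simp add: g_def)
  qed simp
qed

text \<open>The parallelogram estimate divided by the step \<open>t\<close> compares difference
  quotients at \<open>u\<close> and \<open>v\<close>; as \<open>t\<close> tends to 0, only the term
  with \<open>edist n u v\<close> is left, with its constant 12.\<close>

lemma C11_ball_partial_deriv_Lipschitz:
  assumes h: "C11_ball n a e K h" and u: "u \<in> euclid_ball n a (e / 4)" "v \<in> euclid_ball n a (e / 4)" and i: "i < n"
  shows "\<bar>partial_deriv i h u - partial_deriv i h v\<bar> \<le> 12 * K * edist n u v"
proof (rule linear_bound_limit)
  have e: "e > 0" using u(1) edist_nonneg[of n a u] unfolding euclid_ball_def by (auto simp del: edist_nonneg)
  then show "e / 4 > 0" by simp
  have uu: "u \<in> euclid_ball n a e" "v \<in> euclid_ball n a e" using u euclid_ball_mono[of "e/4" e] e by auto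
  fix t :: real assume t: "0 < t" "t < e / 4"
  define w where "w = (\<lambda>j. t * (if j = i then 1 else 0))"
  have w: "w \<in> topspace (Euclidean_space n)" "L2_set w {..<n} = t"
    using i t unfolding w_def L2_set_scale by (auto simp: topspace_Euclidean_space L2_set_unit)
  have upd: "x(i := x i + t) = (\<lambda>j. x j + w j)" for x by (auto simp: w_def)
  have p: "\<bar>h (\<lambda>j. x j + w j) - h x - partial_deriv i h x * t\<bar> \<le> 4 * K * t\<^sup>2" if x: "x \<in> euclid_ball n a (e / 4)" for x
    using C11_ball_partial_deriv(2)[OF h _ i, of x "x i + t"] x t e euclid_ball_mono[of "e/4" e]
    by (auto simp: upd euclid_ball_def)
  have q: "\<bar>h (\<lambda>i. u i + w i) - h u - (h (\<lambda>i. v i + w i) - h v)\<bar> \<le> 12 * K * t * (t + edist n u v)"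
    using C11_ball_parallelogram[OF h u w(1)] t by (simp add: w)
  have "\<bar>partial_deriv i h u * t - partial_deriv i h v * t\<bar> \<le> 8 * K * t\<^sup>2 + 12 * K * t * (t + edist n u v)"
    using p[OF u(1)] p[OF u(2)] q by (simp add: abs_le_iff)
  also have "\<dots> = (20 * K * t + 12 * K * edist n u v) * t" by (simp add: algebra_simps power2_eq_square)
  finally have "\<bar>partial_deriv i h u - partial_deriv i h v\<bar> * t \<le> (20 * K * t + 12 * K * edist n u v) * t"
    using t by (simp add: abs_mult flip: left_diff_distrib)
  then show "\<bar>partial_deriv i h u - partial_deriv i h v\<bar> \<le> (20 * K) * t + 12 * K * edist n u v"
    using t by simp
qed

text \<open>The displacement is carried out one coordinate at a time. Step \<open>j\<close> starts
  at a shifted point; the parallelogram estimate moves it back to \<open>u\<close> at a cost of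
  \<open>24 * K * l\<^sup>2\<close>, and the expansion along the coordinate line costs
  \<open>4 * K * l\<^sup>2\<close> more, which explains the factor \<open>28 * n\<close>.\<close>

lemma C11_ball_total_deriv:
  assumes h: "C11_ball n a e K h" and u: "u \<in> euclid_ball n a (e / 8)" 
    and w: "w \<in> topspace (Euclidean_space n)" "L2_set w {..<n} < e / 8"
  shows "\<bar>h (\<lambda>i. u i + w i) - h u - (\<Sum>i<n. partial_deriv i h u * w i)\<bar> \<le> 28 * n * K * (L2_set w {..<n})\<^sup>2"
proof -
  have K: "K \<ge> 0" using h by (rule C11_ballD)
  define l where "l = L2_set w {..<n}"
  define W where "W j = (\<lambda>i. if i < j then w i else 0)" for j :: nat
  have e: "e > 0" using w L2_set_nonneg[of w "{..<n}"] by linarith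
  have u4: "u \<in> euclid_ball n a (e / 4)" "u \<in> euclid_ball n a e"
    using u e euclid_ball_mono[of "e/8" "e/4" n a] euclid_ball_mono[of "e/8" e n a] by auto
  have Wl: "L2_set (W j) {..<n} \<le> l" "W j \<in> topspace (Euclidean_space n)" for j
    unfolding l_def L2_set_def W_def using w
    by (auto intro!: real_sqrt_le_mono sum_mono simp: topspace_Euclidean_space)
  have "\<bar>h (\<lambda>i. u i + W j i) - h u - (\<Sum>i<j. partial_deriv i h u * w i)\<bar> \<le> 28 * j * K * l\<^sup>2" if "j \<le> n" for j
    using that
  proof (induction j)
    case 0
    then show ?case by (simp add: W_def)
  next
    case (Suc j)
    then have j: "j < n" by simp
    define x where "x = (\<lambda>i. u i + W j i)"
    define v where "v = (\<lambda>i. w j * (if i = j then 1 else 0))"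
    have v: "v \<in> topspace (Euclidean_space n)" "L2_set v {..<n} = \<bar>w j\<bar>"
      using j unfolding v_def L2_set_scale by (auto simp: topspace_Euclidean_space L2_set_unit)
    have wj: "\<bar>w j\<bar> \<le> l" using L2_set_component_le[OF j] l_def by blast
    have l0: "0 \<le> l" using wj by linarith
    have wj2: "(w j)\<^sup>2 \<le> l\<^sup>2" using power_mono[OF wj, of 2] by simp
    have le: "l < e / 8" using w l_def by simp
    have xe: "x \<in> euclid_ball n a (e / 4)"
      using euclid_ball_add[OF u Wl(2)[of j], of "e/8"] Wl(1)[of j] w unfolding x_def l_def by simp
    have step: "(\<lambda>i. x i + v i) = (\<lambda>i. u i + W (Suc j) i)"
      by (auto simp: x_def v_def W_def less_Suc_eq)
    have ed: "edist n x u \<le> l" using Wl(1)[of j] edist_commute[of n x u] unfolding x_def edist_add by simp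
    have "\<bar>h (\<lambda>i. x i + v i) - h x - (h (\<lambda>i. u i + v i) - h u)\<bar> \<le> 12 * K * \<bar>w j\<bar> * (\<bar>w j\<bar> + edist n x u)"
      using C11_ball_parallelogram[OF h xe u4(1) v(1)] v(2) wj le e by simp
    also have "\<dots> \<le> 12 * K * l * (l + l)"
      using wj ed K l0 by (intro mult_mono add_mono) auto
    finally have 1: "\<bar>h (\<lambda>i. x i + v i) - h x - (h (\<lambda>i. u i + v i) - h u)\<bar> \<le> 24 * (K * l\<^sup>2)"
      by (simp add: power2_eq_square)
    have "u(j := u j + w j) = (\<lambda>i. u i + v i)" by (auto simp: v_def)
    then have "\<bar>h (\<lambda>i. u i + v i) - h u - partial_deriv j h u * w j\<bar> \<le> 4 * K * (w j)\<^sup>2"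
      using C11_ball_partial_deriv(2)[OF h u4(2) j, of "u j + w j"] wj le u e by (simp add: euclid_ball_def)
    also have "\<dots> \<le> 4 * (K * l\<^sup>2)" using wj2 K by (simp add: mult_left_mono)
    finally have 2: "\<bar>h (\<lambda>i. u i + v i) - h u - partial_deriv j h u * w j\<bar> \<le> 4 * (K * l\<^sup>2)" .
    have 3: "\<bar>h x - h u - (\<Sum>i<j. partial_deriv i h u * w i)\<bar> \<le> 28 * j * K * l\<^sup>2"
      using Suc unfolding x_def by simp
    have "28 * real (Suc j) * K * l\<^sup>2 = 28 * j * K * l\<^sup>2 + 28 * (K * l\<^sup>2)" by (simp add: algebra_simps)
    then show ?case using 1 2 3 unfolding step[symmetric] sum.lessThan_Suc by (simp only: abs_le_iff) linarith
  qed
  from this[of n] have "\<bar>h (\<lambda>i. u i + W n i) - h u - (\<Sum>i<n. partial_deriv i h u * w i)\<bar> \<le> 28 * n * K * l\<^sup>2"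
    by simp
  moreover have "W n = w" using w by (auto simp: W_def topspace_Euclidean_space)
  ultimately show ?thesis by (simp add: l_def)
qed

text \<open>Along a unit-speed line the chord estimate bounds the defect from concavity by
  \<open>2 * K * m * l * (s - t)\<^sup>2\<close>, which is exactly what subtracting
  \<open>2 * K * t\<^sup>2\<close> compensates. The additional 1 makes the constant positive even
  for \<open>K = 0\<close>.\<close>

lemma C11_ball_semiconcave_on:
  assumes h: "C11_ball n a e K h" and e: "e > 0"
  shows "semiconcave_on n (euclid_ball n a e) h"
proof -
  have K: "K \<ge> 0" using h by (rule C11_ballD)
  have "locally_Lipschitz n (euclid_ball n a e) h"
    unfolding locally_Lipschitz_def 
  proof
    fix x assume "x \<in> euclid_ball n a e"
    then show "\<exists>N C. openin (Euclidean_space n) N \<and> x \<in> N \<and> N \<subseteq> euclid_ball n a e \<and>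
      (\<forall>y\<in>N. \<forall>z\<in>N. \<bar>h y - h z\<bar> \<le> C * edist n y z)"
      using C11_ballD(2)[OF h] openin_euclid_ball by (intro exI[of _ "euclid_ball n a e"] exI[of _ K]) auto
  qed
  moreover have "concave_on {c..d} (\<lambda>t. h (\<lambda>i. p i + t * u i) - (2 * K + 1) * t\<^sup>2)"
    if u: "L2_set u {..<n} = 1" and ray: "\<forall>t\<in>{c..d}. (\<lambda>i. p i + t * u i) \<in> euclid_ball n a e" for p u c d
  proof -
    have mb: "midpoint_bounded (2 * K) c d (\<lambda>t. h (\<lambda>i. p i + t * u i))"
      using C11_ball_ray[OF h, of c d p u] ray u by simp
    show ?thesis unfolding concave_on_iff
    proof (intro conjI ballI allI impI)
      fix s t m l :: real assume st: "s \<in> {c..d}" "t \<in> {c..d}" and ml: "m \<ge> 0" "l \<ge> 0" "m + l = 1"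
      define H where "H t = h (\<lambda>i. p i + t * u i)" for t
      define z where "z = m * s + l * t"
      have lin: "m * H s + l * H t \<le> H z + 2 * K * m * l * (s - t)\<^sup>2"
      proof -
        have *: "m * H s + l * H t \<le> H (m * s + l * t) + 2 * K * m * l * (s - t)\<^sup>2"
          if st: "s \<in> {c..d}" "t \<in> {c..d}" "s \<le> t" and ml: "m \<ge> 0" "l \<ge> 0" "m + l = 1" for s t m l
        proof (cases "s = t")
          case True
          then show ?thesis using ml by (simp flip: distrib_right)
        next
          case False
          then have lt: "s < t" using st by simp
          define z where "z = m * s + l * t"
          have l: "l = 1 - m" using ml by simp
          have zs: "z - s = l * (t - s)" "t - z = m * (t - s)" unfolding z_def l by (auto simp: algebra_simps)
          have "z \<in> {s..t}" using ml lt zs by (smt (verit) atLeastAtMost_iff mult_nonneg_nonneg)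
          then have "\<bar>(t - s) * H z - (t - z) * H s - (z - s) * H t\<bar> \<le> 2 * K * (z - s) * (t - z) * (t - s)"
            using midpoint_bounded_chord[OF midpoint_bounded_subinterval[OF mb, of s t], of z] st
            by (simp add: H_def)
          then have "(t - s) * (m * H s + l * H t) \<le> (t - s) * (H z + 2 * K * m * l * (s - t)\<^sup>2)"
            unfolding zs by (simp add: algebra_simps power2_eq_square abs_le_iff)
          then show ?thesis using lt by (simp add: z_def)
        qed
        show ?thesis
        proof (cases "s \<le> t")
          case True
          then show ?thesis using *[OF st True ml] by (simp add: z_def)
        next
          case False
          then have "l * H t + m * H s \<le> H (l * t + m * s) + 2 * K * l * m * (t - s)\<^sup>2"
            using *[OF st(2,1), of l m] ml by simp
          then show ?thesis by (simp add: z_def power2_commute mult_ac add_ac)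
        qed
      qed
      have "m * s\<^sup>2 + l * t\<^sup>2 - z\<^sup>2 = m * l * (s - t)\<^sup>2"
      proof -
        have "l = 1 - m" using ml(3) by simp
        show ?thesis unfolding z_def \<open>l = 1 - m\<close> by (simp add: algebra_simps power2_eq_square)
      qed
      then have sq: "z\<^sup>2 = m * s\<^sup>2 + l * t\<^sup>2 - m * l * (s - t)\<^sup>2" by simp
      have "m * l * (s - t)\<^sup>2 \<ge> 0" using ml by simp
      then have "m * (H s - (2 * K + 1) * s\<^sup>2) + l * (H t - (2 * K + 1) * t\<^sup>2) \<le> H z - (2 * K + 1) * z\<^sup>2"
        unfolding sq using lin by (simp add: algebra_simps)
      then show "m * (h (\<lambda>i. p i + s * u i) - (2 * K + 1) * s\<^sup>2) + l * (h (\<lambda>i. p i + t * u i) - (2 * K + 1) * t\<^sup>2)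
        \<le> h (\<lambda>i. p i + (m *\<^sub>R s + l *\<^sub>R t) * u i) - (2 * K + 1) * (m *\<^sub>R s + l *\<^sub>R t)\<^sup>2"
        by (simp add: H_def z_def)
    qed simp
  qed
  ultimately show ?thesis
    unfolding semiconcave_on_def using K openin_euclid_ball
    by (intro conjI ballI exI[of _ "euclid_ball n a e"] exI[of _ "2 * K + 1"]) auto
qed

text \<open>The local radius may be taken at most 1/2. Then two points of a ball are at distance at
  most 1, and the Lipschitz bound for the partial derivatives is also a 1/2-Hoelder bound.\<close>

lemma C11_regularity:
  assumes h: "\<And>x. x \<in> \<Omega> \<Longrightarrow> \<exists>e>0. \<exists>K. euclid_ball n x e \<subseteq> \<Omega> \<and> C11_ball n x e K h"
    and sub: "\<Omega> \<subseteq> topspace (Euclidean_space n)"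
  shows "C1_half_on n \<Omega> h" "DC_on n \<Omega> h"
proof -
  have lip: "\<exists>e>0. \<exists>K\<ge>0. e \<le> 1/2 \<and> euclid_ball n x e \<subseteq> \<Omega> \<and> (\<forall>y\<in>euclid_ball n x e. \<forall>z\<in>euclid_ball n x e.
      \<bar>partial_deriv i h y - partial_deriv i h z\<bar> \<le> K * edist n y z)" if x: "x \<in> \<Omega>" and i: "i < n" for x i
  proof -
    obtain e K where eK: "e > 0" "euclid_ball n x e \<subseteq> \<Omega>" "C11_ball n x e K h" using h[OF x] by blast
    define d where "d = min (e/4) (1/2)"
    have "\<bar>partial_deriv i h y - partial_deriv i h z\<bar> \<le> 12 * K * edist n y z" 
      if "y \<in> euclid_ball n x d" "z \<in> euclid_ball n x d" for y z
    proof -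
      have "d \<le> e / 4" by (simp add: d_def)
      then show ?thesis
        using C11_ball_partial_deriv_Lipschitz[OF eK(3) _ _ i, of y z] that euclid_ball_mono[of d "e/4" n x] by blast
    qed
    moreover have "d \<le> e" using eK(1) by (simp add: d_def)
    then have "euclid_ball n x d \<subseteq> \<Omega>" using eK(2) euclid_ball_mono[of d e n x] by auto
    ultimately show ?thesis using eK(1) C11_ballD(1)[OF eK(3)]
      by (intro exI[of _ d] conjI exI[of _ "12 * K"]) (auto simp: d_def)
  qed
  show "C1_half_on n \<Omega> h"
    unfolding C1_half_on_def C1_on_def
  proof (intro conjI allI impI ballI)
    fix i x assume i: "i < n" and x: "x \<in> \<Omega>"
    obtain e K where eK: "e > 0" "C11_ball n x e K h" using h[OF x] by blast
    then show "(\<lambda>t. h (x(i := t))) field_differentiable at (x i)"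
      using C11_ball_partial_deriv(1)[OF eK(2) _ i, of x] x sub by auto
  next
    fix i assume i: "i < n"
    show "continuous_map (subtopology (Euclidean_space n) \<Omega>) euclidean (partial_deriv i h)"
    proof (rule continuous_map_Euclidean_subspace)
      fix x and r :: real assume x: "x \<in> \<Omega>" and r: "r > 0"
      obtain e K where eK: "e > 0" "K \<ge> 0" "\<forall>y\<in>euclid_ball n x e. \<forall>z\<in>euclid_ball n x e.
        \<bar>partial_deriv i h y - partial_deriv i h z\<bar> \<le> K * edist n y z" using lip[OF x i] by blast
      define d where "d = min e (r / (K + 1))"
      have "dist (partial_deriv i h x) (partial_deriv i h y) < r" if y: "y \<in> \<Omega>" "edist n x y < d" for y
      proof -
        have "dist (partial_deriv i h x) (partial_deriv i h y) \<le> K * edist n x y"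
          using eK x y sub unfolding dist_real_def by (auto simp: euclid_ball_def d_def subset_iff)
        also have "\<dots> \<le> (K + 1) * edist n x y" by (intro mult_right_mono) auto
        also have "\<dots> < r" using y eK by (auto simp: d_def field_simps)
        finally show ?thesis .
      qed
      then show "\<exists>d>0. \<forall>y\<in>\<Omega>. edist n x y < d \<longrightarrow> dist (partial_deriv i h x) (partial_deriv i h y) < r"
        using eK r by (intro exI[of _ d]) (auto simp: d_def)
    qed
  next
    fix i assume i: "i < n"
    show "locally_Holder n (1 / 2) \<Omega> (partial_deriv i h)"
      unfolding locally_Holder_def
    proof
      fix x assume x: "x \<in> \<Omega>"
      obtain e K where eK: "e > 0" "K \<ge> 0" "e \<le> 1/2" "euclid_ball n x e \<subseteq> \<Omega>" "\<forall>y\<in>euclid_ball n x e. \<forall>z\<in>euclid_ball n x e.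
        \<bar>partial_deriv i h y - partial_deriv i h z\<bar> \<le> K * edist n y z" using lip[OF x i] by blast
      have "\<bar>partial_deriv i h y - partial_deriv i h z\<bar> \<le> K * edist n y z powr (1 / 2)"
        if yz: "y \<in> euclid_ball n x e" "z \<in> euclid_ball n x e" for y z
      proof -
        have "edist n y z \<le> 1" using yz eK(3) edist_triangle[of n y z x] edist_commute[of n x y]
          by (auto simp: euclid_ball_def)
        then have "edist n y z \<le> edist n y z powr (1 / 2)"
          by (rule le_powr_half[OF edist_nonneg])
        then have "K * edist n y z \<le> K * edist n y z powr (1 / 2)" using eK by (intro mult_left_mono)
        then show ?thesis using eK(5) yz by (meson order_trans)
      qed
      then show "\<exists>N C. openin (Euclidean_space n) N \<and> x \<in> N \<and> N \<subseteq> \<Omega> \<and>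
         (\<forall>y\<in>N. \<forall>z\<in>N. \<bar>partial_deriv i h y - partial_deriv i h z\<bar> \<le> C * edist n y z powr (1 / 2))"
        using eK x sub openin_euclid_ball by (intro exI[of _ "euclid_ball n x e"] exI[of _ K]) auto
    qed
  qed
  show "DC_on n \<Omega> h"
    unfolding DC_on_def
  proof
    fix x assume x: "x \<in> \<Omega>"
    obtain e K where eK: "e > 0" "euclid_ball n x e \<subseteq> \<Omega>" "C11_ball n x e K h" using h[OF x] by blast
    \<comment> \<open>As \<open>h\<close> is itself semiconcave, the zero function can be the one
      subtracted.\<close>
    have "C11_ball n x e 0 (\<lambda>_. 0)" by (simp add: C11_ball_def)
    then show "\<exists>N g k. openin (Euclidean_space n) N \<and> x \<in> N \<and> N \<subseteq> \<Omega> \<and>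
      semiconcave_on n N g \<and> semiconcave_on n N k \<and> (\<forall>y\<in>N. h y = g y - k y)"
      using eK x sub openin_euclid_ball C11_ball_semiconcave_on[OF _ eK(1)]
      by (intro exI[of _ "euclid_ball n x e"] exI[of _ h] exI[of _ "\<lambda>_. 0"]) auto
  qed
qed

section \<open>Distance functions of semiconcave G-spaces\<close>

definition is_midpoint :: "'a::metric_space \<Rightarrow> 'a \<Rightarrow> 'a \<Rightarrow> bool" where
  "is_midpoint m x y \<longleftrightarrow> dist x m = dist x y / 2 \<and> dist m y = dist x y / 2"

text \<open>The counterpart of \<open>C11_ball\<close> on the space. The midpoint is required to lie
  in \<open>S\<close>, because a shortest path between points of \<open>S\<close> may leave
  \<open>S\<close>.\<close>

definition almost_affine :: "'a::metric_space set \<Rightarrow> real \<Rightarrow> ('a \<Rightarrow> real) \<Rightarrow> bool" where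
  "almost_affine S C f \<longleftrightarrow> 0 \<le> C \<and> (\<forall>x\<in>S. \<forall>y\<in>S. \<bar>f x - f y\<bar> \<le> C * dist x y) \<and>
    (\<forall>x\<in>S. \<forall>y\<in>S. \<forall>m\<in>S. is_midpoint m x y \<longrightarrow> \<bar>f x + f y - 2 * f m\<bar> \<le> C * (dist x y)\<^sup>2)"

lemma almost_affineD:
  assumes "almost_affine S C f"
  shows "0 \<le> C" "x \<in> S \<Longrightarrow> y \<in> S \<Longrightarrow> \<bar>f x - f y\<bar> \<le> C * dist x y"
    "x \<in> S \<Longrightarrow> y \<in> S \<Longrightarrow> m \<in> S \<Longrightarrow> is_midpoint m x y \<Longrightarrow> \<bar>f x + f y - 2 * f m\<bar> \<le> C * (dist x y)\<^sup>2"
  using assms unfolding almost_affine_def by auto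

lemma almost_affine_mono:
  assumes "almost_affine S C f" "T \<subseteq> S" "C \<le> C'"
  shows "almost_affine T C' f"
  unfolding almost_affine_def
proof (intro conjI ballI impI)
  show "0 \<le> C'" using almost_affineD(1)[OF assms(1)] assms(3) by simp
  have *: "C * z \<le> C' * z" if "z \<ge> 0" for z using that assms(3) by (rule mult_right_mono[rotated])
  fix x y assume xy: "x \<in> T" "y \<in> T"
  show "\<bar>f x - f y\<bar> \<le> C' * dist x y"
    using almost_affineD(2)[OF assms(1), of x y] xy assms(2) *[of "dist x y"] by force
  fix m assume "m \<in> T" "is_midpoint m x y"
  then show "\<bar>f x + f y - 2 * f m\<bar> \<le> C' * (dist x y)\<^sup>2"
    using almost_affineD(3)[OF assms(1), of x y m] xy assms(2) *[of "(dist x y)\<^sup>2"] by force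
qed

lemma shortest_path_dist:
  "shortest_path a b \<gamma> \<Longrightarrow> s \<in> {a..b} \<Longrightarrow> t \<in> {a..b} \<Longrightarrow> dist (\<gamma> s) (\<gamma> t) = \<bar>s - t\<bar>"
  by (auto simp: shortest_path_def)

lemma shortest_path_shift:
  "shortest_path a b \<gamma> \<Longrightarrow> shortest_path (a - c) (b - c) (\<lambda>t. \<gamma> (t + c))"
  by (auto simp: shortest_path_def)

lemma shortest_path_join:
  assumes 1: "shortest_path a b \<gamma>" and 2: "shortest_path b c \<delta>" and eq: "\<gamma> b = \<delta> b"
    and d: "dist (\<gamma> a) (\<delta> c) = c - a"
  shows "shortest_path a c (\<lambda>t. if t \<le> b then \<gamma> t else \<delta> t)"
proof -
  have ab: "a \<le> b" "b \<le> c" using 1 2 by (auto simp: shortest_path_def)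
  have m: "dist (\<gamma> s) (\<delta> t) = t - s" if s: "s \<in> {a..b}" and t: "t \<in> {b..c}" for s t
  proof (rule antisym)
    have "dist (\<gamma> s) (\<delta> t) \<le> dist (\<gamma> s) (\<gamma> b) + dist (\<delta> b) (\<delta> t)"
      using dist_triangle[of "\<gamma> s" "\<delta> t" "\<gamma> b"] eq by simp
    also have "\<dots> = t - s"
      using shortest_path_dist[OF 1 s, of b] shortest_path_dist[OF 2 _ t, of b] ab s t by simp
    finally show "dist (\<gamma> s) (\<delta> t) \<le> t - s" .
    have "c - a \<le> dist (\<gamma> a) (\<gamma> s) + dist (\<gamma> s) (\<delta> t) + dist (\<delta> t) (\<delta> c)"
      using d dist_triangle[of "\<gamma> a" "\<delta> c" "\<gamma> s"] dist_triangle[of "\<gamma> s" "\<delta> c" "\<delta> t"] by linarith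
    then show "t - s \<le> dist (\<gamma> s) (\<delta> t)"
      using shortest_path_dist[OF 1 _ s, of a] shortest_path_dist[OF 2 t, of c] ab s t by simp
  qed
  show ?thesis
    unfolding shortest_path_def
  proof (intro conjI ballI)
    show "a \<le> c" using ab by simp
    fix s t assume st: "s \<in> {a..c}" "t \<in> {a..c}"
    show "dist (if s \<le> b then \<gamma> s else \<delta> s) (if t \<le> b then \<gamma> t else \<delta> t) = \<bar>s - t\<bar>"
      using st shortest_path_dist[OF 1, of s t] shortest_path_dist[OF 2, of s t] m[of s t] m[of t s]
      by (auto simp: dist_commute)
  qed
qed

lemma almost_affine_shortest_path:
  assumes f: "almost_affine S C f" and \<gamma>: "shortest_path a b \<gamma>" and S: "\<gamma> ` {a..b} \<subseteq> S"
  shows "midpoint_bounded (2 * C) a b (f \<circ> \<gamma>)"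
  unfolding midpoint_bounded_def
proof (intro conjI allI impI)
  have "C-lipschitz_on {a..b} (f \<circ> \<gamma>)"
  proof (rule lipschitz_onI)
    fix s t assume "s \<in> {a..b}" "t \<in> {a..b}"
    then show "dist ((f \<circ> \<gamma>) s) ((f \<circ> \<gamma>) t) \<le> C * dist s t"
      using almost_affineD(2)[OF f, of "\<gamma> s" "\<gamma> t"] S shortest_path_dist[OF \<gamma>, of s t]
      by (simp add: dist_real_def image_subset_iff)
  qed (rule almost_affineD(1)[OF f])
  then show "continuous_on {a..b} (f \<circ> \<gamma>)" by (rule lipschitz_on_continuous_on)
  fix s h :: real assume h: "0 < h" "a \<le> s - h" "s + h \<le> b"
  then have "is_midpoint (\<gamma> s) (\<gamma> (s + h)) (\<gamma> (s - h))"
    using shortest_path_dist[OF \<gamma>] by (auto simp: is_midpoint_def)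
  moreover have "dist (\<gamma> (s + h)) (\<gamma> (s - h)) = 2 * h" using h shortest_path_dist[OF \<gamma>] by auto
  ultimately show "\<bar>(f \<circ> \<gamma>) (s + h) + (f \<circ> \<gamma>) (s - h) - 2 * (f \<circ> \<gamma>) s\<bar> \<le> 2 * (2 * C) * h\<^sup>2"
    using almost_affineD(3)[OF f, of "\<gamma> (s + h)" "\<gamma> (s - h)" "\<gamma> s"] S h 
    by (simp add: power_mult_distrib image_subset_iff)
qed

section \<open>Shortest paths, compactness and local extension\<close>

locale semiconcave_G_space =
  fixes space_type :: "'a::metric_space itself"
  assumes G_space: "G_space TYPE('a)"
    and semiconcave: "locally_semiconcave_space TYPE('a)"
begin

lemma geodesic_exists:
  obtains \<gamma> where "shortest_path 0 (dist x y) \<gamma>" "\<gamma> 0 = (x::'a)" "\<gamma> (dist x y) = y"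
proof -
  obtain a b \<gamma> where \<gamma>: "shortest_path a b \<gamma>" "\<gamma> a = x" "\<gamma> b = y"
    using semiconcave unfolding locally_semiconcave_space_def geodesic_space_def by blast
  have "dist x y = b - a" using shortest_path_dist[OF \<gamma>(1), of a b] \<gamma> by (auto simp: shortest_path_def)
  then show thesis
    using shortest_path_shift[OF \<gamma>(1), of a] \<gamma> that[of "\<lambda>t. \<gamma> (t + a)"] by simp
qed

lemma point_between:
  assumes "0 \<le> s" "s \<le> dist x y"
  obtains z :: 'a where "dist x z = s" "dist z y = dist x y - s"
proof -
  obtain \<gamma> where \<gamma>: "shortest_path 0 (dist x y) \<gamma>" "\<gamma> 0 = x" "\<gamma> (dist x y) = y"
    by (rule geodesic_exists)
  show thesis using shortest_path_dist[OF \<gamma>(1), of 0 s] shortest_path_dist[OF \<gamma>(1), of s "dist x y"]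
    assms \<gamma>(2,3) by (intro that[of "\<gamma> s"]) auto
qed

lemma midpoint_exists: obtains m :: 'a where "is_midpoint m x y"
  using point_between[of "dist x y / 2" x y] by (auto simp: is_midpoint_def field_simps)

lemma geodesic_through:
  assumes "dist x y + dist y z = dist x (z::'a)"
  obtains \<gamma> where "shortest_path 0 (dist x z) \<gamma>" "\<gamma> 0 = x" "\<gamma> (dist x y) = y" "\<gamma> (dist x z) = z"
proof -
  obtain \<gamma> where \<gamma>: "shortest_path 0 (dist x y) \<gamma>" "\<gamma> 0 = x" "\<gamma> (dist x y) = y"
    by (rule geodesic_exists)
  obtain \<delta> where \<delta>: "shortest_path 0 (dist y z) \<delta>" "\<delta> 0 = y" "\<delta> (dist y z) = z"
    by (rule geodesic_exists)
  have \<delta>': "shortest_path (dist x y) (dist x z) (\<lambda>t. \<delta> (t - dist x y))"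
    using shortest_path_shift[OF \<delta>(1), of "- dist x y"] assms by (simp add: add.commute)
  have zy: "dist x z - dist x y = dist y z" using assms by simp
  from shortest_path_join[OF \<gamma>(1) \<delta>'] 
  have "shortest_path 0 (dist x z) (\<lambda>t. if t \<le> dist x y then \<gamma> t else \<delta> (t - dist x y))"
    using \<gamma> \<delta> assms zy by simp
  moreover have "(if dist x z \<le> dist x y then \<gamma> (dist x z) else \<delta> (dist x z - dist x y)) = z"
  proof (cases "y = z")
    case False
    then have "\<not> dist x z \<le> dist x y" using assms zero_less_dist_iff[of y z] by linarith
    then show ?thesis using \<delta> zy by simp
  qed (use \<gamma> in simp)
  ultimately show thesis using \<gamma>
    by (intro that[of "\<lambda>t. if t \<le> dist x y then \<gamma> t else \<delta> (t - dist x y)"]) auto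
qed

text \<open>The second G-space axiom is a Bolzano-Weierstrass property, and a closed ball contains
  the accumulation points of its subsets.\<close>

lemma compact_cball: "compact (cball (x::'a) r)"
proof -
  have "\<exists>y. y islimpt S" if "bounded S" "infinite S" for S :: "'a set"
    using G_space that unfolding G_space_def by blast
  then have "\<exists>y\<in>cball x r. y islimpt S" if "infinite S" "S \<subseteq> cball x r" for S
    using that bounded_subset[OF bounded_cball] closed_cball[of x r] closed_limpt islimpt_subset by metis
  then show ?thesis unfolding compact_eq_Bolzano_Weierstrass by blast
qed

text \<open>By compactness a longest extension inside the ball exists, and it can only end on the sphere.\<close>

lemma local_extension:
  obtains \<rho> where "\<rho> > 0"
    "\<And>r x y. r \<le> \<rho> \<Longrightarrow> x \<in> cball x0 \<rho> \<Longrightarrow> y \<in> cball x0 r \<Longrightarrow> x \<noteq> y \<Longrightarrow>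
      \<exists>z. dist x0 z = r \<and> dist x y + dist y z = dist x (z::'a)"
proof -
  obtain U where U: "open U" "x0 \<in> U"
    "\<And>x y. x \<in> U \<Longrightarrow> y \<in> U \<Longrightarrow> \<exists>z\<in>U - {x, y}. dist x y + dist y z = dist x z"
    using G_space unfolding G_space_def by metis
  obtain \<rho> where \<rho>: "\<rho> > 0" "cball x0 \<rho> \<subseteq> U" using U open_contains_cball by blast
  have "\<exists>z. dist x0 z = r \<and> dist x y + dist y z = dist x z"
    if r: "r \<le> \<rho>" and x: "x \<in> cball x0 \<rho>" and y: "y \<in> cball x0 r" "x \<noteq> y" for x y r
  proof -
    define S where "S = cball x0 r \<inter> {z. dist x y + dist y z = dist x z}"
    have "closed {z. dist x y + dist y z = dist x z}" by (intro closed_Collect_eq continuous_intros)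
    then have S: "compact S" unfolding S_def by (intro compact_Int_closed compact_cball)
    have "y \<in> S" using y unfolding S_def by simp
    then obtain z where z: "z \<in> S" "\<And>w. w \<in> S \<Longrightarrow> dist y w \<le> dist y z"
      using continuous_attains_sup[OF S, of "dist y"] continuous_on_dist[OF continuous_on_const continuous_on_id, of S y] by auto
    have ex: "dist x y + dist y z = dist x z" "dist x0 z \<le> r" using z by (auto simp: S_def)
    have "dist x0 z = r"
    proof (rule ccontr)
      assume "dist x0 z \<noteq> r"
      then have zi: "dist x0 z < r" using ex by simp
      have "x \<in> U" "z \<in> U" using \<rho> x ex r by auto
      then obtain v where v: "v \<in> U" "v \<noteq> z" "dist x z + dist z v = dist x v" using U(3) by blast
      \<comment> \<open>The extension beyond \<open>z\<close> is cut off after length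
        \<open>s\<close> so that it stays in the ball; it still prolongs the path from
        \<open>x\<close> through \<open>y\<close>, against the choice of \<open>z\<close> as
        farthest from \<open>y\<close>.\<close>
      define s where "s = min (dist z v) (r - dist x0 z)"
      have s: "s > 0" "s \<le> dist z v" "s \<le> r - dist x0 z" using v zi by (auto simp: s_def)
      obtain w where w: "dist z w = s" "dist w v = dist z v - s" using point_between[of s z v] s by auto
      have 1: "dist x w \<ge> dist x z + s"
        using dist_triangle[of x v w] v(3) w by linarith
      have 2: "dist y w \<ge> dist y z + s" using 1 dist_triangle[of x w y] ex by linarith
      have 3: "dist y w \<le> dist y z + s" "dist x w \<le> dist x z + s"
        using dist_triangle[of y w z] dist_triangle[of x w z] w by auto
      have "dist x0 w \<le> r" using dist_triangle[of x0 w z] w s by linarith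
      then have "w \<in> S" unfolding S_def using 1 2 3 ex by simp
      then show False using z(2)[of w] 2 s by simp
    qed
    then show ?thesis using ex by blast
  qed
  then show thesis using \<rho>(1) that by blast
qed

lemma local_semiconcavity:
  obtains \<rho> L where "\<rho> > 0" "L \<ge> 0"
    "\<And>p y z m. dist x0 p < \<rho> \<Longrightarrow> dist x0 y < \<rho> / 2 \<Longrightarrow> dist x0 z < \<rho> / 2 \<Longrightarrow> is_midpoint m y (z::'a) \<Longrightarrow>
      (dist p y)\<^sup>2 + (dist p z)\<^sup>2 \<le> 2 * (dist p m)\<^sup>2 + L * (dist y z)\<^sup>2"
proof -
  obtain l U where U: "open U" "x0 \<in> U"
    "\<And>p a b \<gamma>. p \<in> U \<Longrightarrow> shortest_path a b \<gamma> \<Longrightarrow> \<gamma> ` {a..b} \<subseteq> U \<Longrightarrow>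
        concave_on {a..b} (\<lambda>t. (dist p (\<gamma> t))\<^sup>2 - l * t\<^sup>2)"
    using semiconcave unfolding locally_semiconcave_space_def by metis
  obtain \<rho> where \<rho>: "\<rho> > 0" "ball x0 \<rho> \<subseteq> U" using U open_contains_ball by blast
  have main: "(dist p y)\<^sup>2 + (dist p z)\<^sup>2 \<le> 2 * (dist p m)\<^sup>2 + \<bar>l\<bar> * (dist y z)\<^sup>2"
    if p: "dist x0 p < \<rho>" and yz: "dist x0 y < \<rho> / 2" "dist x0 z < \<rho> / 2" and m: "is_midpoint m y z" for p y z m
  proof -
    define d where "d = dist y z / 2"
    have "dist y m + dist m z = dist y z" using m by (auto simp: is_midpoint_def)
    then obtain \<gamma> where \<gamma>: "shortest_path 0 (dist y z) \<gamma>" "\<gamma> 0 = y" "\<gamma> (dist y m) = m" "\<gamma> (dist y z) = z"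
      by (rule geodesic_through)
    \<comment> \<open>Averaging the bounds through \<open>y\<close> and through \<open>z\<close>
      gives \<open>dist x0 (\<gamma> t) < \<rho>\<close>; this is why \<open>y\<close> and
      \<open>z\<close> come from the ball of half the radius.\<close>
    have "\<gamma> t \<in> ball x0 \<rho>" if t: "t \<in> {0..dist y z}" for t
    proof -
      have "dist y (\<gamma> t) = t" "dist (\<gamma> t) z = dist y z - t"
        using shortest_path_dist[OF \<gamma>(1), of 0 t] shortest_path_dist[OF \<gamma>(1), of t "dist y z"] t \<gamma> by auto
      then show ?thesis
        using dist_triangle[of x0 "\<gamma> t" y] dist_triangle[of x0 "\<gamma> t" z] dist_triangle[of y z x0] yz
        by (simp add: dist_commute)
    qed
    then have *: "concave_on {0..dist y z} (\<lambda>t. (dist p (\<gamma> t))\<^sup>2 - l * t\<^sup>2)"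
      using \<rho> p by (intro U(3) \<gamma>(1)) auto
    have "(dist p y)\<^sup>2 + ((dist p z)\<^sup>2 - l * (2 * d)\<^sup>2) \<le> 2 * ((dist p m)\<^sup>2 - l * d\<^sup>2)"
    proof -
      have 1: "dist y z / 2 = d" "dist y z = 2 * d" "dist y m = d"
        using m by (simp_all add: d_def is_midpoint_def)
      have "\<gamma> d = m" using \<gamma>(3) unfolding 1(3) .
      show ?thesis
        using concave_onD[OF *, of "1/2" 0 "dist y z"] \<gamma>(2,4) \<open>\<gamma> d = m\<close> 1(1,2) zero_le_dist[of y z] by (simp add: field_simps)
    qed
    then have "(dist p y)\<^sup>2 + (dist p z)\<^sup>2 \<le> 2 * (dist p m)\<^sup>2 + 2 * l * d\<^sup>2"
      by (simp add: power_mult_distrib algebra_simps)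
    also have "2 * l * d\<^sup>2 \<le> \<bar>l\<bar> * (dist y z)\<^sup>2"
    proof -
      have "l * (dist y z)\<^sup>2 \<le> \<bar>l\<bar> * (dist y z)\<^sup>2" by (intro mult_right_mono) auto
      moreover have "0 \<le> \<bar>l\<bar> * (dist y z)\<^sup>2" by simp
      moreover have "2 * l * d\<^sup>2 = l * (dist y z)\<^sup>2 / 2" by (simp add: d_def power_divide)
      ultimately show ?thesis by linarith
    qed
    finally show ?thesis by simp
  qed
  show thesis by (rule that[OF \<rho>(1) abs_ge_zero[of l] main])
qed

end

text \<open>From \<open>(a + b)\<^sup>2 \<le> 2 * (a\<^sup>2 + b\<^sup>2)\<close> and a completed
  square. Taking the root costs a division by \<open>m\<close>, so the passage from squared
  distances to distances is of use only where these are bounded below.\<close>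

lemma sum_le_of_squares_bound:
  fixes a b m c :: real
  assumes "a\<^sup>2 + b\<^sup>2 \<le> 2 * m\<^sup>2 + c" "m > 0" "c \<ge> 0"
  shows "a + b \<le> 2 * m + c / (2 * m)"
proof -
  have "(a + b)\<^sup>2 \<le> 2 * (a\<^sup>2 + b\<^sup>2)"
    using zero_le_power2[of "a - b"] by (simp add: power2_eq_square algebra_simps)
  also have "\<dots> \<le> 4 * m\<^sup>2 + 2 * c" using assms(1) by simp
  also have "\<dots> \<le> (2 * m + c / (2 * m))\<^sup>2"
    using assms(2) by (simp add: power2_sum power2_eq_square field_simps)
  finally show ?thesis by (rule power2_le_imp_le) (use assms in simp)
qed

context semiconcave_G_space
begin

text \<open>The upper estimate \<open>far\<close> needs \<open>q\<close> away from \<open>m\<close>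
  because of the square root. The lower estimate \<open>near\<close> holds for every
  \<open>p\<close> of the closed ball of radius \<open>R\<close>, even one close to
  \<open>m\<close>, since the opposite point on the sphere of radius \<open>2 * R\<close> is always
  far from \<open>m\<close>. For \<open>p\<close> close to \<open>x0\<close> the upper estimate is
  therefore taken for the squared distance, and the lower one for the square follows from
  \<open>near\<close>.\<close>

lemma local_distance_estimates:
  obtains R r K where "0 < r" "4 * r \<le> R" "0 \<le> K"
    "\<And>p. dist x0 p = R \<Longrightarrow> almost_affine (ball (x0::'a) r) K (dist p)"
    "\<And>p. p \<in> ball x0 r \<Longrightarrow> almost_affine (ball x0 r) K (\<lambda>x. (dist p x)\<^sup>2)"
    "\<And>x y. x \<in> ball x0 r \<Longrightarrow> y \<in> ball x0 r \<Longrightarrow> x \<noteq> y \<Longrightarrow>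
      \<exists>z. dist x0 z = R \<and> dist x y + dist y z = dist x z"
proof -
  obtain \<rho>1 where \<rho>1: "\<rho>1 > 0"
    "\<And>r x y. r \<le> \<rho>1 \<Longrightarrow> x \<in> cball x0 \<rho>1 \<Longrightarrow> y \<in> cball x0 r \<Longrightarrow> x \<noteq> y \<Longrightarrow>
      \<exists>z. dist x0 z = r \<and> dist x y + dist y z = dist x z"
    using local_extension[of x0] by blast
  obtain \<rho>2 L where \<rho>2: "\<rho>2 > 0" "L \<ge> 0"
    "\<And>p y z m. dist x0 p < \<rho>2 \<Longrightarrow> dist x0 y < \<rho>2 / 2 \<Longrightarrow> dist x0 z < \<rho>2 / 2 \<Longrightarrow> is_midpoint m y z \<Longrightarrow>
      (dist p y)\<^sup>2 + (dist p z)\<^sup>2 \<le> 2 * (dist p m)\<^sup>2 + L * (dist y z)\<^sup>2"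
    using local_semiconcavity by blast
  \<comment> \<open>\<open>2 * R \<le> \<rho>1\<close> lets shortest paths be prolonged up to the
    sphere of radius \<open>2 * R\<close>, and \<open>2 * R < \<rho>2\<close> makes semiconcavity
    available for distances from its points.\<close>
  define R where "R = min (\<rho>1 / 2) (\<rho>2 / 4)"
  define r where "r = R / 4"
  have R: "R > 0" "2 * R \<le> \<rho>1" "2 * R < \<rho>2" using \<rho>1 \<rho>2 by (auto simp: R_def)
  have r: "r > 0" "4 * r = R" using R by (auto simp: r_def)
  \<comment> \<open>Covers the four constants needed below: \<open>L / R\<close> and 1 for distance
    functions, \<open>L\<close> and \<open>R\<close> for their squares.\<close>
  define K where "K = 2 * L / R + 2 * L + R + 1"
  have "L / R \<ge> 0" using R \<rho>2 by simp
  then have K: "2 * L / R \<le> K" "L \<le> K" "R \<le> K" "1 \<le> K" "0 \<le> K" using R \<rho>2 unfolding K_def by auto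
  have sc: "(dist p y)\<^sup>2 + (dist p z)\<^sup>2 \<le> 2 * (dist p m)\<^sup>2 + L * (dist y z)\<^sup>2"
    if "dist x0 p \<le> 2 * R" "y \<in> ball x0 r" "z \<in> ball x0 r" "is_midpoint m y z" for p y z m
    using that R r by (intro \<rho>2(3)) auto
  have far: "dist q y + dist q z \<le> 2 * dist q m + (L / R) * (dist y z)\<^sup>2"
    if q: "dist x0 q \<le> 2 * R" "dist q m \<ge> R / 2" and yz: "y \<in> ball x0 r" "z \<in> ball x0 r" "is_midpoint m y z" for q y z m
  proof -
    have "dist q y + dist q z \<le> 2 * dist q m + (L * (dist y z)\<^sup>2) / (2 * dist q m)"
      by (rule sum_le_of_squares_bound[OF sc[OF q(1) yz]]) (use q R \<rho>2 in auto)
    also have "(L * (dist y z)\<^sup>2) / (2 * dist q m) \<le> (L * (dist y z)\<^sup>2) / R"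
      using q R \<rho>2(2) by (intro divide_left_mono mult_nonneg_nonneg mult_pos_pos) auto
    finally show ?thesis by simp
  qed
  have near: "dist p y + dist p z \<ge> 2 * dist p m - (L / R) * (dist y z)\<^sup>2"
    if p: "dist x0 p \<le> R" and yz: "y \<in> ball x0 r" "z \<in> ball x0 r" "m \<in> ball x0 r" "is_midpoint m y z" for p y z m
  proof (cases "p = m")
    case True
    have "0 \<le> (L / R) * (dist y z)\<^sup>2" using R \<rho>2 by simp
    then show ?thesis using True by (smt (verit) dist_self zero_le_dist)
  next
    case False
    then obtain q where q: "dist x0 q = 2 * R" "dist p m + dist m q = dist p q"
      using \<rho>1(2)[of "2 * R" p m] R p yz(3) r by auto
    have "dist q m \<ge> R / 2" using dist_triangle[of x0 q m] q yz(3) r by (simp add: dist_commute)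
    then have "dist q y + dist q z \<le> 2 * dist q m + (L / R) * (dist y z)\<^sup>2"
      using q yz by (intro far) auto
    then show ?thesis using q dist_triangle[of p q y] dist_triangle[of p q z] by (simp add: dist_commute)
  qed
  show thesis
  proof (rule that[of r R K])
    show "almost_affine (ball x0 r) K (dist p)" if p: "dist x0 p = R" for p
      unfolding almost_affine_def
    proof (intro conjI ballI impI)
      show "0 \<le> K" by (rule K)
      fix x y assume xy: "x \<in> ball x0 r" "y \<in> ball x0 r"
      have "\<bar>dist p x - dist p y\<bar> \<le> 1 * dist x y"
        using dist_triangle[of p x y] dist_triangle[of p y x] by (simp add: dist_commute abs_le_iff)
      also have "\<dots> \<le> K * dist x y" using K by (intro mult_right_mono) auto
      finally show "\<bar>dist p x - dist p y\<bar> \<le> K * dist x y" .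
      fix m assume m: "m \<in> ball x0 r" "is_midpoint m x y"
      have "dist p m \<ge> R / 2" using dist_triangle[of x0 p m] p m r by (simp add: dist_commute)
      then have "\<bar>dist p x + dist p y - 2 * dist p m\<bar> \<le> L / R * (dist x y)\<^sup>2"
        using far[of p m x y] near[of p x y m] p xy m R by (simp add: abs_le_iff)
      also have "\<dots> \<le> K * (dist x y)\<^sup>2" using K \<open>L / R \<ge> 0\<close> by (intro mult_right_mono) auto
      finally show "\<bar>dist p x + dist p y - 2 * dist p m\<bar> \<le> K * (dist x y)\<^sup>2" .
    qed
    show "almost_affine (ball x0 r) K (\<lambda>x. (dist p x)\<^sup>2)" if p: "p \<in> ball x0 r" for p
      unfolding almost_affine_def
    proof (intro conjI ballI impI)
      show "0 \<le> K" by (rule K)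
      have le: "dist p x \<le> R / 2" if "x \<in> ball x0 r" for x
        using dist_triangle[of p x x0] p that r by (simp add: dist_commute)
      fix x y assume xy: "x \<in> ball x0 r" "y \<in> ball x0 r"
      have "\<bar>(dist p x)\<^sup>2 - (dist p y)\<^sup>2\<bar> = \<bar>dist p x - dist p y\<bar> * (dist p x + dist p y)"
        by (simp add: power2_eq_square square_diff_square_factored abs_mult)
      also have "\<dots> \<le> dist x y * R"
        using dist_triangle[of p x y] dist_triangle[of p y x] le[OF xy(1)] le[OF xy(2)]
        by (intro mult_mono) (auto simp: dist_commute abs_le_iff)
      also have "\<dots> = R * dist x y" by simp
      also have "\<dots> \<le> K * dist x y" using K by (intro mult_right_mono) auto
      finally show "\<bar>(dist p x)\<^sup>2 - (dist p y)\<^sup>2\<bar> \<le> K * dist x y" .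
      fix m assume m: "m \<in> ball x0 r" "is_midpoint m x y"
      have u: "(dist p x)\<^sup>2 + (dist p y)\<^sup>2 - 2 * (dist p m)\<^sup>2 \<le> L * (dist x y)\<^sup>2"
        using sc[of p x y m] p xy m r R by simp
      define e where "e = L / R * (dist x y)\<^sup>2"
      have e: "e \<ge> 0" using mult_nonneg_nonneg[OF \<open>L / R \<ge> 0\<close> zero_le_power2] unfolding e_def .
      have n: "dist p x + dist p y \<ge> 2 * dist p m - e"
        unfolding e_def using near[of p x y m] p xy m r by simp
      have sq: "(dist p x + dist p y)\<^sup>2 \<le> 2 * ((dist p x)\<^sup>2 + (dist p y)\<^sup>2)"
        using zero_le_power2[of "dist p x - dist p y"] by (simp add: power2_eq_square algebra_simps)
      have "2 * (dist p m)\<^sup>2 - 2 * dist p m * e \<le> (dist p x)\<^sup>2 + (dist p y)\<^sup>2"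
      \<comment> \<open>The estimate \<open>n\<close> can be squared only while its right side is
        nonnegative; in the other case the left side of the claim is at most 0.\<close>
      proof (cases "2 * dist p m \<le> e")
        case True
        then have "dist p m * (2 * dist p m) \<le> dist p m * e" by (intro mult_left_mono) auto
        moreover have "0 \<le> dist p m * e" using e by simp
        ultimately have "2 * (dist p m)\<^sup>2 - 2 * dist p m * e \<le> 0" by (simp add: power2_eq_square)
        then show ?thesis by (smt (verit) zero_le_power2)
      next
        case False
        then have "(2 * dist p m - e)\<^sup>2 \<le> (dist p x + dist p y)\<^sup>2" using n by (intro power_mono) auto
        then have "(2 * dist p m - e)\<^sup>2 \<le> 2 * ((dist p x)\<^sup>2 + (dist p y)\<^sup>2)" using sq by simp
        moreover have "(2 * dist p m - e)\<^sup>2 = 4 * (dist p m)\<^sup>2 - 4 * (dist p m * e) + e\<^sup>2"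
          by (simp add: power2_eq_square algebra_simps)
        ultimately have "4 * (dist p m)\<^sup>2 - 4 * (dist p m * e) \<le> 2 * ((dist p x)\<^sup>2 + (dist p y)\<^sup>2)"
          using zero_le_power2[of e] by linarith
        then show ?thesis by simp
      qed
      moreover have "2 * dist p m * e \<le> R * e" using le[OF m(1)] e by (intro mult_right_mono) auto
      \<comment> \<open>The factor \<open>R\<close>, from the size of \<open>2 * dist p m\<close>,
        cancels the denominator of \<open>e\<close>.\<close>
      moreover have "R * e = L * (dist x y)\<^sup>2" unfolding e_def using R by simp
      ultimately have "\<bar>(dist p x)\<^sup>2 + (dist p y)\<^sup>2 - 2 * (dist p m)\<^sup>2\<bar> \<le> L * (dist x y)\<^sup>2"
        using u by (simp add: abs_le_iff)
      also have "\<dots> \<le> K * (dist x y)\<^sup>2" using K by (intro mult_right_mono) auto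
      finally show "\<bar>(dist p x)\<^sup>2 + (dist p y)\<^sup>2 - 2 * (dist p m)\<^sup>2\<bar> \<le> K * (dist x y)\<^sup>2" .
    qed
    show "\<exists>z. dist x0 z = R \<and> dist x y + dist y z = dist x z" if "x \<in> ball x0 r" "y \<in> ball x0 r" "x \<noteq> y" for x y
      using \<rho>1(2)[of R x y] that R r by auto
  qed (use r K in auto)
qed

end

section \<open>Transition maps\<close>

lemma C11_ball_cong:
  assumes "\<And>u. u \<in> euclid_ball n a e \<Longrightarrow> h u = h' u"
  shows "C11_ball n a e K h \<longleftrightarrow> C11_ball n a e K h'"
proof -
  have mid: "(\<lambda>i. (u i + v i) / 2) \<in> euclid_ball n a e" if "u \<in> euclid_ball n a e" "v \<in> euclid_ball n a e" for u v
  proof -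
    have "(\<lambda>i. (u i + v i) / 2) = (\<lambda>i. u i + 1/2 * (v i - u i))" by (auto simp: field_simps)
    then show ?thesis using euclid_ball_segment[OF that, of "1/2"] by simp
  qed
  show ?thesis unfolding C11_ball_def using assms mid by auto
qed

definition locally_almost_affine :: "'a::metric_space set \<Rightarrow> ('a \<Rightarrow> real) \<Rightarrow> bool" where
  "locally_almost_affine V f \<longleftrightarrow> (\<forall>x\<in>V. \<exists>d>0. \<exists>C. ball x d \<subseteq> V \<and> almost_affine (ball x d) C f)"

lemma locally_almost_affineI:
  assumes "open V" "almost_affine V C f"
  shows "locally_almost_affine V f"
  unfolding locally_almost_affine_def
proof
  fix x assume "x \<in> V"
  then obtain d where "d > 0" "ball x d \<subseteq> V" using assms(1) open_contains_ball by blast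
  then show "\<exists>d>0. \<exists>C. ball x d \<subseteq> V \<and> almost_affine (ball x d) C f"
    using almost_affine_mono[OF assms(2)] by blast
qed

definition good_chart :: "nat \<Rightarrow> 'a::metric_space chart \<Rightarrow> bool" where
  "good_chart n c \<longleftrightarrow> open (fst c) \<and> openin (Euclidean_space n) (snd c ` fst c) \<and>
    homeomorphic_map (top_of_set (fst c)) (subtopology (Euclidean_space n) (snd c ` fst c)) (snd c) \<and>
    (\<forall>x\<in>fst c. \<exists>d>0. \<exists>C. ball x d \<subseteq> fst c \<and>
      (\<forall>y\<in>ball x d. \<forall>z\<in>ball x d. dist y z \<le> C * edist n (snd c y) (snd c z))) \<and>
    (\<forall>i<n. locally_almost_affine (fst c) (\<lambda>x. snd c x i))"

lemma good_chartD:
  assumes "good_chart n (U, \<psi>)"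
  shows "open U" "openin (Euclidean_space n) (\<psi> ` U)" "inj_on \<psi> U"
    "homeomorphic_map (top_of_set U) (subtopology (Euclidean_space n) (\<psi> ` U)) \<psi>"
    "i < n \<Longrightarrow> locally_almost_affine U (\<lambda>x. \<psi> x i)"
    "x \<in> U \<Longrightarrow> \<psi> x \<in> topspace (Euclidean_space n)"
proof -
  show 1: "open U" "openin (Euclidean_space n) (\<psi> ` U)"
    "homeomorphic_map (top_of_set U) (subtopology (Euclidean_space n) (\<psi> ` U)) \<psi>"
    "i < n \<Longrightarrow> locally_almost_affine U (\<lambda>x. \<psi> x i)"
    using assms unfolding good_chart_def by auto
  show "inj_on \<psi> U" using homeomorphic_imp_injective_map[OF 1(3)] by simp
  show "x \<in> U \<Longrightarrow> \<psi> x \<in> topspace (Euclidean_space n)"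
    using openin_subset[OF 1(2)] by auto
qed

lemma good_chart_local:
  assumes c: "good_chart n (U, \<psi>)" and x: "x \<in> U"
  obtains d C where "d > 0" "C \<ge> 1" "ball x d \<subseteq> U"
    "\<And>y z. y \<in> ball x d \<Longrightarrow> z \<in> ball x d \<Longrightarrow> dist y z \<le> C * edist n (\<psi> y) (\<psi> z)"
    "\<And>y z. y \<in> ball x d \<Longrightarrow> z \<in> ball x d \<Longrightarrow> edist n (\<psi> y) (\<psi> z) \<le> C * dist y z"
    "\<And>i. i < n \<Longrightarrow> almost_affine (ball x d) C (\<lambda>x. \<psi> x i)"
proof -
  have "\<forall>x\<in>U. \<exists>d>0. \<exists>C. ball x d \<subseteq> U \<and>
      (\<forall>y\<in>ball x d. \<forall>z\<in>ball x d. dist y z \<le> C * edist n (\<psi> y) (\<psi> z))"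
    using c unfolding good_chart_def by simp
  then obtain d0 C0 where 0: "d0 > 0" "ball x d0 \<subseteq> U"
    "\<And>y z. y \<in> ball x d0 \<Longrightarrow> z \<in> ball x d0 \<Longrightarrow> dist y z \<le> C0 * edist n (\<psi> y) (\<psi> z)"
    using x by blast
  have "\<exists>d>0. \<exists>C. almost_affine (ball x d) C (\<lambda>x. \<psi> x i)" if "i < n" for i
    using good_chartD(5)[OF c that] x unfolding locally_almost_affine_def by blast
  then obtain d C where dC: "\<And>i. i < n \<Longrightarrow> d i > 0" "\<And>i. i < n \<Longrightarrow> almost_affine (ball x (d i)) (C i) (\<lambda>x. \<psi> x i)"
    by metis
  define D where "D = Min (insert d0 (d ` {..<n}))"
  define E where "E = \<bar>C0\<bar> + (\<Sum>i<n. \<bar>C i\<bar>) + 1"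
  have D: "D > 0" "D \<le> d0" "\<And>i. i < n \<Longrightarrow> D \<le> d i" unfolding D_def using 0 dC by auto
  have CE: "\<bar>C i\<bar> \<le> (\<Sum>i<n. \<bar>C i\<bar>)" if "i < n" for i
    using that member_le_sum[of i "{..<n}" "\<lambda>i. \<bar>C i\<bar>"] by auto
  have "(\<Sum>i<n. \<bar>C i\<bar>) \<ge> 0" by (intro sum_nonneg) auto
  then have E: "1 \<le> E" "\<bar>C0\<bar> \<le> E" "(\<Sum>i<n. \<bar>C i\<bar>) \<le> E" unfolding E_def by auto
  have Ci: "C i \<le> E" if "i < n" for i using CE[OF that] E(3) by linarith
  have ballD: "ball x D \<subseteq> ball x d0" "\<And>i. i < n \<Longrightarrow> ball x D \<subseteq> ball x (d i)"
    using D by (auto intro!: subset_ball)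
  show thesis
  proof (rule that[of D E])
    show "ball x D \<subseteq> U" using ballD 0 by auto
    show "almost_affine (ball x D) E (\<lambda>x. \<psi> x i)" if "i < n" for i
      using almost_affine_mono[OF dC(2)[OF that] ballD(2)[OF that] Ci[OF that]] .
    fix y z assume yz: "y \<in> ball x D" "z \<in> ball x D"
    have "dist y z \<le> C0 * edist n (\<psi> y) (\<psi> z)" using 0(3) yz ballD by blast
    also have "\<dots> \<le> E * edist n (\<psi> y) (\<psi> z)" using E by (intro mult_right_mono) auto
    finally show "dist y z \<le> E * edist n (\<psi> y) (\<psi> z)" .
    have "edist n (\<psi> y) (\<psi> z) \<le> (\<Sum>i<n. \<bar>\<psi> y i - \<psi> z i\<bar>)" by (rule edist_le_sum)
    also have "\<dots> \<le> (\<Sum>i<n. \<bar>C i\<bar> * dist y z)"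
    proof (rule sum_mono)
      fix i assume "i \<in> {..<n}"
      then have i: "i < n" by simp
      have "\<bar>\<psi> y i - \<psi> z i\<bar> \<le> C i * dist y z"
        using almost_affineD(2)[OF dC(2)[OF i], of y z] yz ballD(2)[OF i] by blast
      also have "\<dots> \<le> \<bar>C i\<bar> * dist y z" by (intro mult_right_mono) auto
      finally show "\<bar>\<psi> y i - \<psi> z i\<bar> \<le> \<bar>C i\<bar> * dist y z" .
    qed
    also have "\<dots> = (\<Sum>i<n. \<bar>C i\<bar>) * dist y z" by (simp add: sum_distrib_right)
    also have "\<dots> \<le> E * dist y z" using E by (intro mult_right_mono) auto
    finally show "edist n (\<psi> y) (\<psi> z) \<le> E * dist y z" .
  qed (use D E in auto)
qed

lemma good_chart_image_ball:
  assumes c: "good_chart n (U, \<psi>)" and x: "x \<in> U" and d: "d > 0"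
  obtains e where "e > 0" "euclid_ball n (\<psi> x) e \<subseteq> \<psi> ` (U \<inter> ball x d)"
proof -
  have "openin (top_of_set U) (U \<inter> ball x d)" by (simp add: openin_open_Int)
  then have "openin (subtopology (Euclidean_space n) (\<psi> ` U)) (\<psi> ` (U \<inter> ball x d))"
    using homeomorphic_imp_open_map[OF good_chartD(4)[OF c]] unfolding open_map_def by blast
  then have "openin (Euclidean_space n) (\<psi> ` (U \<inter> ball x d))"
    using good_chartD(2)[OF c] openin_trans_full by blast
  then show thesis using x d that unfolding openin_Euclidean_space_iff by force
qed

context semiconcave_G_space
begin

text \<open>Let \<open>m\<close> be a midpoint of \<open>g u\<close> and \<open>g v\<close>. Since
  the coordinates are almost affine, \<open>\<psi> m\<close> differs from the Euclidean midpoint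
  \<open>w\<close> of \<open>u\<close> and \<open>v\<close> quadratically little, and a Lipschitz
  function then takes nearly the same value at \<open>m\<close> and at \<open>g w\<close>. The
  factor \<open>M\<close> does not depend on \<open>f\<close> or \<open>C\<close>; this uniformity
  is needed for families of distance functions.\<close>

lemma chart_transfer:
  fixes \<psi> :: "'a \<Rightarrow> nat \<Rightarrow> real"
  assumes c: "good_chart n (U, \<psi>)" and x: "x \<in> U" and d: "d > 0"
  obtains e M where "e > 0" "M \<ge> 1" "euclid_ball n (\<psi> x) e \<subseteq> \<psi> ` U"
    "\<And>u. u \<in> euclid_ball n (\<psi> x) e \<Longrightarrow> inv_into U \<psi> u \<in> ball x d"
    "\<And>u v. u \<in> euclid_ball n (\<psi> x) e \<Longrightarrow> v \<in> euclid_ball n (\<psi> x) e \<Longrightarrow>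
       dist (inv_into U \<psi> u) (inv_into U \<psi> v) \<le> M * edist n u v"
    "\<And>u v. u \<in> euclid_ball n (\<psi> x) e \<Longrightarrow> v \<in> euclid_ball n (\<psi> x) e \<Longrightarrow>
       edist n u v \<le> M * dist (inv_into U \<psi> u) (inv_into U \<psi> v)"
    "\<And>C f. almost_affine (ball x d) C f \<Longrightarrow> C11_ball n (\<psi> x) e (M * C) (\<lambda>u. f (inv_into U \<psi> u))"
proof -
  obtain d0 L where 0: "d0 > 0" "L \<ge> 1" "ball x d0 \<subseteq> U"
    "\<And>y z. y \<in> ball x d0 \<Longrightarrow> z \<in> ball x d0 \<Longrightarrow> dist y z \<le> L * edist n (\<psi> y) (\<psi> z)"
    "\<And>y z. y \<in> ball x d0 \<Longrightarrow> z \<in> ball x d0 \<Longrightarrow> edist n (\<psi> y) (\<psi> z) \<le> L * dist y z"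
    "\<And>i. i < n \<Longrightarrow> almost_affine (ball x d0) L (\<lambda>x. \<psi> x i)"
    using good_chart_local[OF c x] by metis
  define d1 where "d1 = min d d0"
  have d1: "d1 > 0" "d1 \<le> d" "d1 \<le> d0" using 0 d by (auto simp: d1_def)
  \<comment> \<open>Preimages lie in the ball of half the radius, so that their midpoints stay
    within \<open>d1\<close> of \<open>x\<close>.\<close>
  obtain e where e: "e > 0" "euclid_ball n (\<psi> x) e \<subseteq> \<psi> ` (U \<inter> ball x (d1 / 2))"
    using good_chart_image_ball[OF c x, of "d1/2"] d1 by auto
  define g where "g = inv_into U \<psi>"
  have g: "g u \<in> ball x (d1 / 2)" "\<psi> (g u) = u" if u: "u \<in> euclid_ball n (\<psi> x) e" for u
  proof -
    obtain y where "y \<in> U" "y \<in> ball x (d1 / 2)" "u = \<psi> y" using e u by auto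
    then show "g u \<in> ball x (d1 / 2)" "\<psi> (g u) = u"
      using good_chartD(3)[OF c] by (auto simp: g_def)
  qed
  have sub: "y \<in> ball x d \<and> y \<in> ball x d0 \<and> y \<in> ball x d1" if "y \<in> ball x (d1 / 2)" for y
    using that d1 by auto
  \<comment> \<open>In the first summand, \<open>1\<close> stands for the second difference of
    \<open>f\<close> at \<open>m\<close> and \<open>2 * n * L\<^sup>2\<close> for moving
    \<open>m\<close> to \<open>g w\<close>, while the last \<open>L\<^sup>2\<close> converts
    distances to coordinates; the second summand covers the Lipschitz bounds.\<close>
  define M where "M = (1 + 2 * n * L\<^sup>2) * L\<^sup>2 + L"
  have "(1 + 2 * n * L\<^sup>2) * L\<^sup>2 \<ge> 0" by simp
  then have M: "M \<ge> L" "M \<ge> (1 + 2 * n * L\<^sup>2) * L\<^sup>2" "M \<ge> 1" using 0(2) unfolding M_def by linarith+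
  have lip: "dist (g u) (g v) \<le> L * edist n u v"
    if "u \<in> euclid_ball n (\<psi> x) e" "v \<in> euclid_ball n (\<psi> x) e" for u v
    using 0(4)[of "g u" "g v"] g that sub by metis
  have lip': "edist n u v \<le> L * dist (g u) (g v)"
    if "u \<in> euclid_ball n (\<psi> x) e" "v \<in> euclid_ball n (\<psi> x) e" for u v
    using 0(5)[of "g u" "g v"] g that sub by metis
  have C11: "C11_ball n (\<psi> x) e (M * C) (\<lambda>u. f (g u))" if f: "almost_affine (ball x d) C f" for C f
    unfolding C11_ball_def
  proof (intro conjI ballI)
    have C: "C \<ge> 0" using f by (rule almost_affineD)
    then show "0 \<le> M * C" using M by simp
    fix u v assume u: "u \<in> euclid_ball n (\<psi> x) e" and v: "v \<in> euclid_ball n (\<psi> x) e"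
    have fd: "\<bar>f y - f z\<bar> \<le> C * dist y z" if "y \<in> ball x d" "z \<in> ball x d" for y z
      using almost_affineD(2)[OF f that] .
    have "\<bar>f (g u) - f (g v)\<bar> \<le> C * dist (g u) (g v)" using g u v sub by (intro fd) auto
    also have "\<dots> \<le> C * (L * edist n u v)" using lip[OF u v] C by (intro mult_left_mono)
    also have "\<dots> = L * (C * edist n u v)" by simp
    also have "\<dots> \<le> M * (C * edist n u v)" using M C by (intro mult_right_mono) auto
    finally show "\<bar>f (g u) - f (g v)\<bar> \<le> M * C * edist n u v" by simp
    define w where "w = (\<lambda>i. (u i + v i) / 2)"
    have "w = (\<lambda>i. u i + 1/2 * (v i - u i))" by (auto simp: w_def field_simps)
    then have w: "w \<in> euclid_ball n (\<psi> x) e" using euclid_ball_segment[OF u v, of "1/2"] by simp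
    obtain m where m: "is_midpoint m (g u) (g v)" by (rule midpoint_exists)
    define D where "D = dist (g u) (g v)"
    have "dist x m < d1"
    proof -
      have "dist x m \<le> dist x (g u) + D / 2"
        using m dist_triangle[of x m "g u"] by (simp add: is_midpoint_def D_def)
      moreover have "D \<le> dist x (g u) + dist x (g v)" unfolding D_def by (metis dist_commute dist_triangle)
      ultimately show ?thesis using g(1)[OF u] g(1)[OF v] by simp
    qed
    then have mb: "m \<in> ball x d0" "m \<in> ball x d" using d1 by auto
    have "edist n (g' m) w \<le> (\<Sum>i<n. \<bar>g' m i - w i\<bar>)" for g' by (rule edist_le_sum)
    then have "edist n (\<psi> m) w \<le> (\<Sum>i<n. \<bar>\<psi> m i - w i\<bar>)" .
    also have "\<dots> \<le> (\<Sum>i<n. L * D\<^sup>2)"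
    proof (rule sum_mono)
      fix i assume "i \<in> {..<n}"
      then have "\<bar>\<psi> (g u) i + \<psi> (g v) i - 2 * \<psi> m i\<bar> \<le> L * D\<^sup>2"
        using almost_affineD(3)[OF 0(6), of i "g u" "g v" m] sub g(1)[OF u] g(1)[OF v] mb m by (simp add: D_def)
      moreover have "\<psi> (g u) i + \<psi> (g v) i - 2 * \<psi> m i = - 2 * (\<psi> m i - w i)"
        using g(2)[OF u] g(2)[OF v] by (simp add: w_def)
      ultimately have "2 * \<bar>\<psi> m i - w i\<bar> \<le> L * D\<^sup>2" by (simp only: abs_mult)
      moreover have "\<bar>\<psi> m i - w i\<bar> \<le> 2 * \<bar>\<psi> m i - w i\<bar>" by simp
      ultimately show "\<bar>\<psi> m i - w i\<bar> \<le> L * D\<^sup>2" by (rule order_trans[rotated])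
    qed
    also have "\<dots> = n * L * D\<^sup>2" by simp
    finally have ew: "edist n (\<psi> m) w \<le> n * L * D\<^sup>2" .
    have "dist m (g w) \<le> L * edist n (\<psi> m) w" using 0(4)[of m "g w"] mb sub g[OF w] by auto
    also have "\<dots> \<le> L * (n * L * D\<^sup>2)" using ew 0 by (intro mult_left_mono) auto
    finally have mw: "dist m (g w) \<le> n * L\<^sup>2 * D\<^sup>2" by (simp add: power2_eq_square mult_ac)
    have "\<bar>f m - f (g w)\<bar> \<le> C * dist m (g w)" using mb sub g(1)[OF w] by (intro fd) auto
    also have "\<dots> \<le> C * (n * L\<^sup>2 * D\<^sup>2)" using mw C by (intro mult_left_mono)
    finally have 1: "\<bar>f m - f (g w)\<bar> \<le> C * (n * L\<^sup>2 * D\<^sup>2)" .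
    have 2: "\<bar>f (g u) + f (g v) - 2 * f m\<bar> \<le> C * D\<^sup>2"
      using almost_affineD(3)[OF f, of "g u" "g v" m] sub g(1)[OF u] g(1)[OF v] mb m by (simp add: D_def)
    have "\<bar>f (g u) + f (g v) - 2 * f (g w)\<bar> \<le> C * D\<^sup>2 + 2 * (C * (n * L\<^sup>2 * D\<^sup>2))"
      using 1 2 by (simp only: abs_le_iff) linarith
    also have "\<dots> = C * ((1 + 2 * n * L\<^sup>2) * D\<^sup>2)" by (simp add: algebra_simps)
    also have "\<dots> \<le> C * ((1 + 2 * n * L\<^sup>2) * (L * edist n u v)\<^sup>2)"
      using lip[OF u v] C by (intro mult_left_mono power_mono) (auto simp: D_def)
    also have "\<dots> = ((1 + 2 * n * L\<^sup>2) * L\<^sup>2) * (C * (edist n u v)\<^sup>2)" by (simp add: power_mult_distrib mult_ac)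
    also have "\<dots> \<le> M * (C * (edist n u v)\<^sup>2)" using M C by (intro mult_right_mono) auto
    finally show "\<bar>f (g u) + f (g v) - 2 * f (g (\<lambda>i. (u i + v i) / 2))\<bar> \<le> M * C * (edist n u v)\<^sup>2"
      by (simp add: w_def)
  qed
  have LM: "L * z \<le> M * z" if "z \<ge> 0" for z using that M by (intro mult_right_mono)
  show thesis
  proof (rule that[OF e(1) M(3)])
    show "euclid_ball n (\<psi> x) e \<subseteq> \<psi> ` U" using e by auto
    show "inv_into U \<psi> u \<in> ball x d" if "u \<in> euclid_ball n (\<psi> x) e" for u
      using g(1)[OF that] sub by (auto simp: g_def)
    fix u v assume uv: "u \<in> euclid_ball n (\<psi> x) e" "v \<in> euclid_ball n (\<psi> x) e"
    show "dist (inv_into U \<psi> u) (inv_into U \<psi> v) \<le> M * edist n u v"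
      using lip[OF uv] LM[of "edist n u v"] by (simp add: g_def)
    show "edist n u v \<le> M * dist (inv_into U \<psi> u) (inv_into U \<psi> v)"
      using lip'[OF uv] LM[of "dist (g u) (g v)"] by (simp add: g_def)
  qed (use C11 in \<open>simp add: g_def\<close>)
qed

text \<open>With \<open>f\<close> a coordinate of another chart this yields the regularity of
  transition maps and their inverses, with \<open>f\<close> a squared distance the canonical
  property of the atlas.\<close>

lemma chart_regularity:
  fixes \<psi> :: "'a \<Rightarrow> nat \<Rightarrow> real"
  assumes c: "good_chart n (U, \<psi>)" and f: "locally_almost_affine V f"
    and h: "\<And>x. x \<in> U \<inter> V \<Longrightarrow> h (\<psi> x) = f x"
  shows "C1_half_on n (\<psi> ` (U \<inter> V)) h" "DC_on n (\<psi> ` (U \<inter> V)) h"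
proof -
  have local: "\<exists>e>0. \<exists>K. euclid_ball n u e \<subseteq> \<psi> ` (U \<inter> V) \<and> C11_ball n u e K h" if "u \<in> \<psi> ` (U \<inter> V)" for u
  proof -
    obtain x where x: "x \<in> U" "x \<in> V" "u = \<psi> x" using \<open>u \<in> _\<close> by auto
    obtain d C where d: "d > 0" "ball x d \<subseteq> V" "almost_affine (ball x d) C f"
      using f x unfolding locally_almost_affine_def by blast
    obtain e M where e: "e > 0" "euclid_ball n (\<psi> x) e \<subseteq> \<psi> ` U"
      "\<And>u. u \<in> euclid_ball n (\<psi> x) e \<Longrightarrow> inv_into U \<psi> u \<in> ball x d"
      "C11_ball n (\<psi> x) e (M * C) (\<lambda>u. f (inv_into U \<psi> u))"
      using chart_transfer[OF c x(1) d(1)] d(3) by metis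
    have g: "inv_into U \<psi> u \<in> U \<inter> V \<and> \<psi> (inv_into U \<psi> u) = u" if "u \<in> euclid_ball n (\<psi> x) e" for u
      using e(2,3) that d(2) by (meson IntI f_inv_into_f inv_into_into subset_iff)
    then have sub: "euclid_ball n (\<psi> x) e \<subseteq> \<psi> ` (U \<inter> V)" by (metis image_eqI subsetI)
    have eq: "f (inv_into U \<psi> u) = h u" if "u \<in> euclid_ball n (\<psi> x) e" for u
      using h[of "inv_into U \<psi> u"] g[OF that] by simp
    have "C11_ball n (\<psi> x) e (M * C) h" using e(4) C11_ball_cong[of n "\<psi> x" e "\<lambda>u. f (inv_into U \<psi> u)" h] eq by blast
    then show ?thesis using e(1) sub x(3) by blast
  qed
  have sub: "\<psi> ` (U \<inter> V) \<subseteq> topspace (Euclidean_space n)" using good_chartD(6)[OF c] by auto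
  show "C1_half_on n (\<psi> ` (U \<inter> V)) h" "DC_on n (\<psi> ` (U \<inter> V)) h"
    by (rule C11_regularity[OF local sub]; assumption)+
qed

section \<open>Compatibility of all good charts\<close>

definition good_atlas :: "nat \<Rightarrow> 'a chart set" where
  "good_atlas n = {c. good_chart n c}"

lemma transition_eq:
  assumes "good_chart n (U, \<phi>)" "x \<in> U"
  shows "transition (U, \<phi>) (V, \<psi>) (\<phi> x) = \<psi> x"
  using assms good_chartD(3)[OF assms(1)] by (simp add: transition_def)

lemma transition_bij_betw:
  assumes "good_chart n (U, \<phi>)" "good_chart n (V, \<psi>)"
  shows "bij_betw (transition (U, \<phi>) (V, \<psi>)) (\<phi> ` (U \<inter> V)) (\<psi> ` (U \<inter> V))"
proof (rule bij_betw_byWitness[where f' = "transition (V, \<psi>) (U, \<phi>)"])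
qed (use transition_eq[OF assms(1)] transition_eq[OF assms(2)] in auto)

lemma inv_transition_eq:
  assumes "good_chart n (U, \<phi>)" "good_chart n (V, \<psi>)" "x \<in> U \<inter> V"
  shows "inv_into (\<phi> ` (U \<inter> V)) (transition (U, \<phi>) (V, \<psi>)) (\<psi> x) = \<phi> x"
  using transition_bij_betw[OF assms(1,2)] transition_eq[OF assms(1), of x V \<psi>] assms(3)
  by (intro inv_into_f_eq) (auto simp: bij_betw_def)

lemma transition_components:
  fixes \<phi> \<psi> :: "'a \<Rightarrow> nat \<Rightarrow> real"
  assumes c: "good_chart n (U, \<phi>)" and c': "good_chart n (V, \<psi>)" and i: "i < n"
  shows "C1_half_on n (\<phi> ` (U \<inter> V)) (\<lambda>x. transition (U, \<phi>) (V, \<psi>) x i)"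
    "DC_on n (\<phi> ` (U \<inter> V)) (\<lambda>x. transition (U, \<phi>) (V, \<psi>) x i)"
    "C1_half_on n (\<psi> ` (U \<inter> V)) (\<lambda>y. inv_into (\<phi> ` (U \<inter> V)) (transition (U, \<phi>) (V, \<psi>)) y i)"
    "DC_on n (\<psi> ` (U \<inter> V)) (\<lambda>y. inv_into (\<phi> ` (U \<inter> V)) (transition (U, \<phi>) (V, \<psi>)) y i)"
proof -
  have "transition (U, \<phi>) (V, \<psi>) (\<phi> x) i = \<psi> x i" if "x \<in> U \<inter> V" for x
    using transition_eq[OF c, of x V \<psi>] that by simp
  from chart_regularity[OF c good_chartD(5)[OF c' i], of "\<lambda>x. transition (U, \<phi>) (V, \<psi>) x i", OF this]
  show "C1_half_on n (\<phi> ` (U \<inter> V)) (\<lambda>x. transition (U, \<phi>) (V, \<psi>) x i)"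
    "DC_on n (\<phi> ` (U \<inter> V)) (\<lambda>x. transition (U, \<phi>) (V, \<psi>) x i)" by blast+
  have "inv_into (\<phi> ` (U \<inter> V)) (transition (U, \<phi>) (V, \<psi>)) (\<psi> x) i = \<phi> x i" if "x \<in> V \<inter> U" for x
    using inv_transition_eq[OF c c'] that by (simp add: Int_commute)
  from chart_regularity[OF c' good_chartD(5)[OF c i], of "\<lambda>y. inv_into (\<phi> ` (U \<inter> V)) (transition (U, \<phi>) (V, \<psi>)) y i", OF this]
  show "C1_half_on n (\<psi> ` (U \<inter> V)) (\<lambda>y. inv_into (\<phi> ` (U \<inter> V)) (transition (U, \<phi>) (V, \<psi>)) y i)"
    "DC_on n (\<psi> ` (U \<inter> V)) (\<lambda>y. inv_into (\<phi> ` (U \<inter> V)) (transition (U, \<phi>) (V, \<psi>)) y i)"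
    by (simp_all add: Int_commute)
qed

lemma good_chart_restrict_homeomorphic:
  assumes c: "good_chart n (U, \<phi>)" and W: "W \<subseteq> U"
  shows "homeomorphic_map (top_of_set W) (subtopology (Euclidean_space n) (\<phi> ` W)) \<phi>"
proof -
  have "homeomorphic_map (subtopology (top_of_set U) W) (subtopology (subtopology (Euclidean_space n) (\<phi> ` U)) (\<phi> ` W)) \<phi>"
    using W good_chartD(6)[OF c] by (intro homeomorphic_map_subtopologies[OF good_chartD(4)[OF c]]) auto
  moreover have "U \<inter> W = W" "\<phi> ` U \<inter> \<phi> ` W = \<phi> ` W" using W by auto
  ultimately show ?thesis by (simp add: subtopology_subtopology)
qed

lemma transition_homeomorphic:
  assumes c: "good_chart n (U, \<phi>)" and c': "good_chart n (V, \<psi>)"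
  shows "homeomorphic_map (subtopology (Euclidean_space n) (\<phi> ` (U \<inter> V)))
    (subtopology (Euclidean_space n) (\<psi> ` (U \<inter> V))) (transition (U, \<phi>) (V, \<psi>))"
proof -
  define W where "W = U \<inter> V"
  obtain g where g: "homeomorphic_maps (top_of_set W) (subtopology (Euclidean_space n) (\<phi> ` W)) \<phi> g"
    using good_chart_restrict_homeomorphic[OF c, of W] homeomorphic_map_maps W_def by blast
  then have "homeomorphic_map (subtopology (Euclidean_space n) (\<phi> ` W)) (top_of_set W) g"
    using homeomorphic_maps_map homeomorphic_maps_sym by blast
  from homeomorphic_map_compose[OF this good_chart_restrict_homeomorphic[OF c', of W]]
  have 1: "homeomorphic_map (subtopology (Euclidean_space n) (\<phi> ` W)) (subtopology (Euclidean_space n) (\<psi> ` W)) (\<psi> \<circ> g)"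
    by (simp add: W_def)
  have "(\<psi> \<circ> g) u = transition (U, \<phi>) (V, \<psi>) u" if "u \<in> topspace (subtopology (Euclidean_space n) (\<phi> ` W))" for u
  proof -
    obtain x where x: "x \<in> W" "u = \<phi> x" using \<open>u \<in> _\<close> by auto
    then have "g u = x" using g by (simp add: homeomorphic_maps_def)
    then show ?thesis using x transition_eq[OF c, of x V \<psi>] by (simp add: W_def)
  qed
  from homeomorphic_map_eq[OF 1 this] show ?thesis by (simp add: W_def)
qed

text \<open>Both charts are locally bi-Lipschitz with respect to \<open>dist\<close>, so distances
  before and after the transition are compared through the distance \<open>D\<close> of the
  corresponding points of the space.\<close>

lemma transition_bi_Lipschitz:
  fixes \<phi> \<psi> :: "'a \<Rightarrow> nat \<Rightarrow> real"
  assumes c: "good_chart n (U, \<phi>)" and c': "good_chart n (V, \<psi>)"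
  shows "locally_bi_Lipschitz n (\<phi> ` (U \<inter> V)) (transition (U, \<phi>) (V, \<psi>))"
  unfolding locally_bi_Lipschitz_def
proof
  fix u assume "u \<in> \<phi> ` (U \<inter> V)"
  then obtain x where x: "x \<in> U" "x \<in> V" "u = \<phi> x" by auto
  obtain d L where d: "d > 0" "L \<ge> 1" "ball x d \<subseteq> V"
    "\<And>y z. y \<in> ball x d \<Longrightarrow> z \<in> ball x d \<Longrightarrow> dist y z \<le> L * edist n (\<psi> y) (\<psi> z)"
    "\<And>y z. y \<in> ball x d \<Longrightarrow> z \<in> ball x d \<Longrightarrow> edist n (\<psi> y) (\<psi> z) \<le> L * dist y z"
    using good_chart_local[OF c' x(2)] by metis
  obtain e M where e: "e > 0" "M \<ge> 1" "euclid_ball n (\<phi> x) e \<subseteq> \<phi> ` U"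
    "\<And>u. u \<in> euclid_ball n (\<phi> x) e \<Longrightarrow> inv_into U \<phi> u \<in> ball x d"
    "\<And>u v. u \<in> euclid_ball n (\<phi> x) e \<Longrightarrow> v \<in> euclid_ball n (\<phi> x) e \<Longrightarrow>
       dist (inv_into U \<phi> u) (inv_into U \<phi> v) \<le> M * edist n u v"
    "\<And>u v. u \<in> euclid_ball n (\<phi> x) e \<Longrightarrow> v \<in> euclid_ball n (\<phi> x) e \<Longrightarrow>
       edist n u v \<le> M * dist (inv_into U \<phi> u) (inv_into U \<phi> v)"
    using chart_transfer[OF c x(1) d(1)] by metis
  show "\<exists>N L. openin (Euclidean_space n) N \<and> u \<in> N \<and> N \<subseteq> \<phi> ` (U \<inter> V) \<and>
    (\<forall>y\<in>N. \<forall>z\<in>N. edist n (transition (U, \<phi>) (V, \<psi>) y) (transition (U, \<phi>) (V, \<psi>) z) \<le> L * edist n y z \<and>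
       edist n y z \<le> L * edist n (transition (U, \<phi>) (V, \<psi>) y) (transition (U, \<phi>) (V, \<psi>) z))"
  proof (intro exI conjI ballI)
    show "openin (Euclidean_space n) (euclid_ball n (\<phi> x) e)" by (rule openin_euclid_ball)
    show "u \<in> euclid_ball n (\<phi> x) e" using x e good_chartD(6)[OF c] by simp
    show "euclid_ball n (\<phi> x) e \<subseteq> \<phi> ` (U \<inter> V)"
    proof
      fix w assume w: "w \<in> euclid_ball n (\<phi> x) e"
      then obtain y where "y \<in> U" "w = \<phi> y" using e(3) by auto
      then show "w \<in> \<phi> ` (U \<inter> V)" using e(4)[OF w] d(3) good_chartD(3)[OF c] by auto
    qed
    fix y z assume yz: "y \<in> euclid_ball n (\<phi> x) e" "z \<in> euclid_ball n (\<phi> x) e"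
    define D where "D = dist (inv_into U \<phi> y) (inv_into U \<phi> z)"
    define T where "T = edist n (transition (U, \<phi>) (V, \<psi>) y) (transition (U, \<phi>) (V, \<psi>) z)"
    have 1: "T \<le> L * D" "D \<le> L * T" unfolding D_def T_def transition_def using d(4,5) e(4) yz by auto
    have 2: "D \<le> M * edist n y z" "edist n y z \<le> M * D" unfolding D_def using e(5,6) yz by auto
    have "T \<le> L * (M * edist n y z)" using 1(1) 2(1) d(2) by (meson mult_left_mono order_trans zero_le_one)
    moreover have "edist n y z \<le> M * (L * T)" using 1(2) 2(2) e(2) by (meson mult_left_mono order_trans zero_le_one)
    ultimately show "T \<le> (L * M) * edist n y z" "edist n y z \<le> (L * M) * T" by (simp_all add: mult_ac)
  qed
qed

text \<open>No choice of charts is made: any two good charts are compatible, because the coordinates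
  of one are almost affine functions and these are regular in the other.\<close>

lemma good_atlas_structure:
  assumes cover: "\<And>x::'a. \<exists>c. good_chart n c \<and> x \<in> fst c"
  shows "atlas n (good_atlas n)" "C1_half_atlas n (good_atlas n)" "DC_atlas n (good_atlas n)"
    "canonical_atlas n (good_atlas n)"
proof -
  show at: "atlas n (good_atlas n)"
    unfolding atlas_def good_atlas_def using cover good_chartD(1,2,4) by fastforce
  show "C1_half_atlas n (good_atlas n)"
    unfolding C1_half_atlas_def C1_half_diffeo_def
    using at transition_bij_betw transition_components by (auto simp: good_atlas_def)
  show "DC_atlas n (good_atlas n)"
    unfolding DC_atlas_def DC_homeomorphism_def
    using at transition_homeomorphic transition_bi_Lipschitz transition_components by (auto simp: good_atlas_def)
  have "\<exists>U. open U \<and> x \<in> U \<and> (\<forall>p\<in>U. \<forall>(V, \<phi>)\<in>good_atlas n.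
        C1_half_on n (\<phi> ` (U \<inter> V)) (\<lambda>y. (dist p (inv_into V \<phi> y))\<^sup>2) \<and>
        DC_on n (\<phi> ` (U \<inter> V)) (\<lambda>y. (dist p (inv_into V \<phi> y))\<^sup>2))" for x :: 'a
  proof -
    \<comment> \<open>The ball is chosen before any chart, so one neighbourhood serves all charts of
      the atlas.\<close>
    obtain r K where r: "r > 0" "\<And>p. p \<in> ball x r \<Longrightarrow> almost_affine (ball x r) K (\<lambda>y. (dist p y)\<^sup>2)"
      using local_distance_estimates[of x] by metis
    have "C1_half_on n (\<phi> ` (ball x r \<inter> V)) (\<lambda>y. (dist p (inv_into V \<phi> y))\<^sup>2) \<and>
        DC_on n (\<phi> ` (ball x r \<inter> V)) (\<lambda>y. (dist p (inv_into V \<phi> y))\<^sup>2)"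
      if p: "p \<in> ball x r" and c: "good_chart n (V, \<phi>)" for p V \<phi>
      using chart_regularity[OF c locally_almost_affineI[OF open_ball r(2)[OF p]], of "\<lambda>y. (dist p (inv_into V \<phi> y))\<^sup>2"]
        good_chartD(3)[OF c] by (simp add: Int_commute)
    then show ?thesis using r(1) by (intro exI[of _ "ball x r"]) (auto simp: good_atlas_def)
  qed
  then show "canonical_atlas n (good_atlas n)"
    unfolding canonical_atlas_def using at by blast
qed

end

section \<open>Distance coordinates\<close>

locale distance_estimates = semiconcave_G_space space_type for space_type :: "'a::metric_space itself" +
  fixes x0 :: 'a and R r K :: real
  assumes r: "0 < r" "4 * r \<le> R" and K: "0 \<le> K"
    and affine: "\<And>p. dist x0 p = R \<Longrightarrow> almost_affine (ball x0 r) K (dist p)"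
    and extension: "\<And>x y. x \<in> ball x0 r \<Longrightarrow> y \<in> ball x0 r \<Longrightarrow> x \<noteq> y \<Longrightarrow>
      \<exists>z. dist x0 z = R \<and> dist x y + dist y z = dist x z"
begin

lemma dist_diff_le: "\<bar>dist p x - dist p y\<bar> \<le> dist x (y::'a)"
  using dist_triangle[of p x y] dist_triangle[of p y x] by (simp add: dist_commute abs_le_iff)

text \<open>The condition \<open>T + dist x0 x \<le> R\<close> guarantees that the extension up to
  the sphere of radius \<open>R\<close> has length at least \<open>T\<close> and can be cut
  there.\<close>

lemma extend_to_length:
  assumes x: "x \<in> ball x0 r" "y \<in> ball x0 r" "x \<noteq> y" and T: "dist x y \<le> T" "T + dist x0 x \<le> R"
  obtains z where "dist x y + dist y z = dist x z" "dist x z = T"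
proof -
  obtain w where w: "dist x0 w = R" "dist x y + dist y w = dist x w" using extension[OF x] by blast
  have "dist x w \<ge> T" using dist_triangle[of x0 w x] w T by simp
  then obtain z where z: "dist y z = T - dist x y" "dist z w = dist y w - (T - dist x y)"
    using point_between[of "T - dist x y" y w] T w by auto
  have "dist x z = T" using dist_triangle[of x z y] dist_triangle[of x w z] z w by linarith
  then show thesis using z by (intro that) auto
qed

text \<open>The distance from \<open>p\<close> is midpoint bounded along a shortest path from
  \<open>x\<close> through \<open>y\<close> to \<open>z\<close>, so its slope over the initial piece
  is nearly that over the whole. This carries first-order information from one scale to
  another.\<close>

lemma geodesic_difference_quotient:
  assumes p: "dist x0 p = R" and xy: "x \<noteq> y" "dist x y + dist y z = dist x z"
    and small: "dist x0 x + dist x z < r"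
  shows "\<bar>(dist p y - dist p x) / dist x y - (dist p z - dist p x) / dist x z\<bar> \<le> 2 * K * dist x z"
proof -
  obtain \<gamma> where \<gamma>: "shortest_path 0 (dist x z) \<gamma>" "\<gamma> 0 = x" "\<gamma> (dist x y) = y" "\<gamma> (dist x z) = z"
    using geodesic_through[OF xy(2)] by blast
  have "\<gamma> t \<in> ball x0 r" if t: "t \<in> {0..dist x z}" for t
    using shortest_path_dist[OF \<gamma>(1), of 0 t] t \<gamma>(2) small dist_triangle[of x0 "\<gamma> t" x] by auto
  then have "midpoint_bounded (2 * K) 0 (dist x z) (dist p \<circ> \<gamma>)"
    by (intro almost_affine_shortest_path[OF affine[OF p] \<gamma>(1)]) auto
  from midpoint_bounded_chord'[OF this, of "dist x y"] xy zero_le_dist[of y z]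
  have "\<bar>(dist p y - dist p x) / dist x y - (dist p z - dist p x) / dist x z\<bar> \<le> 2 * K * (dist x z - dist x y)"
    using \<gamma> by (simp del: zero_le_dist)
  also have "\<dots> \<le> 2 * K * dist x z" using K by (intro mult_left_mono) auto
  finally show ?thesis .
qed

text \<open>Infinitesimal injectivity at \<open>x0\<close>: in every direction some distance
  function from \<open>I\<close> changes at a rate of at least \<open>c\<close>, with either
  sign.\<close>

definition separates :: "'a set \<Rightarrow> real \<Rightarrow> real \<Rightarrow> bool" where
  "separates I c \<tau> \<longleftrightarrow> 0 < c \<and> 0 < \<tau> \<and>
    (\<forall>y. 0 < dist x0 y \<and> dist x0 y < \<tau> \<longrightarrow> (\<exists>p\<in>I. c * dist x0 y \<le> \<bar>dist p y - dist p x0\<bar>))"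

text \<open>On the way from \<open>x0\<close> through \<open>y\<close> to a point \<open>q\<close>
  of the sphere, the distance from \<open>q\<close> decreases at unit rate. A point \<open>p\<close>
  of a finite net near \<open>q\<close> inherits this at the scale \<open>T\<close> of the net, and
  the difference quotient carries it down to \<open>y\<close>.\<close>

lemma finite_separating_set:
  obtains I c \<tau> where "finite I" "I \<subseteq> sphere x0 R" "separates I c \<tau>"
proof -
  \<comment> \<open>A net of mesh \<open>T / 8\<close> leaves the rate \<open>-7 / 8\<close> at
    distance \<open>T\<close>, and \<open>2 * K * T \<le> 1 / 4\<close> bounds the change of the
    quotient on the way to \<open>y\<close>; the result stays below \<open>-1 / 2\<close>.\<close>
  define T where "T = min (r / 2) (1 / (8 * K + 8))"
  have T: "T > 0" "T < r" using r K by (auto simp: T_def)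
  have "2 * K * T \<le> 2 * K * (1 / (8 * K + 8))" using K by (intro mult_left_mono) (auto simp: T_def)
  also have "\<dots> \<le> 1 / 4" using K by (simp add: field_simps)
  finally have KT: "2 * K * T \<le> 1 / 4" .
  have "compact (sphere x0 R)"
  proof -
    have "closed {y. dist x0 y = R}" by (intro closed_Collect_eq continuous_intros)
    moreover have "sphere x0 R = cball x0 R \<inter> {y. dist x0 y = R}" by auto
    ultimately show ?thesis using compact_Int_closed[OF compact_cball] by metis
  qed
  then obtain I where I: "I \<subseteq> sphere x0 R" "finite I" "sphere x0 R \<subseteq> (\<Union>p\<in>I. ball p (T / 8))"
    using compactE_image[of "sphere x0 R" "sphere x0 R" "\<lambda>p. ball p (T / 8)"] T by force
  have "\<exists>p\<in>I. 1 / 2 * dist x0 y \<le> \<bar>dist p y - dist p x0\<bar>" if y: "0 < dist x0 y" "dist x0 y < T" for y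
  proof -
    define t where "t = dist x0 y"
    obtain q where q: "dist x0 q = R" "dist x0 y + dist y q = R"
      using extension[of x0 y] y T r by auto
    obtain z where z: "dist y z = T - t" "dist z q = dist y q - (T - t)"
      using point_between[of "T - t" y q] y T r q by (auto simp: t_def)
    have dz: "dist x0 z = T" using dist_triangle[of x0 z y] dist_triangle[of x0 q z] z q by (simp add: t_def)
    obtain p where p: "p \<in> I" "dist p q < T / 8" using I(3) q by auto
    have pR: "dist x0 p = R" using p I by auto
    have "dist p z \<le> R - T + T / 8" using dist_triangle[of p z q] p z q by (simp add: t_def dist_commute)
    then have 1: "(dist p z - dist p x0) / dist x0 z \<le> - 7 / 8" using T pR dz by (simp add: dist_commute field_simps)
    have "\<bar>(dist p y - dist p x0) / dist x0 y - (dist p z - dist p x0) / dist x0 z\<bar> \<le> 2 * K * dist x0 z"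
      using geodesic_difference_quotient[OF pR, of x0 y z] y dz z T by (auto simp: t_def)
    then have "(dist p y - dist p x0) / dist x0 y \<le> - 1 / 2" using 1 KT dz by simp
    then have "dist p y - dist p x0 \<le> - (1 / 2) * dist x0 y" using y by (simp add: pos_divide_le_eq)
    then have "1 / 2 * dist x0 y \<le> \<bar>dist p y - dist p x0\<bar>" by linarith
    then show ?thesis using p by blast
  qed
  then have "separates I (1/2) T" using T by (simp add: separates_def)
  then show thesis using I that by blast
qed

lemma minimal_separating_set:
  obtains I c \<tau> where "finite I" "I \<subseteq> sphere x0 R" "separates I c \<tau>"
    "\<And>p c' \<tau>'. p \<in> I \<Longrightarrow> \<not> separates (I - {p}) c' \<tau>'"
proof -
  define P where "P I \<longleftrightarrow> finite I \<and> I \<subseteq> sphere x0 R \<and> (\<exists>c \<tau>. separates I c \<tau>)" for I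
  obtain I0 c0 \<tau>0 where "finite I0" "I0 \<subseteq> sphere x0 R" "separates I0 c0 \<tau>0"
    by (rule finite_separating_set)
  then have "P I0" unfolding P_def by blast
  then obtain I where I: "P I" "\<And>J. P J \<Longrightarrow> card I \<le> card J"
    using ex_has_least_nat[of P I0 card] by blast
  have min: "\<not> separates (I - {p}) c' \<tau>'" if "p \<in> I" for p c' \<tau>'
  proof
    assume sep: "separates (I - {p}) c' \<tau>'"
    have fin: "finite I" "I \<subseteq> sphere x0 R" using I(1) by (simp_all add: P_def)
    then have "finite (I - {p})" "I - {p} \<subseteq> sphere x0 R" by auto
    then have "P (I - {p})" unfolding P_def using sep by blast
    from I(2)[OF this] show False using card_Diff1_less[OF fin(1) that] by simp
  qed
  obtain c \<tau> where "finite I" "I \<subseteq> sphere x0 R" "separates I c \<tau>" using I(1) unfolding P_def by blast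
  then show thesis by (rule that) (rule min)
qed

end

text \<open>Minimality of the separating set provides, for each of its points, directions at \<open>x0\<close>
  along which only the distance from this point changes to first order.\<close>

locale distance_coordinates = distance_estimates space_type x0 R r K
  for space_type :: "'a::metric_space itself" and x0 :: 'a and R r K +
  fixes n :: nat and p :: "nat \<Rightarrow> 'a" and c \<tau> :: real
  assumes p_inj: "inj_on p {..<n}" and p_sphere: "\<And>i. i < n \<Longrightarrow> dist x0 (p i) = R"
    and sep: "separates (p ` {..<n}) c \<tau>"
    and minimal: "\<And>i c' \<tau>'. i < n \<Longrightarrow> \<not> separates (p ` {..<n} - {p i}) c' \<tau>'"
begin

lemma c_pos: "c > 0" "\<tau> > 0" using sep by (auto simp: separates_def)

lemma sepD:
  assumes "0 < dist x0 y" "dist x0 y < \<tau>"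
  obtains i where "i < n" "c * dist x0 y \<le> \<bar>dist (p i) y - dist (p i) x0\<bar>"
proof -
  have "\<exists>q\<in>p ` {..<n}. c * dist x0 y \<le> \<bar>dist q y - dist q x0\<bar>"
    using sep assms by (simp add: separates_def)
  then show thesis using that by blast
qed

text \<open>Without \<open>p i\<close> the set does not separate, so some arbitrarily close
  \<open>y\<close> changes the other distances little; as the full set separates, the distance from
  \<open>p i\<close> changes by at least \<open>c * dist x0 y\<close>. If the sign is not the
  prescribed one, \<open>y\<close> is replaced by a point opposite to it with \<open>x0\<close> as
  midpoint, which reverses all changes up to a quadratic error.\<close>

lemma coordinate_direction_at_center:
  assumes i: "i < n" and \<sigma>: "\<sigma> \<in> {1, -1::real}" and c1: "c1 > 0" and d: "d > 0"
  obtains y where "0 < dist x0 y" "dist x0 y < d"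
    "\<And>j. j < n \<Longrightarrow> j \<noteq> i \<Longrightarrow> \<bar>dist (p j) y - dist (p j) x0\<bar> \<le> c1 * dist x0 y"
    "c / 2 * dist x0 y \<le> \<sigma> * (dist (p i) y - dist (p i) x0)"
proof -
  \<comment> \<open>At distances \<open>t\<close> up to \<open>m\<close> the reflection error
    \<open>4 * K * t\<^sup>2\<close> is at most half of \<open>c1 * t\<close> and of
    \<open>c * t\<close>.\<close>
  define m where "m = min (c1 / 2) (c / 2) / (4 * K + 1)"
  have m: "m > 0" using c1 c_pos K by (simp add: m_def)
  have "4 * K * m \<le> (4 * K + 1) * m" using m by (intro mult_right_mono) auto
  also have "\<dots> = min (c1 / 2) (c / 2)" using K by (simp add: m_def)
  finally have Km: "4 * K * m \<le> c1 / 2" "4 * K * m \<le> c / 2" by auto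
  define d' where "d' = min (min d \<tau>) (min m (r / 2))"
  have d': "d' > 0" "d' \<le> d" "d' \<le> \<tau>" "d' \<le> m" "d' \<le> r / 2" using d c_pos m r by (auto simp: d'_def)
  \<comment> \<open>Smaller than \<open>c\<close>, so that no point other than \<open>p i\<close>
    can be the one that separates \<open>y\<close> from \<open>x0\<close>.\<close>
  define c2 where "c2 = min c1 c / 2"
  have c2: "c2 > 0" "c2 \<le> c1 / 2" "c2 < c" using c1 c_pos by (auto simp: c2_def)
  obtain y where y: "0 < dist x0 y" "dist x0 y < d'"
    "\<And>q. q \<in> p ` {..<n} - {p i} \<Longrightarrow> \<bar>dist q y - dist q x0\<bar> < c2 * dist x0 y"
    using minimal[OF i, of c2 d'] c2 d' unfolding separates_def by (auto simp: not_le)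
  define t where "t = dist x0 y"
  have t: "t > 0" "t < d'" using y by (auto simp: t_def)
  have small: "4 * K * t \<le> c1 / 2" "4 * K * t \<le> c / 2"
  proof -
    have "4 * K * t \<le> 4 * K * m" using K t d' by (intro mult_left_mono) auto
    then show "4 * K * t \<le> c1 / 2" "4 * K * t \<le> c / 2" using Km by auto
  qed
  have ct: "c2 * t \<le> c1 / 2 * t" "c2 * t < c * t" "4 * K * t * t \<le> c1 / 2 * t" "4 * K * t * t \<le> c / 2 * t"
    using c2 t small by (auto intro: mult_right_mono mult_strict_right_mono)
  have other: "\<bar>dist (p j) y - dist (p j) x0\<bar> \<le> c1 / 2 * t" if "j < n" "j \<noteq> i" for j
  proof -
    have "p j \<noteq> p i" using inj_onD[OF p_inj, of j i] that i by blast
    then have "p j \<in> p ` {..<n} - {p i}" using that by blast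
    from y(3)[OF this] show ?thesis using ct by (simp add: t_def)
  qed
  have self: "c * t \<le> \<bar>dist (p i) y - dist (p i) x0\<bar>"
  proof -
    have "0 < dist x0 y" "dist x0 y < \<tau>" using y d' by auto
    then obtain j where j: "j < n" "c * t \<le> \<bar>dist (p j) y - dist (p j) x0\<bar>"
      unfolding t_def by (rule sepD)
    show ?thesis
    proof (cases "j = i")
      case False
      have "p j \<noteq> p i" using inj_onD[OF p_inj, of j i] False j i by blast
      then have "p j \<in> p ` {..<n} - {p i}" using j by blast
      from y(3)[OF this] show ?thesis using j(2) ct by (simp add: t_def)
    qed (use j in simp)
  qed
  show thesis
  proof (cases "c * t \<le> \<sigma> * (dist (p i) y - dist (p i) x0)")
    case True
    have le: "c1 / 2 * t \<le> c1 * t" "c / 2 * t \<le> c * t" using t c1 c_pos by auto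
    show ?thesis
    proof (rule that[of y])
      fix j assume "j < n" "j \<noteq> i"
      from other[OF this] show "\<bar>dist (p j) y - dist (p j) x0\<bar> \<le> c1 * dist x0 y" using le by (simp add: t_def)
    qed (use t d' True le in \<open>auto simp: t_def\<close>)
  next
    case False
    then have neg: "c * t \<le> - \<sigma> * (dist (p i) y - dist (p i) x0)"
      using self \<sigma> by (auto simp: abs_if split: if_splits)
    have yr: "y \<in> ball x0 r" "y \<noteq> x0" "x0 \<in> ball x0 r" using t d' r by (auto simp: t_def)
    obtain z where z: "dist y x0 + dist x0 z = dist y z" "dist y z = 2 * t"
      using extend_to_length[of y x0 "2 * t"] yr t d' r by (auto simp: t_def dist_commute)
    have zt: "dist x0 z = t" using z by (simp add: t_def dist_commute)
    have mid: "is_midpoint x0 y z" using z zt by (simp add: is_midpoint_def t_def dist_commute)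
    have zr: "z \<in> ball x0 r" using zt t d' r by simp
    have opp: "\<bar>(dist (p j) y - dist (p j) x0) + (dist (p j) z - dist (p j) x0)\<bar> \<le> 4 * K * t * t" if j: "j < n" for j
      using almost_affineD(3)[OF affine[OF p_sphere[OF j]] yr(1) zr yr(3) mid] z(2)
      by (simp add: power2_eq_square algebra_simps)
    show ?thesis
    proof (rule that[of z])
      show "0 < dist x0 z" "dist x0 z < d" using zt t d' by auto
      fix j assume j: "j < n" "j \<noteq> i"
      have "c1 * t = c1 / 2 * t + c1 / 2 * t" by simp
      then show "\<bar>dist (p j) z - dist (p j) x0\<bar> \<le> c1 * dist x0 z"
        using other[OF j] opp[OF j(1)] ct(3) unfolding zt by linarith
    next
      have "c * t = c / 2 * t + c / 2 * t" by simp
      then show "c / 2 * dist x0 z \<le> \<sigma> * (dist (p i) z - dist (p i) x0)"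
        using neg opp[OF i] ct(4) \<sigma> unfolding zt by auto
    qed
  qed
qed

text \<open>For \<open>x\<close> close to \<open>x0\<close> the same target \<open>y\<close> is
  aimed at: the displacement of \<open>x\<close> is negligible compared with the distance
  \<open>t\<close> from \<open>x0\<close> to \<open>y\<close>, and the difference quotient carries
  the slopes over the path from \<open>x\<close> to \<open>y\<close> down to all shorter lengths
  \<open>s\<close>. All small \<open>s\<close> are provided because the descent in
  \<open>\<psi>_open\<close> chooses its step length afterwards.\<close>

lemma coordinate_directions_nearby:
  assumes c1: "c1 > 0"
  obtains \<eta> where "\<eta> > 0" "\<And>x i \<sigma>. x \<in> ball x0 \<eta> \<Longrightarrow> i < n \<Longrightarrow> \<sigma> \<in> {1, -1::real} \<Longrightarrow>
    \<exists>s0>0. \<forall>s. 0 < s \<and> s \<le> s0 \<longrightarrow> (\<exists>z. dist x z = s \<and>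
      (\<forall>j<n. j \<noteq> i \<longrightarrow> \<bar>dist (p j) z - dist (p j) x\<bar> \<le> c1 * s) \<and>
      c / 8 * s \<le> \<sigma> * (dist (p i) z - dist (p i) x))"
proof -
  define Q where "Q i \<sigma> x \<longleftrightarrow> (\<exists>s0>0. \<forall>s. 0 < s \<and> s \<le> s0 \<longrightarrow> (\<exists>z. dist x z = s \<and>
      (\<forall>j<n. j \<noteq> i \<longrightarrow> \<bar>dist (p j) z - dist (p j) x\<bar> \<le> c1 * s) \<and>
      c / 8 * s \<le> \<sigma> * (dist (p i) z - dist (p i) x)))" for i and \<sigma> :: real and x
  have Q: "eventually (Q i \<sigma>) (nhds x0)" if i: "i < n" and \<sigma>: "\<sigma> \<in> {1, -1}" for i \<sigma>
  proof -
    \<comment> \<open>The path from \<open>x\<close> to \<open>y\<close> has length at most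
      \<open>3 * d / 2\<close>, so slopes vary along it by at most \<open>3 * K * d\<close>; this
      has to stay within the margins \<open>c1 / 2\<close> and \<open>c / 16\<close>.\<close>
    define d where "d = min (r / 4) (min (c1 / 2) (c / 16) / (3 * K + 1))"
    have d: "d > 0" "d \<le> r / 4" using r c1 c_pos K by (auto simp: d_def)
    have "3 * K * d \<le> (3 * K + 1) * d" using d by (intro mult_right_mono) auto
    also have "\<dots> \<le> (3 * K + 1) * (min (c1 / 2) (c / 16) / (3 * K + 1))"
      using K by (intro mult_left_mono) (auto simp: d_def)
    also have "\<dots> = min (c1 / 2) (c / 16)" using K by simp
    finally have Kd: "3 * K * d \<le> c1 / 2" "3 * K * d \<le> c / 16" by auto
    \<comment> \<open>A bound sharper than \<open>c1\<close> is asked for at the centre, to leave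
      room for moving the base point and for the variation of slopes.\<close>
    have "c1 / 8 > 0" using c1 by simp
    from coordinate_direction_at_center[OF i \<sigma> this d(1)]
    obtain y where y: "0 < dist x0 y" "dist x0 y < d"
      "\<And>j. j < n \<Longrightarrow> j \<noteq> i \<Longrightarrow> \<bar>dist (p j) y - dist (p j) x0\<bar> \<le> c1 / 8 * dist x0 y"
      "c / 2 * dist x0 y \<le> \<sigma> * (dist (p i) y - dist (p i) x0)" by blast
    define t where "t = dist x0 y"
    have t: "t > 0" "t < d" using y by (auto simp: t_def)
    define \<eta> where "\<eta> = min (t / 2) (min (c1 * t / 16) (c * t / 16))"
    have \<eta>: "\<eta> > 0" "\<eta> \<le> t / 2" "\<eta> \<le> c1 * t / 16" "\<eta> \<le> c * t / 16" using t c1 c_pos by (auto simp: \<eta>_def)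
    have "Q i \<sigma> x" if x: "dist x0 x < \<eta>" for x
    proof -
      define u where "u = dist x y"
      have u: "t / 2 \<le> u" "u \<le> 3 * t / 2"
        using dist_triangle[of x0 y x] dist_triangle[of x y x0] x \<eta>(2) by (auto simp: u_def t_def dist_commute)
      have u0: "u > 0" using u t by simp
      have "2 * K * u \<le> 2 * K * (3 * d / 2)" using K u t by (intro mult_left_mono) auto
      then have Ku: "2 * K * u \<le> c1 / 2" "2 * K * u \<le> c / 16" using Kd by auto
      have move: "\<bar>dist (p j) x - dist (p j) x0\<bar> \<le> \<eta>" for j
        using dist_diff_le[of "p j" x x0] x by (simp add: dist_commute)
      have q_other: "\<bar>(dist (p j) y - dist (p j) x) / u\<bar> \<le> c1 / 2" if j: "j < n" "j \<noteq> i" for j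
      proof -
        have "\<bar>dist (p j) y - dist (p j) x\<bar> \<le> c1 / 8 * t + c1 * t / 16"
          using y(3)[OF j] move[of j] \<eta>(3) unfolding t_def by linarith
        also have "\<dots> \<le> c1 / 2 * (t / 2)" using c1 t by (simp add: field_simps)
        also have "\<dots> \<le> c1 / 2 * u" using u c1 by (intro mult_left_mono) auto
        finally show ?thesis using u0 by (simp add: field_simps)
      qed
      have q_self: "3 / 16 * c \<le> \<sigma> * ((dist (p i) y - dist (p i) x) / u)"
      proof -
        have "3 / 16 * c * u \<le> 3 / 16 * c * (3 * t / 2)" using u c_pos by (intro mult_left_mono) auto
        also have "\<dots> \<le> c / 2 * t - c * t / 16" using c_pos t by (simp add: field_simps)
        also have "\<dots> \<le> \<sigma> * (dist (p i) y - dist (p i) x)"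
          using y(4) move[of i] \<eta>(4) \<sigma> unfolding t_def by auto
        finally show ?thesis using u0 by (simp add: field_simps)
      qed
      have "\<exists>z. dist x z = s \<and> (\<forall>j<n. j \<noteq> i \<longrightarrow> \<bar>dist (p j) z - dist (p j) x\<bar> \<le> c1 * s) \<and>
          c / 8 * s \<le> \<sigma> * (dist (p i) z - dist (p i) x)" if s: "0 < s" "s \<le> u" for s
      proof -
        obtain z where z: "dist x z = s" "dist z y = u - s" using point_between[of s x y] s by (auto simp: u_def)
        have quot: "\<bar>(dist (p j) z - dist (p j) x) / s - (dist (p j) y - dist (p j) x) / u\<bar> \<le> 2 * K * u"
          if j: "j < n" for j
        proof -
          have "dist x0 x + dist x y < r" using x u t d \<eta>(2) by (simp add: u_def)
          then show ?thesis
            using geodesic_difference_quotient[OF p_sphere[OF j], of x z y] z s by (auto simp: u_def)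
        qed
        show ?thesis
        proof (intro exI conjI allI impI)
          show "dist x z = s" by (rule z)
          fix j assume j: "j < n" "j \<noteq> i"
          have "\<bar>(dist (p j) z - dist (p j) x) / s\<bar> \<le> c1" using quot[OF j(1)] q_other[OF j] Ku by linarith
          then show "\<bar>dist (p j) z - dist (p j) x\<bar> \<le> c1 * s" using s by (simp add: pos_divide_le_eq)
        next
          have "c / 8 \<le> \<sigma> * A" if "\<bar>A - B\<bar> \<le> 2 * K * u" "3 / 16 * c \<le> \<sigma> * B" for A B
          proof -
            have "\<sigma> = 1 \<or> \<sigma> = - 1" using \<sigma> by simp
            then show ?thesis
            proof
              assume "\<sigma> = 1"
              then show ?thesis using that Ku by simp
            next
              assume "\<sigma> = - 1"
              then show ?thesis using that Ku by simp
            qed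
          qed
          from this[OF quot[OF i] q_self] have "c / 8 \<le> \<sigma> * ((dist (p i) z - dist (p i) x) / s)" .
          then show "c / 8 * s \<le> \<sigma> * (dist (p i) z - dist (p i) x)" using s by (simp add: pos_le_divide_eq)
        qed
      qed
      then show ?thesis unfolding Q_def using u0 by blast
    qed
    then show ?thesis unfolding eventually_nhds_metric using \<eta>(1) by (auto simp: dist_commute)
  qed
  \<comment> \<open>Only finitely many pairs of \<open>i\<close> and \<open>\<sigma>\<close> occur,
    so one neighbourhood serves them all.\<close>
  have "eventually (\<lambda>x. \<forall>i\<in>{..<n}. \<forall>\<sigma>\<in>{1, -1}. Q i \<sigma> x) (nhds x0)"
    by (intro eventually_ball_finite ballI Q) auto
  then obtain \<eta> where "\<eta> > 0" "\<And>x. dist x x0 < \<eta> \<Longrightarrow> \<forall>i\<in>{..<n}. \<forall>\<sigma>\<in>{1, -1}. Q i \<sigma> x"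
    unfolding eventually_nhds_metric by blast
  then have "Q i \<sigma> x" if "x \<in> ball x0 \<eta>" "i < n" "\<sigma> \<in> {1, -1}" for x i \<sigma>
    using that by (auto simp: dist_commute)
  then show thesis using \<open>\<eta> > 0\<close> that[of \<eta>] unfolding Q_def by blast
qed

section \<open>The coordinate map given by distances from the separating points\<close>

definition \<psi> :: "'a \<Rightarrow> nat \<Rightarrow> real" where
  "\<psi> x = (\<lambda>i. if i < n then dist (p i) x else 0)"

lemma \<psi>_topspace: "\<psi> x \<in> topspace (Euclidean_space n)"
  by (simp add: \<psi>_def topspace_Euclidean_space)

text \<open>Separation is known only from \<open>x0\<close>. The path from \<open>x\<close> through
  \<open>y\<close> is therefore prolonged to a fixed length \<open>t\<close>, large compared with
  \<open>\<eta>\<close>, at which the base point \<open>x\<close> may be exchanged for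
  \<open>x0\<close>; the difference quotient then leads back from \<open>z\<close> to
  \<open>y\<close>.\<close>

lemma \<psi>_lower_bound:
  obtains \<eta> a where "\<eta> > 0" "a > 0"
    "\<And>x y. x \<in> ball x0 \<eta> \<Longrightarrow> y \<in> ball x0 \<eta> \<Longrightarrow> a * dist x y \<le> edist n (\<psi> x) (\<psi> y)"
proof -
  define t where "t = min (min (\<tau> / 2) (r / 2)) (c / 8 / (2 * K + 1))"
  have "t \<le> min (\<tau> / 2) (r / 2)" unfolding t_def by (rule min.cobounded1)
  then have t: "t > 0" "t \<le> \<tau> / 2" "t \<le> r / 2" using c_pos r K by (auto simp: t_def)
  have "2 * K * t \<le> (2 * K + 1) * t" using t by (intro mult_right_mono) auto
  also have "\<dots> \<le> (2 * K + 1) * (c / 8 / (2 * K + 1))" using K by (intro mult_left_mono) (auto simp: t_def)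
  also have "\<dots> = c / 8" using K by (simp add: field_simps)
  finally have Kt: "2 * K * t \<le> c / 8" .
  \<comment> \<open>Exchanging \<open>x\<close> for \<open>x0\<close> costs
    \<open>c * \<eta>\<close> through the length and \<open>\<eta>\<close> through the value of the
    distance function, together at most half of \<open>c * t\<close>.\<close>
  define \<eta> where "\<eta> = min (t / 4) (c * t / (2 * (c + 1)))"
  have "\<eta> \<le> t / 4" unfolding \<eta>_def by (rule min.cobounded1)
  then have \<eta>: "\<eta> > 0" "\<eta> \<le> t / 4" using t c_pos by (auto simp: \<eta>_def)
  have "(c + 1) * \<eta> \<le> (c + 1) * (c * t / (2 * (c + 1)))" using c_pos by (intro mult_left_mono) (auto simp: \<eta>_def)
  also have "\<dots> = c * t / 2" using c_pos by (simp add: field_simps)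
  finally have c\<eta>: "(c + 1) * \<eta> \<le> c * t / 2" .
  show thesis
  proof (rule that[of \<eta> "c / 4"])
    fix x y assume xy: "x \<in> ball x0 \<eta>" "y \<in> ball x0 \<eta>"
    show "c / 4 * dist x y \<le> edist n (\<psi> x) (\<psi> y)"
    proof (cases "x = y")
      case False
      have "x \<in> ball x0 r" "y \<in> ball x0 r" using xy \<eta> t r by auto
      moreover have "dist x y \<le> t" using dist_triangle[of x y x0] xy \<eta> t by (simp add: dist_commute)
      moreover have "t + dist x0 x \<le> R" using xy \<eta> t r by simp
      ultimately obtain z where z: "dist x y + dist y z = dist x z" "dist x z = t"
        using extend_to_length[OF _ _ False, of t] by blast
      have zt: "t - \<eta> \<le> dist x0 z" "dist x0 z \<le> t + \<eta>"
        using dist_triangle[of x z x0] dist_triangle[of x0 z x] z xy by (auto simp: dist_commute)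
      have "0 < dist x0 z" "dist x0 z < \<tau>" using zt \<eta> t by auto
      then obtain i where i: "i < n" "c * dist x0 z \<le> \<bar>dist (p i) z - dist (p i) x0\<bar>"
        by (rule sepD)
      have "c * (t - \<eta>) \<le> c * dist x0 z" using zt c_pos by (intro mult_left_mono) auto
      then have "c * t - c * \<eta> \<le> \<bar>dist (p i) z - dist (p i) x0\<bar>" using i(2) by (simp add: right_diff_distrib)
      moreover have "\<bar>dist (p i) x - dist (p i) x0\<bar> \<le> \<eta>" using dist_diff_le[of "p i" x x0] xy by (simp add: dist_commute)
      moreover have "c * \<eta> + \<eta> \<le> c * t / 2" using c\<eta> by (simp add: distrib_right)
      ultimately have "c * t / 2 \<le> \<bar>dist (p i) z - dist (p i) x\<bar>" by linarith
      then have "c / 2 \<le> \<bar>(dist (p i) z - dist (p i) x) / t\<bar>" using t by (simp add: field_simps)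
      moreover have "\<bar>(dist (p i) y - dist (p i) x) / dist x y - (dist (p i) z - dist (p i) x) / t\<bar> \<le> 2 * K * t"
        using geodesic_difference_quotient[OF p_sphere[OF i(1)] False z(1)] z(2) xy \<eta> t r by simp
      ultimately have "c / 4 \<le> \<bar>(dist (p i) y - dist (p i) x) / dist x y\<bar>" using Kt c_pos by linarith
      then have "c / 4 * dist x y \<le> \<bar>dist (p i) y - dist (p i) x\<bar>" using False by (simp add: pos_le_divide_eq)
      also have "\<dots> \<le> edist n (\<psi> x) (\<psi> y)"
        using edist_component_le[OF i(1), of "\<psi> x" "\<psi> y"] i(1) by (simp add: \<psi>_def abs_minus_commute)
      finally show ?thesis .
    qed simp
  qed (use \<eta> c_pos in auto)
qed

end

context distance_coordinates
begin

text \<open>A point of the image nearest to \<open>u\<close> must be \<open>u\<close>: otherwise one of the coordinate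
  directions decreases the distance to \<open>u\<close>.\<close>

lemma \<psi>_open:
  obtains \<eta> where "\<eta> > 0"
    "\<And>x e. x \<in> ball x0 \<eta> \<Longrightarrow> e > 0 \<Longrightarrow> \<exists>d>0. euclid_ball n (\<psi> x) d \<subseteq> \<psi> ` ball x e"
proof -
  \<comment> \<open>The unwanted changes in the other coordinates add up to a rate of at most
    \<open>n * c1 \<le> c / 16\<close>, half of the rate \<open>c / 8\<close> in the chosen
    coordinate.\<close>
  define c1 where "c1 = c / (16 * n + 16)"
  have c1: "c1 > 0" using c_pos by (simp add: c1_def add_nonneg_pos)
  have nc1: "n * c1 \<le> c / 16" using c_pos by (simp add: c1_def field_simps)
  obtain \<eta>1 where \<eta>1: "\<eta>1 > 0" "\<And>x i \<sigma>. x \<in> ball x0 \<eta>1 \<Longrightarrow> i < n \<Longrightarrow> \<sigma> \<in> {1, -1::real} \<Longrightarrow>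
    \<exists>s0>0. \<forall>s. 0 < s \<and> s \<le> s0 \<longrightarrow> (\<exists>z. dist x z = s \<and>
      (\<forall>j<n. j \<noteq> i \<longrightarrow> \<bar>dist (p j) z - dist (p j) x\<bar> \<le> c1 * s) \<and>
      c / 8 * s \<le> \<sigma> * (dist (p i) z - dist (p i) x))"
    using coordinate_directions_nearby[OF c1] by blast
  obtain \<eta>2 a where \<eta>2: "\<eta>2 > 0" "a > 0"
    "\<And>x y. x \<in> ball x0 \<eta>2 \<Longrightarrow> y \<in> ball x0 \<eta>2 \<Longrightarrow> a * dist x y \<le> edist n (\<psi> x) (\<psi> y)"
    using \<psi>_lower_bound by blast
  define \<eta> where "\<eta> = min \<eta>1 \<eta>2"
  have "\<exists>d>0. euclid_ball n (\<psi> x) d \<subseteq> \<psi> ` ball x e" if x: "x \<in> ball x0 \<eta>" and e: "e > 0" for x e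
  proof -
    define e' where "e' = min (e / 2) ((\<eta> - dist x0 x) / 2)"
    have "e' \<le> e / 2" "e' \<le> (\<eta> - dist x0 x) / 2"
      unfolding e'_def by (rule min.cobounded1, rule min.cobounded2)
    moreover have "e' > 0" using e x by (simp add: e'_def)
    ultimately have e': "e' > 0" "e' < e" "e' < \<eta> - dist x0 x" using e x by auto
    have sub: "dist x0 y < \<eta>" if "dist x y \<le> e'" for y
      using dist_triangle[of x0 y x] that e' by linarith
    have "u \<in> \<psi> ` ball x e" if u: "u \<in> euclid_ball n (\<psi> x) (a * e' / 2)" for u
    proof -
      define Q where "Q y = edist n u (\<psi> y)" for y
      have "continuous_on (cball x e') (\<lambda>y. L2_set (\<lambda>i. u i - dist (p i) y) {..<n})"
        unfolding L2_set_def by (intro continuous_intros)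
      moreover have Q_eq: "Q y = L2_set (\<lambda>i. u i - dist (p i) y) {..<n}" for y
        unfolding Q_def edist_def by (rule L2_set_cong) (auto simp: \<psi>_def)
      ultimately have "continuous_on (cball x e') Q" by simp
      then obtain y where y: "y \<in> cball x e'" "\<And>z. z \<in> cball x e' \<Longrightarrow> Q y \<le> Q z"
        using continuous_attains_inf[OF compact_cball, of x e' Q] e' by auto
      have Qx: "Q x < a * e' / 2" using u unfolding Q_def euclid_ball_def by (simp add: edist_commute)
      \<comment> \<open>On the boundary the images of \<open>x\<close> and \<open>y\<close> would be
        at least \<open>a * e'\<close> apart, although both are closer than
        \<open>a * e' / 2\<close> to \<open>u\<close>.\<close>
      have "dist x y < e'"
      proof (rule ccontr)
        assume "\<not> ?thesis"
        then have "dist x y = e'" using y(1) by simp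
        then have "a * e' \<le> edist n (\<psi> x) (\<psi> y)" using \<eta>2(3)[of x y] x sub[of y] by (auto simp: \<eta>_def)
        also have "\<dots> \<le> Q x + Q y" using edist_triangle[of n "\<psi> x" "\<psi> y" u] by (simp add: Q_def edist_commute)
        also have "\<dots> < a * e'" using y(2)[of x] Qx e' by simp
        finally show False by simp
      qed
      have "Q y = 0"
      proof (rule ccontr)
        assume "Q y \<noteq> 0"
        then have Qpos: "Q y > 0" unfolding Q_def using edist_nonneg[of n u "\<psi> y"] by linarith
        define E where "E j = u j - dist (p j) y" for j
        have QE: "Q y = L2_set E {..<n}" unfolding Q_eq E_def ..
        have "n \<noteq> 0" using Qpos unfolding QE by (intro notI) (simp add: L2_set_def)
        then have "Max ((\<lambda>j. \<bar>E j\<bar>) ` {..<n}) \<in> (\<lambda>j. \<bar>E j\<bar>) ` {..<n}" by (intro Max_in) auto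
        \<comment> \<open>The coordinate with the largest error is corrected, so that this error
          also controls the effect of unwanted changes in the other coordinates.\<close>
        then obtain i where i: "i < n" "\<bar>E i\<bar> = Max ((\<lambda>j. \<bar>E j\<bar>) ` {..<n})" by auto
        have Ei: "\<bar>E j\<bar> \<le> \<bar>E i\<bar>" if "j < n" for j unfolding i(2) using that by (intro Max_ge) auto
        have "E i \<noteq> 0"
        proof
          assume "E i = 0"
          then have "E j = 0" if "j < n" for j using Ei[OF that] by simp
          then have "L2_set E {..<n} = 0" by (simp add: L2_set_def)
          then show False using Qpos QE by simp
        qed
        define \<sigma> where "\<sigma> = sgn (E i)"
        have \<sigma>: "\<sigma> \<in> {1, -1}" "E i = \<sigma> * \<bar>E i\<bar>" using \<open>E i \<noteq> 0\<close> by (auto simp: \<sigma>_def sgn_if)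
        have "y \<in> ball x0 \<eta>1" using sub[of y] \<open>dist x y < e'\<close> by (simp add: \<eta>_def)
        from \<eta>1(2)[OF this i(1) \<sigma>(1)] obtain s0 where s0: "s0 > 0"
          "\<And>s. 0 < s \<Longrightarrow> s \<le> s0 \<Longrightarrow> \<exists>z. dist y z = s \<and>
            (\<forall>j<n. j \<noteq> i \<longrightarrow> \<bar>dist (p j) z - dist (p j) y\<bar> \<le> c1 * s) \<and>
            c / 8 * s \<le> \<sigma> * (dist (p i) z - dist (p i) y)" by blast
        \<comment> \<open>The last bound keeps the quadratic term at most
          \<open>\<bar>E i\<bar> * c / 16 * s\<close>, while the linear gain in the square of the
          distance is at least twice that.\<close>
        define s where "s = min (min s0 ((e' - dist x y) / 2)) (\<bar>E i\<bar> * c / (16 * n))"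
        have "s \<le> min s0 ((e' - dist x y) / 2)" unfolding s_def by (rule min.cobounded1)
        then have s: "s > 0" "s \<le> s0" "s \<le> (e' - dist x y) / 2"
          using s0(1) \<open>dist x y < e'\<close> \<open>E i \<noteq> 0\<close> c_pos \<open>n \<noteq> 0\<close> by (auto simp: s_def)
        have "s \<le> \<bar>E i\<bar> * c / (16 * n)" by (simp add: s_def)
        then have ns: "n * s \<le> \<bar>E i\<bar> * c / 16" using \<open>n \<noteq> 0\<close> by (simp add: field_simps)
        obtain z where z: "dist y z = s"
          "\<And>j. j < n \<Longrightarrow> j \<noteq> i \<Longrightarrow> \<bar>dist (p j) z - dist (p j) y\<bar> \<le> c1 * s"
          "c / 8 * s \<le> \<sigma> * (dist (p i) z - dist (p i) y)" using s0(2)[OF s(1,2)] by blast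
        define D where "D j = dist (p j) z - dist (p j) y" for j
        have "z \<in> cball x e'" using dist_triangle[of x z y] z(1) s(3) \<open>dist x y < e'\<close> by simp
        then have "Q y \<le> Q z" by (rule y(2))
        moreover have "Q z = L2_set (\<lambda>j. E j - D j) {..<n}" unfolding Q_eq E_def D_def by simp
        ultimately have "L2_set E {..<n} \<le> L2_set (\<lambda>j. E j - D j) {..<n}" using QE by simp
        then have le: "(\<Sum>j<n. (E j)\<^sup>2) \<le> (\<Sum>j<n. (E j - D j)\<^sup>2)" unfolding L2_set_def by simp
        have expand: "(\<Sum>j<n. (E j - D j)\<^sup>2) = (\<Sum>j<n. (E j)\<^sup>2) - 2 * (\<Sum>j<n. E j * D j) + (\<Sum>j<n. (D j)\<^sup>2)"
          by (simp add: power2_diff sum.distrib sum_subtractf sum_distrib_left mult_ac)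
        have "(\<Sum>j<n. (D j)\<^sup>2) \<le> (\<Sum>j<n. s\<^sup>2)"
        proof (rule sum_mono)
          fix j
          have "\<bar>D j\<bar> \<le> s" using dist_diff_le[of "p j" z y] z(1) by (simp add: D_def dist_commute)
          then show "(D j)\<^sup>2 \<le> s\<^sup>2" using power_mono[of "\<bar>D j\<bar>" s 2] by simp
        qed
        also have "\<dots> = n * s * s" by (simp add: power2_eq_square)
        also have "\<dots> \<le> \<bar>E i\<bar> * c / 16 * s" using ns s by (intro mult_right_mono) auto
        finally have DD: "(\<Sum>j<n. (D j)\<^sup>2) \<le> \<bar>E i\<bar> * c / 16 * s" .
        have "E i * D i \<ge> \<bar>E i\<bar> * (c / 8 * s)"
        proof -
          have "E i * D i = \<bar>E i\<bar> * (\<sigma> * D i)" by (subst \<sigma>(2)) simp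
          moreover have "c / 8 * s \<le> \<sigma> * D i" using z(3) by (simp only: D_def)
          then have "\<bar>E i\<bar> * (c / 8 * s) \<le> \<bar>E i\<bar> * (\<sigma> * D i)" by (rule mult_left_mono) simp
          ultimately show ?thesis by (simp only:)
        qed
        moreover have "(\<Sum>j\<in>{..<n} - {i}. E j * D j) \<ge> (\<Sum>j\<in>{..<n} - {i}. - (\<bar>E i\<bar> * (c1 * s)))"
        proof (rule sum_mono)
          fix j assume j: "j \<in> {..<n} - {i}"
          then have "\<bar>E j * D j\<bar> \<le> \<bar>E i\<bar> * (c1 * s)"
            unfolding abs_mult using Ei[of j] z(2)[of j] by (intro mult_mono) (auto simp: D_def)
          then show "- (\<bar>E i\<bar> * (c1 * s)) \<le> E j * D j" by linarith
        qed
        moreover have "(\<Sum>j\<in>{..<n} - {i}. - (\<bar>E i\<bar> * (c1 * s))) \<ge> - (n * (\<bar>E i\<bar> * (c1 * s)))"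
        proof -
          have "(\<Sum>j\<in>{..<n} - {i}. - (\<bar>E i\<bar> * (c1 * s))) \<ge> (\<Sum>j<n. - (\<bar>E i\<bar> * (c1 * s)))"
            using i(1) c1 s by (subst sum.remove[of "{..<n}" i]) auto
          then show ?thesis by simp
        qed
        moreover have "(\<Sum>j<n. E j * D j) = E i * D i + (\<Sum>j\<in>{..<n} - {i}. E j * D j)"
          using i(1) by (subst sum.remove[of "{..<n}" i]) auto
        moreover have "n * (\<bar>E i\<bar> * (c1 * s)) \<le> \<bar>E i\<bar> * c / 16 * s"
        proof -
          have "n * c1 * (\<bar>E i\<bar> * s) \<le> c / 16 * (\<bar>E i\<bar> * s)" using nc1 s by (intro mult_right_mono) auto
          then show ?thesis by (simp add: mult_ac)
        qed
        moreover have "\<bar>E i\<bar> * (c / 8 * s) = 2 * (\<bar>E i\<bar> * c / 16 * s)" by simp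
        ultimately have ED: "\<bar>E i\<bar> * c / 16 * s \<le> (\<Sum>j<n. E j * D j)" by linarith
        have "\<bar>E i\<bar> * c / 16 * s > 0" using \<open>E i \<noteq> 0\<close> c_pos s by simp
        then show False using le expand DD ED by linarith
      qed
      then have "u = \<psi> y" using u \<psi>_topspace[of y] by (simp add: Q_def euclid_ball_def edist_eq_0_iff)
      then show ?thesis using \<open>dist x y < e'\<close> e' by auto
    qed
    then show ?thesis using \<eta>2(2) e'(1) by (intro exI[of _ "a * e' / 2"]) auto
  qed
  then show thesis using \<eta>1(1) \<eta>2(1) by (intro that[of \<eta>]) (auto simp: \<eta>_def)
qed

lemma chart_at_center: "\<exists>U. x0 \<in> U \<and> good_chart n (U, \<psi>)"
proof -
  obtain \<eta>1 where \<eta>1: "\<eta>1 > 0"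
    "\<And>x e. x \<in> ball x0 \<eta>1 \<Longrightarrow> e > 0 \<Longrightarrow> \<exists>d>0. euclid_ball n (\<psi> x) d \<subseteq> \<psi> ` ball x e"
    using \<psi>_open by blast
  obtain \<eta>2 a where \<eta>2: "\<eta>2 > 0" "a > 0"
    "\<And>x y. x \<in> ball x0 \<eta>2 \<Longrightarrow> y \<in> ball x0 \<eta>2 \<Longrightarrow> a * dist x y \<le> edist n (\<psi> x) (\<psi> y)"
    using \<psi>_lower_bound by blast
  define U where "U = ball x0 (min r (min \<eta>1 \<eta>2))"
  have U: "open U" "x0 \<in> U" "U \<subseteq> ball x0 r" "U \<subseteq> ball x0 \<eta>1" "U \<subseteq> ball x0 \<eta>2"
    using r(1) \<eta>1(1) \<eta>2(1) by (auto simp: U_def)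
  have open_image: "openin (Euclidean_space n) (\<psi> ` S)" if S: "open S" "S \<subseteq> U" for S
    unfolding openin_Euclidean_space_iff
  proof (intro conjI ballI)
    show "\<psi> ` S \<subseteq> topspace (Euclidean_space n)" using \<psi>_topspace by blast
    fix u assume "u \<in> \<psi> ` S"
    then obtain x where x: "x \<in> S" "u = \<psi> x" by blast
    obtain e where e: "e > 0" "ball x e \<subseteq> S" using S(1) x(1) open_contains_ball by blast
    have "x \<in> ball x0 \<eta>1" using x(1) S(2) U(4) by blast
    from \<eta>1(2)[OF this e(1)] show "\<exists>d>0. euclid_ball n u d \<subseteq> \<psi> ` S" using e(2) x(2) by blast
  qed
  have lower: "dist x y \<le> 1 / a * edist n (\<psi> x) (\<psi> y)" if "x \<in> U" "y \<in> U" for x y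
    using \<eta>2(3)[of x y] that U(5) \<eta>2(2) by (simp add: field_simps subset_iff)
  have inj: "inj_on \<psi> U"
  proof (rule inj_onI)
    fix x y assume "x \<in> U" "y \<in> U" "\<psi> x = \<psi> y"
    then show "x = y" using lower[of x y] by simp
  qed
  have cont: "continuous_map (top_of_set U) (Euclidean_space n) \<psi>"
    unfolding \<psi>_def continuous_map_componentwise_Euclidean_space
    by (auto intro!: continuous_intros)
  have "homeomorphic_map (top_of_set U) (subtopology (Euclidean_space n) (\<psi> ` U)) \<psi>"
  proof (rule bijective_open_imp_homeomorphic_map)
    show "continuous_map (top_of_set U) (subtopology (Euclidean_space n) (\<psi> ` U)) \<psi>"
      using cont by (simp add: continuous_map_in_subtopology)
    show "open_map (top_of_set U) (subtopology (Euclidean_space n) (\<psi> ` U)) \<psi>"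
      unfolding open_map_def
    proof (intro allI impI)
      fix S assume "openin (top_of_set U) S"
      then have S: "open S" "S \<subseteq> U" using U(1) by (auto simp: openin_open_eq)
      have "\<psi> ` S \<subseteq> \<psi> ` U" using S by blast
      then show "openin (subtopology (Euclidean_space n) (\<psi> ` U)) (\<psi> ` S)"
        using open_image[OF S] by (metis inf.absorb1 openin_subtopology_Int)
    qed
    show "\<psi> ` topspace (top_of_set U) = topspace (subtopology (Euclidean_space n) (\<psi> ` U))"
      using \<psi>_topspace by auto
    show "inj_on \<psi> (topspace (top_of_set U))" using inj by simp
  qed
  moreover have "\<exists>d>0. \<exists>C. ball x d \<subseteq> U \<and> (\<forall>y\<in>ball x d. \<forall>z\<in>ball x d. dist y z \<le> C * edist n (\<psi> y) (\<psi> z))"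
    if x: "x \<in> U" for x
  proof -
    obtain d where d: "d > 0" "ball x d \<subseteq> U" using U(1) x open_contains_ball by blast
    then have "\<forall>y\<in>ball x d. \<forall>z\<in>ball x d. dist y z \<le> 1 / a * edist n (\<psi> y) (\<psi> z)"
      using lower by blast
    then show ?thesis using d by blast
  qed
  moreover have "locally_almost_affine U (\<lambda>x. \<psi> x i)" if i: "i < n" for i
    using locally_almost_affineI[OF U(1) almost_affine_mono[OF affine[OF p_sphere[OF i]] U(3) order_refl]] i
    by (simp add: \<psi>_def)
  moreover have "openin (Euclidean_space n) (\<psi> ` U)" using open_image[OF U(1)] by simp
  ultimately have "good_chart n (U, \<psi>)" unfolding good_chart_def using U(1) by simp
  then show ?thesis using U(2) by blast
qed

end

lemma (in distance_estimates) good_chart_at_center: "\<exists>n c. good_chart n c \<and> x0 \<in> fst c"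
proof (rule minimal_separating_set)
  fix I c \<tau> assume I: "finite I" "I \<subseteq> sphere x0 R" "separates I c \<tau>"
    "\<And>p c' \<tau>'. p \<in> I \<Longrightarrow> \<not> separates (I - {p}) c' \<tau>'"
  obtain p where p: "bij_betw p {..<card I} I"
    using ex_bij_betw_nat_finite[OF I(1)] by (auto simp: atLeast0LessThan)
  have pI: "p ` {..<card I} = I" using p by (rule bij_betw_imp_surj_on)
  interpret distance_coordinates space_type x0 R r K "card I" p c \<tau>
  proof
    show "inj_on p {..<card I}" using p by (rule bij_betw_imp_inj_on)
    show "dist x0 (p i) = R" if "i < card I" for i using I(2) pI that by force
    show "separates (p ` {..<card I}) c \<tau>" unfolding pI by (rule I(3))
    show "\<not> separates (p ` {..<card I} - {p i}) c' \<tau>'" if "i < card I" for i c' \<tau>'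
      unfolding pI by (rule I(4)) (use pI that in blast)
  qed
  obtain U where "x0 \<in> U" "good_chart (card I) (U, \<psi>)" using chart_at_center by blast
  then show ?thesis by (intro exI[of _ "card I"] exI[of _ "(U, \<psi>)"]) simp
qed

section \<open>Constancy of the dimension and global topology\<close>

context semiconcave_G_space
begin

lemma good_chart_exists: "\<exists>n c. good_chart n c \<and> (x0 :: 'a) \<in> fst c"
proof (rule local_distance_estimates[of x0])
  fix r R K assume est: "0 < r" "4 * r \<le> R" "0 \<le> K"
    "\<And>p. dist x0 p = R \<Longrightarrow> almost_affine (ball x0 r) K (dist p)"
    "\<And>x y. x \<in> ball x0 r \<Longrightarrow> y \<in> ball x0 r \<Longrightarrow> x \<noteq> y \<Longrightarrow>
      \<exists>z. dist x0 z = R \<and> dist x y + dist y z = dist x z"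
  interpret distance_estimates space_type x0 R r K
    by unfold_locales (rule est; assumption)+
  show ?thesis by (rule good_chart_at_center)
qed

text \<open>If \<open>m < n\<close>, Euclidean m-space lies in n-space as the set where all
  coordinates from \<open>m\<close> on vanish, and the overlap yields a continuous injection of an
  open subset of n-space into it. Invariance of domain makes the image open in n-space, which is
  impossible.\<close>

lemma good_chart_dimension_le:
  assumes c: "good_chart m (U, \<phi>)" and c': "good_chart n (V, \<psi>)" and x: "(x::'a) \<in> U \<inter> V"
  shows "n \<le> m"
proof (rule ccontr)
  assume "\<not> n \<le> m"
  then have mn: "m < n" by simp
  define W where "W = U \<inter> V"
  have W: "W \<subseteq> U" "W \<subseteq> V" by (auto simp: W_def)
  obtain g where g: "homeomorphic_maps (top_of_set W) (subtopology (Euclidean_space n) (\<psi> ` W)) \<psi> g"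
    using good_chart_restrict_homeomorphic[OF c' W(2)] homeomorphic_map_maps by blast
  have g\<psi>: "g (\<psi> y) = y" if "y \<in> W" for y using g that by (simp add: homeomorphic_maps_def)
  have incl: "continuous_map (Euclidean_space m) (Euclidean_space n) id"
  proof -
    have "Euclidean_space m = subtopology (Euclidean_space n) (topspace (Euclidean_space m))"
      using mn by (simp add: Euclidean_space_top_of_set subtopology_subtopology) (auto intro: arg_cong)
    then show ?thesis by (metis continuous_map_from_subtopology continuous_map_id)
  qed
  have "continuous_map (top_of_set W) (subtopology (Euclidean_space m) (\<phi> ` W)) \<phi>"
    using good_chart_restrict_homeomorphic[OF c W(1)] by (rule homeomorphic_imp_continuous_map)
  then have "continuous_map (top_of_set W) (Euclidean_space n) (id \<circ> \<phi>)"
    by (intro continuous_map_compose[OF _ incl]) (simp add: continuous_map_in_subtopology)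
  moreover have "continuous_map (subtopology (Euclidean_space n) (\<psi> ` W)) (top_of_set W) g"
    using g by (simp add: homeomorphic_maps_def)
  ultimately have "continuous_map (subtopology (Euclidean_space n) (\<psi> ` W)) (Euclidean_space n) (\<phi> \<circ> g)"
    using continuous_map_compose by (metis id_comp)
  moreover have "inj_on (\<phi> \<circ> g) (\<psi> ` W)"
    using inj_on_subset[OF good_chartD(3)[OF c] W(1)] g\<psi> by (auto simp: inj_on_def)
  moreover have "openin (Euclidean_space n) (\<psi> ` W)"
  proof -
    have "openin (top_of_set V) W" using openin_open_Int[OF good_chartD(1)[OF c], of V] by (simp add: W_def Int_commute)
    then have "openin (subtopology (Euclidean_space n) (\<psi> ` V)) (\<psi> ` W)"
      using homeomorphic_imp_open_map[OF good_chartD(4)[OF c']] unfolding open_map_def by blast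
    then show ?thesis using good_chartD(2)[OF c'] openin_trans_full by blast
  qed
  ultimately have "openin (Euclidean_space n) ((\<phi> \<circ> g) ` \<psi> ` W)"
    by (intro invariance_of_domain_Euclidean_space)
  moreover have "(\<phi> \<circ> g) ` \<psi> ` W = \<phi> ` W" using g\<psi> by (auto simp: image_image)
  ultimately have op: "openin (Euclidean_space n) (\<phi> ` W)" by simp
  then obtain e where e: "e > 0" "euclid_ball n (\<phi> x) e \<subseteq> \<phi> ` W"
    using x unfolding openin_Euclidean_space_iff W_def by blast
  have "\<phi> x \<in> topspace (Euclidean_space n)" using op openin_subset x W_def by blast
  \<comment> \<open>Coordinates are numbered from 0: \<open>m\<close> is the first index at which
    all values of \<open>\<phi>\<close> on \<open>U\<close> vanish, and it is still below
    \<open>n\<close>.\<close>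
  then have "(\<phi> x)(m := \<phi> x m + e / 2) \<in> euclid_ball n (\<phi> x) e"
    using mn e(1) by (intro fun_upd_euclid_ball[where d = "e / 2"]) auto
  then have "(\<phi> x)(m := \<phi> x m + e / 2) \<in> \<phi> ` W" using e(2) by (rule subsetD[rotated])
  then obtain y where "y \<in> W" "(\<phi> x)(m := \<phi> x m + e / 2) = \<phi> y" by (rule imageE)
  then have "(\<phi> x)(m := \<phi> x m + e / 2) \<in> topspace (Euclidean_space m)"
    using good_chartD(6)[OF c, of y] W(1) by (simp add: subset_iff)
  then have "((\<phi> x)(m := \<phi> x m + e / 2)) m = 0" unfolding topspace_Euclidean_space by blast
  moreover have "\<phi> x m = 0" using good_chartD(6)[OF c, of x] x by (simp add: topspace_Euclidean_space)
  ultimately show False using e(1) by simp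
qed

lemma connected_UNIV: "connected (UNIV :: 'a set)"
proof (rule connectedI)
  fix A B :: "'a set" assume AB: "open A" "open B" "UNIV \<subseteq> A \<union> B" "A \<inter> B \<inter> UNIV = {}" "A \<inter> UNIV \<noteq> {}" "B \<inter> UNIV \<noteq> {}"
  then obtain x y where xy: "x \<in> A" "y \<in> B" by blast
  obtain \<gamma> where \<gamma>: "shortest_path 0 (dist x y) \<gamma>" "\<gamma> 0 = x" "\<gamma> (dist x y) = y" by (rule geodesic_exists)
  have "1-lipschitz_on {0..dist x y} \<gamma>"
    using shortest_path_dist[OF \<gamma>(1)] by (auto intro!: lipschitz_onI simp: dist_real_def)
  then have "connected (\<gamma> ` {0..dist x y})"
    by (intro connected_continuous_image lipschitz_on_continuous_on) auto
  moreover have "x \<in> \<gamma> ` {0..dist x y}" using \<gamma>(2) by (intro image_eqI[of _ _ 0]) auto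
  moreover have "y \<in> \<gamma> ` {0..dist x y}" using \<gamma>(3) by (intro image_eqI[of _ _ "dist x y"]) auto
  ultimately show False using connectedD[of "\<gamma> ` {0..dist x y}" A B] AB xy by blast
qed

text \<open>The sets \<open>D n\<close> are open, cover the space and are pairwise disjoint by the
  comparison of dimensions, so by connectedness only one of them is nonempty.\<close>

lemma good_chart_cover:
  obtains n where "\<And>x::'a. \<exists>c. good_chart n c \<and> x \<in> fst c"
proof -
  define D where "D n = (\<Union>c\<in>{c. good_chart n (c :: 'a chart)}. fst c)" for n
  have op: "open (D n)" for n unfolding D_def by (rule open_UN) (simp add: good_chart_def)
  have cover: "\<exists>n. x \<in> D n" for x using good_chart_exists[of x] unfolding D_def by simp
  have disj: "m = n" if "x \<in> D m" "x \<in> D n" for m n x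
  proof -
    obtain c where c: "good_chart m c" "x \<in> fst c" using \<open>x \<in> D m\<close> unfolding D_def by (elim UN_E) simp
    obtain c' where c': "good_chart n c'" "x \<in> fst c'" using \<open>x \<in> D n\<close> unfolding D_def by (elim UN_E) simp
    have "n \<le> m" "m \<le> n"
      using good_chart_dimension_le[of m "fst c" "snd c" n "fst c'" "snd c'" x]
        good_chart_dimension_le[of n "fst c'" "snd c'" m "fst c" "snd c" x] c c' by simp_all
    then show ?thesis by simp
  qed
  \<comment> \<open>\<open>undefined\<close> serves as some point of the space; its dimension is the
    common one.\<close>
  obtain n where n: "undefined \<in> D n" using cover by blast
  have all: "x \<in> D n" for x
  proof (rule ccontr)
    assume "x \<notin> D n"
    have 1: "open (\<Union>m\<in>-{n}. D m)" using op by blast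
    have 2: "D n \<inter> (\<Union>m\<in>-{n}. D m) \<inter> UNIV = {}" using disj by fastforce
    have 3: "UNIV \<subseteq> D n \<union> (\<Union>m\<in>-{n}. D m)" using cover by fastforce
    have 4: "(\<Union>m\<in>-{n}. D m) \<inter> UNIV \<noteq> {}" using 3 \<open>x \<notin> D n\<close> by blast
    have "D n \<inter> UNIV = {} \<or> (\<Union>m\<in>-{n}. D m) \<inter> UNIV = {}"
      by (rule connectedD[OF connected_UNIV op 1 2 3])
    then show False using 4 n by blast
  qed
  have "\<exists>c. good_chart n c \<and> x \<in> fst c" for x :: 'a using all[of x] unfolding D_def by auto
  then show thesis by (rule that)
qed

text \<open>The space is a countable union of compact balls, each covered by finitely many balls of
  every radius \<open>1 / Suc j\<close>; these small balls together form a countable base.\<close>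

lemma second_countable_space: "second_countable (euclidean :: 'a topology)"
proof -
  have "\<exists>F. finite F \<and> cball x (real k) \<subseteq> (\<Union>y\<in>F. ball y (1 / Suc j))" for x :: 'a and k j :: nat
    using compactE_image[OF compact_cball, of "UNIV" "\<lambda>y. ball y (1 / Suc j)" x "real k"]
    by (metis UN_I UNIV_I centre_in_ball divide_pos_pos of_nat_0_less_iff open_ball subsetI zero_less_Suc zero_less_one)
  then obtain F where F: "\<And>x k j. finite (F x k j)" "\<And>x k j. cball x (real k) \<subseteq> (\<Union>y\<in>F x k j. ball (y::'a) (1 / Suc j))"
    by metis
  define \<B> where "\<B> = (\<Union>k j. (\<lambda>y. ball (y::'a) (1 / Suc j)) ` F undefined k j)"
  have "countable \<B>" unfolding \<B>_def by (intro countable_UN countableI_type countable_image) (auto intro: countable_finite F(1))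
  moreover have "\<exists>V\<in>\<B>. x \<in> V \<and> V \<subseteq> U" if U: "open U" "x \<in> U" for U x
  proof -
    obtain e where e: "e > 0" "ball x e \<subseteq> U" using U open_contains_ball by blast
    obtain j where j: "1 / Suc j < e / 2" using nat_approx_posE[of "e/2"] e by auto
    obtain k :: nat where "dist undefined x \<le> k" using real_arch_simple by blast
    then obtain y where y: "y \<in> F undefined k j" "x \<in> ball y (1 / Suc j)" using F(2)[of undefined k j] by force
    have "ball y (1 / Suc j) \<subseteq> ball x e"
    proof
      fix z assume "z \<in> ball y (1 / Suc j)"
      then show "z \<in> ball x e" using y(2) j dist_triangle[of x z y] by (simp add: dist_commute)
    qed
    then show ?thesis using y e(2) unfolding \<B>_def by blast
  qed
  moreover have "openin euclidean V" if "V \<in> \<B>" for V using that unfolding \<B>_def by auto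
  ultimately show ?thesis unfolding second_countable_def by (intro exI[of _ \<B>]) auto
qed

lemma topological_manifold_of_good_charts:
  assumes "\<And>x::'a. \<exists>c. good_chart n c \<and> x \<in> fst c"
  shows "topological_manifold n (euclidean :: 'a topology)"
proof -
  have "\<exists>U V. openin euclidean U \<and> x \<in> U \<and> openin (Euclidean_space n) V \<and>
      subtopology euclidean U homeomorphic_space subtopology (Euclidean_space n) V" for x :: 'a
  proof -
    obtain U \<phi> where c: "good_chart n (U, \<phi>)" "x \<in> U" using assms[of x] by auto
    then show ?thesis
      using good_chartD(1,2,4)[OF c(1)] homeomorphic_map_imp_homeomorphic_space
      by (intro exI[of _ U] exI[of _ "\<phi> ` U"]) auto
  qed
  then show ?thesis unfolding topological_manifold_def using second_countable_space by auto
qed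

end

section \<open>The norm induced by the metric in a chart\<close>

text \<open>As for derivatives of midpoint bounded functions, the limit is the supremum of the lower
  estimates, which all lie below the upper ones.\<close>

lemma right_limit_of_linear_oscillation:
  fixes q :: "real \<Rightarrow> real"
  assumes T: "T > 0" and C: "C \<ge> 0"
    and q: "\<And>t s. 0 < t \<Longrightarrow> t \<le> s \<Longrightarrow> s \<le> T \<Longrightarrow> \<bar>q t - q s\<bar> \<le> C * s"
  obtains A where "(q \<longlongrightarrow> A) (at_right 0)" "\<And>t. 0 < t \<Longrightarrow> t \<le> T \<Longrightarrow> \<bar>q t - A\<bar> \<le> C * t"
proof -
  define A where "A = (SUP t\<in>{0<..T}. q t - C * t)"
  have le: "q s - C * s \<le> q t + C * t" if "s \<in> {0<..T}" "t \<in> {0<..T}" for s t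
  proof (cases "s \<le> t")
    case True
    then have "\<bar>q s - q t\<bar> \<le> C * t" using q[of s t] that by simp
    moreover have "0 \<le> C * s" using C that by simp
    ultimately show ?thesis by linarith
  next
    case False
    then have "\<bar>q t - q s\<bar> \<le> C * s" using q[of t s] that by simp
    moreover have "0 \<le> C * t" using C that by simp
    ultimately show ?thesis by linarith
  qed
  have "bdd_above ((\<lambda>t. q t - C * t) ` {0<..T})"
    using le[of _ T] T by (intro bdd_aboveI2[of "{0<..T}" _ "q T + C * T"]) auto
  then have A1: "q t - C * t \<le> A" if "t \<in> {0<..T}" for t
    unfolding A_def using that by (intro cSUP_upper)
  have A2: "A \<le> q t + C * t" if "t \<in> {0<..T}" for t
  proof -
    have "{0<..T} \<noteq> {}" using T by simp
    then show ?thesis unfolding A_def using le[OF _ that] by (intro cSUP_least)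
  qed
  have b: "\<bar>q t - A\<bar> \<le> C * t" if "0 < t" "t \<le> T" for t
    using A1[of t] A2[of t] that by (simp add: abs_le_iff)
  have "(q \<longlongrightarrow> A) (at_right 0)"
  proof (rule LIM_zero_cancel, rule Lim_null_comparison)
    show "((\<lambda>t. C * t) \<longlongrightarrow> 0) (at_right 0)" by (rule tendsto_eq_intros refl | simp)+
    show "eventually (\<lambda>t. norm (q t - A) \<le> C * t) (at_right 0)"
      using eventually_at_right_real[OF T] by eventually_elim (use b in auto)
  qed
  then show thesis using b by (rule that)
qed

lemma divide_Suc_bounds:
  fixes x e :: real
  assumes "0 \<le> x"
  shows "0 < e \<Longrightarrow> e / (4 * (x + 1)) * x < e / 4" "e / (2 * (x + 1)) * (x + 1) = e / 2"
  using assms by (simp_all add: field_simps)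

text \<open>The one-sided derivative at \<open>t = 0\<close> of the distance along the ray from
  \<open>u\<close>; the limit is meaningful only where its existence has been shown.\<close>

definition metric_norm :: "((nat \<Rightarrow> real) \<Rightarrow> (nat \<Rightarrow> real) \<Rightarrow> real) \<Rightarrow> (nat \<Rightarrow> real) \<Rightarrow> (nat \<Rightarrow> real) \<Rightarrow> real" where
  "metric_norm \<rho> u w = Lim (at_right 0) (\<lambda>t. \<rho> u (\<lambda>i. u i + t * w i) / t)"

text \<open>Near a point, the distance is the supremum of the differences of the distance functions
  from the points of a small sphere, which are uniformly of class \<open>C\<^sup>1\<^sup>,\<^sup>1\<close> in a chart.\<close>

locale sup_metric =
  fixes n :: nat and a :: "nat \<Rightarrow> real" and e K M :: real
    and \<rho> :: "(nat \<Rightarrow> real) \<Rightarrow> (nat \<Rightarrow> real) \<Rightarrow> real" and H :: "((nat \<Rightarrow> real) \<Rightarrow> real) set"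
  assumes center: "a \<in> topspace (Euclidean_space n)" and e_pos: "e > 0" and K_nonneg: "K \<ge> 0" and M_ge: "M \<ge> 1"
    and C11: "\<And>h. h \<in> H \<Longrightarrow> C11_ball n a e K h"
    and le_rho: "\<And>h u v. h \<in> H \<Longrightarrow> u \<in> euclid_ball n a e \<Longrightarrow> v \<in> euclid_ball n a e \<Longrightarrow> h u - h v \<le> \<rho> u v"
    and attained: "\<And>u v. u \<in> euclid_ball n a e \<Longrightarrow> v \<in> euclid_ball n a e \<Longrightarrow> u \<noteq> v \<Longrightarrow> \<exists>h\<in>H. \<rho> u v = h u - h v"
    and rho_refl: "\<And>u. \<rho> u u = 0" and rho_commute: "\<And>u v. \<rho> u v = \<rho> v u"
    and rho_triangle: "\<And>u v w. \<rho> u w \<le> \<rho> u v + \<rho> v w"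
    and rho_lower: "\<And>u v. u \<in> euclid_ball n a e \<Longrightarrow> v \<in> euclid_ball n a e \<Longrightarrow> edist n u v \<le> M * \<rho> u v"
    and rho_upper: "\<And>u v. u \<in> euclid_ball n a e \<Longrightarrow> v \<in> euclid_ball n a e \<Longrightarrow> \<rho> u v \<le> M * edist n u v"
begin

section \<open>The norm as first-order part of a supremum of regular functions\<close>

abbreviation len :: "(nat \<Rightarrow> real) \<Rightarrow> real" where "len w \<equiv> L2_set w {..<n}"
abbreviation N :: "(nat \<Rightarrow> real) \<Rightarrow> (nat \<Rightarrow> real) \<Rightarrow> real" where "N \<equiv> metric_norm \<rho>"

lemma rho_nonneg: "0 \<le> \<rho> u v"
  using rho_triangle[of u u v] unfolding rho_refl rho_commute[of v u] by linarith

text \<open>A function \<open>h\<close> that attains the supremum at one base point is a competitor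
  at the other, and the parallelogram estimate compares its two differences. The constant is common
  to all of \<open>H\<close>, so the estimate passes to the supremum.\<close>

lemma rho_translate:
  assumes u: "u \<in> euclid_ball n a (e / 4)" "v \<in> euclid_ball n a (e / 4)"
    and w: "w \<in> topspace (Euclidean_space n)" "len w < e / 4"
  shows "\<bar>\<rho> u (\<lambda>i. u i + w i) - \<rho> v (\<lambda>i. v i + w i)\<bar> \<le> 12 * K * len w * (len w + edist n u v)"
proof -
  have in_ball: "x \<in> euclid_ball n a e \<and> (\<lambda>i. x i + w i) \<in> euclid_ball n a e" if "x \<in> euclid_ball n a (e / 4)" for x
    using euclid_ball_add[OF that w(1), of "e/4"] w(2) that e_pos
      euclid_ball_mono[of "e/4" e n a] euclid_ball_mono[of "e/4 + e/4" e n a] by auto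
  have nonneg: "0 \<le> 12 * K * len w * (len w + edist n u v)" using K_nonneg by simp
  have one: "\<rho> x (\<lambda>i. x i + w i) - \<rho> y (\<lambda>i. y i + w i) \<le> 12 * K * len w * (len w + edist n u v)"
    if xy: "x \<in> euclid_ball n a (e / 4)" "y \<in> euclid_ball n a (e / 4)" "edist n x y = edist n u v" for x y
  proof (cases "x = (\<lambda>i. x i + w i)")
    case True
    then have "\<rho> x (\<lambda>i. x i + w i) = 0" using rho_refl[of x] by simp
    moreover have "0 \<le> \<rho> y (\<lambda>i. y i + w i)"
      by (rule rho_nonneg)
    ultimately show ?thesis using nonneg by simp
  next
    case False
    then obtain h where h: "h \<in> H" "\<rho> x (\<lambda>i. x i + w i) = h x - h (\<lambda>i. x i + w i)"
      using attained in_ball[OF xy(1)] by blast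
    have "h y - h (\<lambda>i. y i + w i) \<le> \<rho> y (\<lambda>i. y i + w i)" using le_rho[OF h(1)] in_ball[OF xy(2)] by blast
    then show ?thesis
      using C11_ball_parallelogram[OF C11[OF h(1)] xy(1,2) w] unfolding h(2) xy(3) by linarith
  qed
  show ?thesis using one[OF u refl] one[OF u(2,1)] edist_commute by (simp add: abs_le_iff)
qed

text \<open>Each \<open>h\<close> is nearly affine on the segment. A maximizer for the shortened
  vector gives the upper bound, one for the full vector the lower bound.\<close>

lemma rho_scale:
  assumes u: "u \<in> euclid_ball n a e" "(\<lambda>i. u i + w i) \<in> euclid_ball n a e" and t: "t \<in> {0..1}"
  shows "\<bar>\<rho> u (\<lambda>i. u i + t * w i) - t * \<rho> u (\<lambda>i. u i + w i)\<bar> \<le> 2 * K * t * (len w)\<^sup>2"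
proof -
  define v where "v = (\<lambda>i. u i + w i)"
  define z where "z = (\<lambda>i. u i + t * w i)"
  have v: "v \<in> euclid_ball n a e" using u(2) by (simp add: v_def)
  have z: "z \<in> euclid_ball n a e" using euclid_ball_segment[OF u t] by (simp add: z_def)
  have h: "\<bar>(h u - h z) - t * (h u - h v)\<bar> \<le> 2 * K * t * (len w)\<^sup>2" if "h \<in> H" for h
  proof -
    have "\<bar>h z - (1 - t) * h u - t * h v\<bar> \<le> 2 * K * (len w)\<^sup>2 * t * (1 - t)"
      using C11_ball_chord[OF C11[OF that] u t] by (simp add: v_def z_def)
    also have "\<dots> \<le> 2 * K * (len w)\<^sup>2 * t * 1"
      using t K_nonneg by (intro mult_left_mono) auto
    finally show ?thesis by (simp add: algebra_simps abs_le_iff)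
  qed
  have nonneg: "0 \<le> 2 * K * t * (len w)\<^sup>2" using K_nonneg t by simp
  have 1: "\<rho> u z - t * \<rho> u v \<le> 2 * K * t * (len w)\<^sup>2"
  proof (cases "u = z")
    case True
    have "0 \<le> t * \<rho> u v" using t rho_nonneg by simp
    then show ?thesis using True rho_refl[of z] nonneg by simp
  next
    case False
    then obtain k where k: "k \<in> H" "\<rho> u z = k u - k z" using attained[OF u(1) z] by blast
    have "t * (k u - k v) \<le> t * \<rho> u v" using le_rho[OF k(1) u(1) v] t by (intro mult_left_mono) auto
    then show ?thesis using h[OF k(1)] k(2) by linarith
  qed
  have 2: "t * \<rho> u v - \<rho> u z \<le> 2 * K * t * (len w)\<^sup>2"
  proof (cases "u = v")
    case True
    then show ?thesis using rho_refl[of v] rho_nonneg[of v z] nonneg by simp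
  next
    case False
    then obtain k where k: "k \<in> H" "\<rho> u v = k u - k v" using attained[OF u(1) v] by blast
    show ?thesis using h[OF k(1)] le_rho[OF k(1) u(1) z] unfolding k(2)[symmetric] by linarith
  qed
  show ?thesis using 1 2 by (simp add: v_def z_def abs_le_iff)
qed

lemma ray_in_ball:
  assumes "u \<in> euclid_ball n a d" "w \<in> topspace (Euclidean_space n)"
  obtains T where "T > 0" "\<And>t. \<bar>t\<bar> \<le> T \<Longrightarrow> (\<lambda>i. u i + t * w i) \<in> euclid_ball n a d"
proof -
  define T where "T = (d - edist n a u) / (2 * (len w + 1))"
  have l: "len w \<ge> 0" by (rule L2_set_nonneg)
  then have "2 * (len w + 1) > 0" by (intro mult_pos_pos add_nonneg_pos) simp_all
  then have T: "T > 0" using assms unfolding T_def by (intro divide_pos_pos) (auto simp: euclid_ball_def)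
  have "T * len w \<le> T * (len w + 1)" using T by (intro mult_left_mono) auto
  also have "\<dots> = (d - edist n a u) / 2" unfolding T_def using l by (rule divide_Suc_bounds(2))
  finally have Tl: "T * len w \<le> (d - edist n a u) / 2" .
  have "(\<lambda>i. u i + t * w i) \<in> euclid_ball n a d" if "\<bar>t\<bar> \<le> T" for t
  proof -
    have "\<bar>t\<bar> * len w \<le> T * len w" using that l by (intro mult_right_mono) auto
    then have "edist n a (\<lambda>i. u i + t * w i) < d"
      using edist_triangle[of n a "\<lambda>i. u i + t * w i" u] Tl assms(1) unfolding edist_add_scale euclid_ball_def by simp
    then show ?thesis using assms by (auto simp: euclid_ball_def topspace_Euclidean_space)
  qed
  then show thesis using T that by blast
qed

text \<open>By \<open>rho_scale\<close> the quotients \<open>q\<close> oscillate linearly near 0, so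
  the limit defining \<open>N u w\<close> exists and is approached at a linear rate.\<close>

lemma norm_expansion:
  assumes u: "u \<in> euclid_ball n a e" and w: "w \<in> topspace (Euclidean_space n)"
    and t: "0 \<le> t" "(\<lambda>i. u i + t * w i) \<in> euclid_ball n a e"
  shows "\<bar>\<rho> u (\<lambda>i. u i + t * w i) - t * N u w\<bar> \<le> 2 * K * (len w)\<^sup>2 * t\<^sup>2"
proof -
  define q where "q t = \<rho> u (\<lambda>i. u i + t * w i) / t" for t
  define C where "C = 2 * K * (len w)\<^sup>2"
  have C: "C \<ge> 0" using K_nonneg by (simp add: C_def)
  have q: "\<bar>q r - q s\<bar> \<le> C * s" if r: "0 < r" "r \<le> s" and s: "(\<lambda>i. u i + s * w i) \<in> euclid_ball n a e" for r s
  proof -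
    have s0: "s > 0" using r by simp
    have "\<bar>\<rho> u (\<lambda>i. u i + r / s * (s * w i)) - r / s * \<rho> u (\<lambda>i. u i + s * w i)\<bar> \<le> 2 * K * (r / s) * (len (\<lambda>i. s * w i))\<^sup>2"
      using r by (intro rho_scale[OF u s]) auto
    then have "\<bar>\<rho> u (\<lambda>i. u i + r * w i) - r * q s\<bar> \<le> C * s * r"
      using s0 by (simp add: q_def C_def L2_set_scale power_mult_distrib power2_eq_square mult_ac)
    moreover have "\<rho> u (\<lambda>i. u i + r * w i) = r * q r" using r by (simp add: q_def)
    ultimately have "r * \<bar>q r - q s\<bar> \<le> r * (C * s)"
      using r by (simp add: abs_mult mult_ac flip: right_diff_distrib)
    then show ?thesis using r by simp
  qed
  have on_segment: "(\<lambda>i. u i + s * w i) \<in> euclid_ball n a e"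
    if "(\<lambda>i. u i + r * w i) \<in> euclid_ball n a e" "0 < r" "0 \<le> s" "s \<le> r" for r s
  proof -
    have "(\<lambda>i. u i + s / r * (u i + r * w i - u i)) \<in> euclid_ball n a e"
      using that by (intro euclid_ball_segment[OF u]) auto
    moreover have "(\<lambda>i. u i + s / r * (u i + r * w i - u i)) = (\<lambda>i. u i + s * w i)" using that by auto
    ultimately show ?thesis by simp
  qed
  have bound: "\<bar>q r - N u w\<bar> \<le> C * r" if r: "0 < r" "(\<lambda>i. u i + r * w i) \<in> euclid_ball n a e" for r
  proof -
    have osc: "\<bar>q t - q s\<bar> \<le> C * s" if "0 < t" "t \<le> s" "s \<le> r" for t s
      using q[OF that(1,2) on_segment[OF r(2,1)]] that by simp
    obtain A where A: "(q \<longlongrightarrow> A) (at_right 0)" "\<And>t. 0 < t \<Longrightarrow> t \<le> r \<Longrightarrow> \<bar>q t - A\<bar> \<le> C * t"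
      using right_limit_of_linear_oscillation[of r C q, OF r(1) C osc] by blast
    have "N u w = A" using tendsto_Lim[OF _ A(1)] by (simp add: metric_norm_def q_def[abs_def])
    then show ?thesis using A(2)[of r] r by simp
  qed
  show ?thesis
  proof (cases "t = 0")
    case False
    then have t0: "t > 0" using t by simp
    have "\<bar>q t - N u w\<bar> * t \<le> C * t * t" using bound[OF t0 t(2)] t0 by (intro mult_right_mono) auto
    moreover have "\<rho> u (\<lambda>i. u i + t * w i) - t * N u w = (q t - N u w) * t"
      using t0 by (simp add: q_def field_simps)
    ultimately show ?thesis using t0 by (simp add: abs_mult C_def power2_eq_square mult_ac)
  qed (simp add: rho_refl)
qed

text \<open>Two expansions with quadratic error have the same linear coefficient. Homogeneity and
  the change of charts are proved by exhibiting such an expansion.\<close>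

lemma norm_unique:
  assumes u: "u \<in> euclid_ball n a e" and w: "w \<in> topspace (Euclidean_space n)" and d: "d > 0"
    and A: "\<And>t. 0 < t \<Longrightarrow> t < d \<Longrightarrow> \<bar>\<rho> u (\<lambda>i. u i + t * w i) - t * A\<bar> \<le> C * t\<^sup>2"
  shows "N u w = A"
proof -
  obtain T where T: "T > 0" "\<And>t. \<bar>t\<bar> \<le> T \<Longrightarrow> (\<lambda>i. u i + t * w i) \<in> euclid_ball n a e"
    using ray_in_ball[OF u w] by blast
  have "\<bar>N u w - A\<bar> \<le> 0"
  proof (rule linear_bound_limit)
    show "min d T > 0" using d T by simp
    fix t assume t: "0 < t" "t < min d T"
    have "\<bar>\<rho> u (\<lambda>i. u i + t * w i) - t * N u w\<bar> \<le> 2 * K * (len w)\<^sup>2 * t\<^sup>2"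
      using norm_expansion[OF u w, of t] T(2)[of t] t by simp
    moreover have "\<bar>\<rho> u (\<lambda>i. u i + t * w i) - t * A\<bar> \<le> C * t\<^sup>2" using A t by simp
    ultimately have "\<bar>t * N u w - t * A\<bar> \<le> 2 * K * (len w)\<^sup>2 * t\<^sup>2 + C * t\<^sup>2" by linarith
    also have "\<dots> = t * ((2 * K * (len w)\<^sup>2 + C) * t)" by (simp add: algebra_simps power2_eq_square)
    finally have "t * \<bar>N u w - A\<bar> \<le> t * ((2 * K * (len w)\<^sup>2 + C) * t)"
      using t by (simp add: abs_mult flip: right_diff_distrib)
    then show "\<bar>N u w - A\<bar> \<le> (2 * K * (len w)\<^sup>2 + C) * t + 0" using t by simp
  qed
  then show ?thesis by simp
qed

lemma norm_bounds:
  assumes u: "u \<in> euclid_ball n a e" and w: "w \<in> topspace (Euclidean_space n)"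
  shows "len w \<le> M * N u w" "N u w \<le> M * len w" "0 \<le> N u w"
proof -
  obtain T where T: "T > 0" "\<And>t. \<bar>t\<bar> \<le> T \<Longrightarrow> (\<lambda>i. u i + t * w i) \<in> euclid_ball n a e"
    using ray_in_ball[OF u w] by blast
  define C where "C = 2 * K * (len w)\<^sup>2"
  have ex: "\<bar>\<rho> u (\<lambda>i. u i + t * w i) - t * N u w\<bar> \<le> C * t\<^sup>2" if "0 < t" "t < T" for t
    unfolding C_def using norm_expansion[OF u w, of t] T(2)[of t] that by simp
  have len: "edist n u (\<lambda>i. u i + t * w i) = t * len w" if "0 < t" for t
    using that by (simp add: edist_add_scale)
  show "len w \<le> M * N u w"
  proof (rule linear_bound_limit[OF T(1)])
    fix t assume t: "0 < t" "t < T"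
    have "t * len w \<le> M * \<rho> u (\<lambda>i. u i + t * w i)" using rho_lower[OF u T(2)[of t]] len t by simp
    also have "\<dots> \<le> M * (t * N u w + C * t\<^sup>2)" using ex[OF t] M_ge by (intro mult_left_mono) auto
    also have "\<dots> = t * ((M * C) * t + M * N u w)" by (simp add: algebra_simps power2_eq_square)
    finally show "len w \<le> (M * C) * t + M * N u w" using t by simp
  qed
  show up: "N u w \<le> M * len w"
  proof (rule linear_bound_limit[OF T(1)])
    fix t assume t: "0 < t" "t < T"
    have "t * N u w \<le> \<rho> u (\<lambda>i. u i + t * w i) + C * t\<^sup>2" using ex[OF t] by linarith
    also have "\<dots> \<le> M * (t * len w) + C * t\<^sup>2" using rho_upper[OF u T(2)[of t]] len t by simp
    also have "\<dots> = t * (C * t + M * len w)" by (simp add: algebra_simps power2_eq_square)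
    finally show "N u w \<le> C * t + M * len w" using t by simp
  qed
  show "0 \<le> N u w"
    using \<open>len w \<le> M * N u w\<close> L2_set_nonneg[of w "{..<n}"] M_ge by (smt (verit) mult_pos_neg)
qed

text \<open>For \<open>r < 0\<close>, symmetry of the distance turns the step from \<open>u\<close>
  to \<open>v\<close>, where \<open>v\<close> is \<open>u - s * w\<close>, into the step
  \<open>s * w\<close> issuing from \<open>v\<close>; moving its base point back to \<open>u\<close>
  by \<open>rho_translate\<close> costs only a term of second order.\<close>

lemma norm_scale:
  assumes u: "u \<in> euclid_ball n a (e / 4)" and w: "w \<in> topspace (Euclidean_space n)"
  shows "N u (\<lambda>i. r * w i) = \<bar>r\<bar> * N u w"
proof -
  have ue: "u \<in> euclid_ball n a e" using u euclid_ball_mono[of "e/4" e n a] e_pos by auto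
  have rw: "(\<lambda>i. r * w i) \<in> topspace (Euclidean_space n)" using w by (simp add: topspace_Euclidean_space)
  obtain T where T: "T > 0" "\<And>t. \<bar>t\<bar> \<le> T \<Longrightarrow> (\<lambda>i. u i + t * w i) \<in> euclid_ball n a (e / 4)"
    using ray_in_ball[OF u w] by blast
  define D where "D = min T (e / (4 * (len w + 1)))"
  have l: "len w \<ge> 0" by (rule L2_set_nonneg)
  then have "4 * (len w + 1) > 0" by (intro mult_pos_pos add_nonneg_pos) simp_all
  then have "e / (4 * (len w + 1)) > 0" using e_pos by (rule divide_pos_pos[rotated])
  then have D: "D > 0" "D \<le> T" "D \<le> e / (4 * (len w + 1))" unfolding D_def using T by (simp_all only: min.cobounded1 min.cobounded2 min_less_iff_conj)
  define d where "d = D / (\<bar>r\<bar> + 1)"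
  have d: "d > 0" using D by (simp add: d_def add_nonneg_pos)
  have ball4: "x \<in> euclid_ball n a e" if "x \<in> euclid_ball n a (e / 4)" for x
    using that euclid_ball_mono[of "e/4" e n a] e_pos by auto
  show ?thesis
  proof (rule norm_unique[OF ue rw d])
    fix t assume t: "0 < t" "t < d"
    define s where "s = t * \<bar>r\<bar>"
    have "t * \<bar>r\<bar> \<le> d * (\<bar>r\<bar> + 1)" using t by (intro mult_mono) auto
    then have s: "0 \<le> s" "s \<le> D" using t by (auto simp: s_def d_def)
    have sw: "(\<lambda>i. s * w i) \<in> topspace (Euclidean_space n)" using w by (simp add: topspace_Euclidean_space)
    have "s * len w \<le> D * len w" using s l by (intro mult_right_mono) auto
    also have "\<dots> \<le> e / (4 * (len w + 1)) * len w" using D l by (intro mult_right_mono) auto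
    also have "\<dots> < e / 4" using l e_pos by (rule divide_Suc_bounds(1))
    finally have sl: "s * len w < e / 4" .
    have ex: "\<bar>\<rho> u (\<lambda>i. u i + s * w i) - s * N u w\<bar> \<le> 2 * K * (len w)\<^sup>2 * s\<^sup>2"
      using norm_expansion[OF ue w s(1)] ball4 T(2)[of s] s D by simp
    have "\<bar>\<rho> u (\<lambda>i. u i + t * (r * w i)) - s * N u w\<bar> \<le> 26 * K * (len w)\<^sup>2 * s\<^sup>2"
    proof (cases "r \<ge> 0")
      case True
      have "2 * K * (len w)\<^sup>2 * s\<^sup>2 \<le> 26 * K * (len w)\<^sup>2 * s\<^sup>2"
        using K_nonneg by (intro mult_right_mono) auto
      moreover have "\<rho> u (\<lambda>i. u i + t * (r * w i)) = \<rho> u (\<lambda>i. u i + s * w i)"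
        using True by (simp add: s_def mult_ac)
      ultimately show ?thesis using ex by linarith
    next
      case False
      define v where "v = (\<lambda>i. u i + (- s) * w i)"
      have v: "v \<in> euclid_ball n a (e / 4)" using T(2)[of "- s"] s D by (simp add: v_def)
      have eq: "(\<lambda>i. u i + t * (r * w i)) = v" "(\<lambda>i. v i + s * w i) = u"
        using False by (auto simp: v_def s_def algebra_simps)
      have "\<rho> u (\<lambda>i. u i + t * (r * w i)) = \<rho> v (\<lambda>i. v i + s * w i)"
        unfolding eq by (rule rho_commute)
      moreover have "\<bar>\<rho> v (\<lambda>i. v i + s * w i) - \<rho> u (\<lambda>i. u i + s * w i)\<bar>
          \<le> 12 * K * len (\<lambda>i. s * w i) * (len (\<lambda>i. s * w i) + edist n v u)"
        using sl s by (intro rho_translate[OF v u sw]) (simp add: L2_set_scale)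
      moreover have "edist n v u = s * len w" using s edist_add_scale[of n u "- s" w] by (simp add: v_def edist_commute)
      ultimately have "\<bar>\<rho> u (\<lambda>i. u i + t * (r * w i)) - \<rho> u (\<lambda>i. u i + s * w i)\<bar> \<le> 24 * (K * (len w)\<^sup>2 * s\<^sup>2)"
        using s by (simp add: L2_set_scale power2_eq_square mult_ac)
      then show ?thesis using ex by linarith
    qed
    then show "\<bar>\<rho> u (\<lambda>i. u i + t * (r * w i)) - t * (\<bar>r\<bar> * N u w)\<bar> \<le> (26 * K * (len w)\<^sup>2 * r\<^sup>2) * t\<^sup>2"
      by (simp add: s_def power_mult_distrib mult_ac)
  qed
qed

text \<open>This is \<open>rho_translate\<close> divided by the step length; the term quadratic in
  the step disappears in the limit.\<close>

lemma norm_base_Lipschitz: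
  assumes u: "u \<in> euclid_ball n a (e / 4)" "v \<in> euclid_ball n a (e / 4)" and w: "w \<in> topspace (Euclidean_space n)"
  shows "\<bar>N u w - N v w\<bar> \<le> 12 * K * len w * edist n u v"
proof -
  have ball4: "x \<in> euclid_ball n a e" if "x \<in> euclid_ball n a (e / 4)" for x
    using that euclid_ball_mono[of "e/4" e n a] e_pos by auto
  obtain T where T: "T > 0" "\<And>t. \<bar>t\<bar> \<le> T \<Longrightarrow> (\<lambda>i. u i + t * w i) \<in> euclid_ball n a (e / 4)"
    using ray_in_ball[OF u(1) w] by blast
  obtain T' where T': "T' > 0" "\<And>t. \<bar>t\<bar> \<le> T' \<Longrightarrow> (\<lambda>i. v i + t * w i) \<in> euclid_ball n a (e / 4)"
    using ray_in_ball[OF u(2) w] by blast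
  have l: "len w \<ge> 0" by (rule L2_set_nonneg)
  define d where "d = min (min T T') (e / (4 * (len w + 1)))"
  have "4 * (len w + 1) > 0" using l by (intro mult_pos_pos add_nonneg_pos) simp_all
  then have "e / (4 * (len w + 1)) > 0" using e_pos by (rule divide_pos_pos[rotated])
  then have d: "d > 0" "d \<le> min T T'" "d \<le> e / (4 * (len w + 1))" unfolding d_def using T T' by (simp_all only: min.cobounded1 min.cobounded2 min_less_iff_conj)
  show ?thesis
  proof (rule linear_bound_limit[OF d(1)])
    fix t assume t: "0 < t" "t < d"
    have tw: "(\<lambda>i. t * w i) \<in> topspace (Euclidean_space n)" using w by (simp add: topspace_Euclidean_space)
    have "t * len w \<le> d * len w" using t l by (intro mult_right_mono) auto
    also have "\<dots> \<le> e / (4 * (len w + 1)) * len w" using d l by (intro mult_right_mono) auto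
    also have "\<dots> < e / 4" using l e_pos by (rule divide_Suc_bounds(1))
    finally have tl: "t * len w < e / 4" .
    have 1: "\<bar>\<rho> u (\<lambda>i. u i + t * w i) - t * N u w\<bar> \<le> 2 * K * (len w)\<^sup>2 * t\<^sup>2"
      using t d T(2)[of t] ball4 by (intro norm_expansion[OF ball4[OF u(1)] w]) auto
    have 2: "\<bar>\<rho> v (\<lambda>i. v i + t * w i) - t * N v w\<bar> \<le> 2 * K * (len w)\<^sup>2 * t\<^sup>2"
      using t d T'(2)[of t] ball4 by (intro norm_expansion[OF ball4[OF u(2)] w]) auto
    have 3: "\<bar>\<rho> u (\<lambda>i. u i + t * w i) - \<rho> v (\<lambda>i. v i + t * w i)\<bar> \<le> 12 * K * (t * len w) * (t * len w + edist n u v)"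
      using rho_translate[OF u tw] tl t by (simp add: L2_set_scale)
    have "\<bar>t * N u w - t * N v w\<bar> \<le> 4 * K * (len w)\<^sup>2 * t\<^sup>2 + 12 * K * (t * len w) * (t * len w + edist n u v)"
      using 1 2 3 by linarith
    also have "\<dots> = t * ((16 * K * (len w)\<^sup>2) * t + 12 * K * len w * edist n u v)"
      by (simp add: algebra_simps power2_eq_square)
    finally have "t * \<bar>N u w - N v w\<bar> \<le> t * ((16 * K * (len w)\<^sup>2) * t + 12 * K * len w * edist n u v)"
      using t by (simp add: abs_mult flip: right_diff_distrib)
    then show "\<bar>N u w - N v w\<bar> \<le> (16 * K * (len w)\<^sup>2) * t + 12 * K * len w * edist n u v" using t by simp
  qed
qed

text \<open>The detour through \<open>v\<close>, which is \<open>u + t * w\<close>, bounds the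
  distance. Its second leg issues from \<open>v\<close> instead of \<open>u\<close>, which changes
  the norm of \<open>w'\<close> by a multiple of \<open>t\<close> and does not matter in the
  limit.\<close>

lemma norm_triangle:
  assumes u: "u \<in> euclid_ball n a (e / 4)"
    and w: "w \<in> topspace (Euclidean_space n)" "w' \<in> topspace (Euclidean_space n)"
  shows "N u (\<lambda>i. w i + w' i) \<le> N u w + N u w'"
proof -
  have ball4: "x \<in> euclid_ball n a e" if "x \<in> euclid_ball n a (e / 4)" for x
    using that euclid_ball_mono[of "e/4" e n a] e_pos by auto
  have ww: "(\<lambda>i. w i + w' i) \<in> topspace (Euclidean_space n)" using w by (simp add: topspace_Euclidean_space)
  obtain T1 where T1: "T1 > 0" "\<And>t. \<bar>t\<bar> \<le> T1 \<Longrightarrow> (\<lambda>i. u i + t * w i) \<in> euclid_ball n a (e / 4)"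
    using ray_in_ball[OF u w(1)] by blast
  obtain T2 where T2: "T2 > 0" "\<And>t. \<bar>t\<bar> \<le> T2 \<Longrightarrow> (\<lambda>i. u i + t * (w i + w' i)) \<in> euclid_ball n a (e / 4)"
    using ray_in_ball[OF u ww] by blast
  show ?thesis
  proof (rule linear_bound_limit)
    show "min T1 T2 > 0" using T1 T2 by simp
    define C where "C = 2 * K * (len (\<lambda>i. w i + w' i))\<^sup>2 + 2 * K * (len w)\<^sup>2 + 2 * K * (len w')\<^sup>2"
    fix t assume t: "0 < t" "t < min T1 T2"
    define v where "v = (\<lambda>i. u i + t * w i)"
    have v: "v \<in> euclid_ball n a (e / 4)" using T1(2)[of t] t by (simp add: v_def)
    have vw: "(\<lambda>i. v i + t * w' i) = (\<lambda>i. u i + t * (w i + w' i))" by (auto simp: v_def algebra_simps)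
    have b2: "(\<lambda>i. u i + t * (w i + w' i)) \<in> euclid_ball n a e" using T2(2)[of t] t ball4 by simp
    have 1: "\<bar>\<rho> u (\<lambda>i. u i + t * (w i + w' i)) - t * N u (\<lambda>i. w i + w' i)\<bar> \<le> 2 * K * (len (\<lambda>i. w i + w' i))\<^sup>2 * t\<^sup>2"
      using t b2 by (intro norm_expansion[OF ball4[OF u] ww]) auto
    have 2: "\<bar>\<rho> u v - t * N u w\<bar> \<le> 2 * K * (len w)\<^sup>2 * t\<^sup>2"
      unfolding v_def using t ball4[OF v] by (intro norm_expansion[OF ball4[OF u] w(1)]) (auto simp: v_def)
    have 3: "\<bar>\<rho> v (\<lambda>i. v i + t * w' i) - t * N v w'\<bar> \<le> 2 * K * (len w')\<^sup>2 * t\<^sup>2"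
      using t b2 by (intro norm_expansion[OF ball4[OF v] w(2)]) (auto simp: vw)
    have "\<bar>N u w' - N v w'\<bar> \<le> 12 * K * len w' * (t * len w)"
      using norm_base_Lipschitz[OF u v w(2)] t by (simp add: v_def edist_add_scale)
    then have 4: "t * N v w' \<le> t * (N u w' + 12 * K * len w' * (t * len w))"
      using t by (intro mult_left_mono) auto
    have "t * N u (\<lambda>i. w i + w' i) \<le> t * N u w + t * (N u w' + 12 * K * len w' * (t * len w)) + (2 * K * (len (\<lambda>i. w i + w' i))\<^sup>2 * t\<^sup>2 + 2 * K * (len w)\<^sup>2 * t\<^sup>2 + 2 * K * (len w')\<^sup>2 * t\<^sup>2)"
      using 1 2 3 4 rho_triangle[of u "\<lambda>i. u i + t * (w i + w' i)" v] unfolding vw by linarith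
    also have "\<dots> = t * ((C + 12 * K * len w' * len w) * t + (N u w + N u w'))"
      by (simp add: C_def algebra_simps power2_eq_square)
    finally show "N u (\<lambda>i. w i + w' i) \<le> (C + 12 * K * len w' * len w) * t + (N u w + N u w')" using t by simp
  qed
qed

lemma norm_Lipschitz:
  assumes u: "u \<in> euclid_ball n a (e / 4)"
    and w: "w \<in> topspace (Euclidean_space n)" "w' \<in> topspace (Euclidean_space n)"
  shows "\<bar>N u w - N u w'\<bar> \<le> M * edist n w w'"
proof -
  have ue: "u \<in> euclid_ball n a e" using u euclid_ball_mono[of "e/4" e n a] e_pos by auto
  have one: "N u x - N u y \<le> M * edist n x y" if xy: "x \<in> topspace (Euclidean_space n)" "y \<in> topspace (Euclidean_space n)" for x y
  proof -
    have d: "(\<lambda>i. x i - y i) \<in> topspace (Euclidean_space n)" using xy by (simp add: topspace_Euclidean_space)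
    have "N u x \<le> N u y + N u (\<lambda>i. x i - y i)" using norm_triangle[OF u xy(2) d] by simp
    then show ?thesis using norm_bounds(2)[OF ue d] unfolding edist_def by simp
  qed
  show ?thesis using one[OF w] one[OF w(2,1)] by (simp add: abs_le_iff edist_commute)
qed

end

lemma (in sup_metric) norm_unique_eventually:
  assumes u: "u \<in> euclid_ball n a e" and w: "w \<in> topspace (Euclidean_space n)"
    and A: "eventually (\<lambda>t. \<bar>\<rho> u (\<lambda>i. u i + t * w i) - t * A\<bar> \<le> C * t\<^sup>2) (at_right 0)"
  shows "N u w = A"
proof -
  obtain d where "d > 0" "\<And>t. 0 < t \<Longrightarrow> t < d \<Longrightarrow> \<bar>\<rho> u (\<lambda>i. u i + t * w i) - t * A\<bar> \<le> C * t\<^sup>2"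
    using A unfolding eventually_at_right_field by auto
  then show ?thesis by (rule norm_unique[OF u w])
qed

section \<open>Norms in charts and the change of charts\<close>

lemma differential_topspace: "differential n \<tau> x v \<in> topspace (Euclidean_space n)"
  by (simp add: differential_def topspace_Euclidean_space)

lemma differential_scale: "differential n \<tau> x (\<lambda>i. t * v i) = (\<lambda>i. t * differential n \<tau> x v i)"
  by (auto simp: differential_def sum_distrib_left mult_ac)

text \<open>Outside the image of the chart \<open>inv_into\<close> has arbitrary values, but the
  pullback of a distance is a pseudometric everywhere; so the metric axioms of
  \<open>sup_metric\<close> can be stated without restriction to a ball.\<close>

definition chart_dist :: "'a::metric_space chart \<Rightarrow> (nat \<Rightarrow> real) \<Rightarrow> (nat \<Rightarrow> real) \<Rightarrow> real" where
  "chart_dist c u v = dist (inv_into (fst c) (snd c) u) (inv_into (fst c) (snd c) v)"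

definition chart_norm :: "'a::metric_space chart \<Rightarrow> (nat \<Rightarrow> real) \<Rightarrow> (nat \<Rightarrow> real) \<Rightarrow> real" where
  "chart_norm c = metric_norm (chart_dist c)"

lemma chart_dist_image:
  "good_chart n c \<Longrightarrow> x \<in> fst c \<Longrightarrow> y \<in> fst c \<Longrightarrow> chart_dist c (snd c x) (snd c y) = dist x y"
  using good_chartD(3)[of n "fst c" "snd c"] by (simp add: chart_dist_def)

context semiconcave_G_space
begin

text \<open>\<open>H\<close> consists of the distances from the points of the sphere of radius
  \<open>R\<close>. The triangle inequality bounds their differences, prolonging the path from one
  point through the other up to the sphere gives equality, and \<open>chart_transfer\<close>
  provides the common constant \<open>M * K\<close>.\<close>

lemma chart_sup_metric:
  assumes c: "good_chart n c" and x: "(x::'a) \<in> fst c"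
  shows "\<exists>e K M H. sup_metric n (snd c x) e K M (chart_dist c) H \<and> euclid_ball n (snd c x) e \<subseteq> snd c ` fst c"
proof (rule local_distance_estimates[of x])
  fix R r K assume r: "0 < r" and K: "0 \<le> K"
    and affine: "\<And>p. dist x p = R \<Longrightarrow> almost_affine (ball x r) K (dist p)"
    and ext: "\<And>y z. y \<in> ball x r \<Longrightarrow> z \<in> ball x r \<Longrightarrow> y \<noteq> z \<Longrightarrow>
      \<exists>p. dist x p = R \<and> dist y z + dist z p = dist y p"
  obtain U \<psi> where c_eq: "c = (U, \<psi>)" by (cases c)
  have c: "good_chart n (U, \<psi>)" and x: "x \<in> U" using assms by (simp_all add: c_eq)
  show ?thesis
  proof (rule chart_transfer[OF c x r])
    fix e M assume e: "e > 0" and M: "M \<ge> 1" and sub: "euclid_ball n (\<psi> x) e \<subseteq> \<psi> ` U"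
      and inball: "\<And>u. u \<in> euclid_ball n (\<psi> x) e \<Longrightarrow> inv_into U \<psi> u \<in> ball x r"
      and up: "\<And>u v. u \<in> euclid_ball n (\<psi> x) e \<Longrightarrow> v \<in> euclid_ball n (\<psi> x) e \<Longrightarrow>
       dist (inv_into U \<psi> u) (inv_into U \<psi> v) \<le> M * edist n u v"
      and low: "\<And>u v. u \<in> euclid_ball n (\<psi> x) e \<Longrightarrow> v \<in> euclid_ball n (\<psi> x) e \<Longrightarrow>
       edist n u v \<le> M * dist (inv_into U \<psi> u) (inv_into U \<psi> v)"
      and C11: "\<And>C f. almost_affine (ball x r) C f \<Longrightarrow> C11_ball n (\<psi> x) e (M * C) (\<lambda>u. f (inv_into U \<psi> u))"
    have "sup_metric n (\<psi> x) e (M * K) M (chart_dist (U, \<psi>)) ((\<lambda>p u. dist p (inv_into U \<psi> u)) ` {p. dist x p = R})"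
    proof (unfold_locales, goal_cases)
      case 1 show ?case by (rule good_chartD(6)[OF c x])
    next
      case 2 show ?case by (rule e)
    next
      case 3 show ?case using M K by simp
    next
      case 4 show ?case by (rule M)
    next
      case (5 h)
      then obtain p where "dist x p = R" "h = (\<lambda>u. dist p (inv_into U \<psi> u))" by blast
      then show ?case using C11[OF affine] by simp
    next
      case (6 h u v)
      then obtain p where "h = (\<lambda>u. dist p (inv_into U \<psi> u))" by blast
      then show ?case
        using dist_triangle[of p "inv_into U \<psi> u" "inv_into U \<psi> v"] by (simp add: chart_dist_def dist_commute)
    next
      case (7 u v)
      define y where "y = inv_into U \<psi> u"
      define z where "z = inv_into U \<psi> v"
      have "y \<noteq> z"
      proof
        assume "y = z"
        then have "edist n u v \<le> 0" using low[OF 7(1,2)] by (simp add: y_def z_def)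
        then have "edist n u v = 0" by (rule antisym[OF _ edist_nonneg])
        then show False using 7 edist_eq_0_iff[of u n v] by (simp add: euclid_ball_def)
      qed
      then obtain p where p: "dist x p = R" "dist y z + dist z p = dist y p"
        using ext[of y z] inball[OF 7(1)] inball[OF 7(2)] by (auto simp: y_def z_def)
      then have "chart_dist (U, \<psi>) u v = dist p y - dist p z"
        by (simp add: chart_dist_def y_def z_def dist_commute)
      then show ?case using p(1) by (intro bexI[of _ "\<lambda>u. dist p (inv_into U \<psi> u)"]) (auto simp: y_def z_def)
    next
      case (8 u) show ?case by (simp add: chart_dist_def)
    next
      case (9 u v) show ?case by (simp add: chart_dist_def dist_commute)
    next
      case (10 u w v) show ?case by (simp add: chart_dist_def dist_triangle)
    next
      case (11 u v) then show ?case using low by (simp add: chart_dist_def)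
    next
      case (12 u v) then show ?case using up by (simp add: chart_dist_def)
    qed
    then show ?thesis unfolding c_eq using sub by (intro exI conjI) (simp_all only: fst_conv snd_conv)
  qed
qed

text \<open>In the chart \<open>c\<close> the components of \<open>c'\<close> have quadratically
  small second differences, so their total derivatives leave quadratic remainders, and
  \<open>C\<close> sums these over the components. The endpoint is delivered as a point
  \<open>y\<close> of the overlap so that its distance from \<open>x\<close> can be measured in both
  charts.\<close>

lemma transition_expansion:
  assumes c: "good_chart n c" and c': "good_chart n c'" and x: "(x::'a) \<in> fst c \<inter> fst c'"
  shows "\<exists>e>0. \<exists>C\<ge>0. \<forall>w\<in>topspace (Euclidean_space n). L2_set w {..<n} < e \<longrightarrow>
    (\<exists>y\<in>fst c \<inter> fst c'. snd c y = (\<lambda>i. snd c x i + w i) \<and>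
      edist n (snd c' y) (\<lambda>i. snd c' x i + differential n (transition c c') (snd c x) w i) \<le> C * (L2_set w {..<n})\<^sup>2)"
proof -
  obtain U \<phi> V \<psi> where eq: "c = (U, \<phi>)" "c' = (V, \<psi>)" by (cases c, cases c')
  have c: "good_chart n (U, \<phi>)" and c': "good_chart n (V, \<psi>)" and x: "x \<in> U" "x \<in> V"
    using assms by (simp_all add: eq)
  show ?thesis
  proof (rule good_chart_local[OF c' x(2)])
    fix d L assume d: "d > 0" and L: "L \<ge> 1" and dV: "ball x d \<subseteq> V"
      and aff: "\<And>i. i < n \<Longrightarrow> almost_affine (ball x d) L (\<lambda>x. \<psi> x i)"
    show ?thesis
    proof (rule chart_transfer[OF c x(1) d])
      fix e M assume e: "e > 0" and M: "M \<ge> 1" and sub: "euclid_ball n (\<phi> x) e \<subseteq> \<phi> ` U"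
        and inball: "\<And>u. u \<in> euclid_ball n (\<phi> x) e \<Longrightarrow> inv_into U \<phi> u \<in> ball x d"
        and C11: "\<And>C f. almost_affine (ball x d) C f \<Longrightarrow> C11_ball n (\<phi> x) e (M * C) (\<lambda>u. f (inv_into U \<phi> u))"
      define C where "C = n * (28 * n * (M * L))"
      have "\<exists>y\<in>U \<inter> V. \<phi> y = (\<lambda>i. \<phi> x i + w i) \<and>
        edist n (\<psi> y) (\<lambda>i. \<psi> x i + differential n (transition (U, \<phi>) (V, \<psi>)) (\<phi> x) w i) \<le> C * (L2_set w {..<n})\<^sup>2"
        if w: "w \<in> topspace (Euclidean_space n)" "L2_set w {..<n} < e / 8" for w
      proof -
        define u where "u = (\<lambda>i. \<phi> x i + w i)"
        define y where "y = inv_into U \<phi> u"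
        have xe: "\<phi> x \<in> euclid_ball n (\<phi> x) (e / 8)" using good_chartD(6)[OF c x(1)] e by simp
        have "u \<in> euclid_ball n (\<phi> x) e"
          using euclid_ball_add[OF xe w(1), of "e/8"] w(2) e euclid_ball_mono[of "e/8 + e/8" e n "\<phi> x"]
          by (auto simp: u_def)
        then have y: "y \<in> U" "\<phi> y = u" "y \<in> V"
          using sub inball[of u] dV by (auto simp: y_def f_inv_into_f inv_into_into)
        have comp: "\<bar>\<psi> y i - (\<psi> x i + differential n (transition (U, \<phi>) (V, \<psi>)) (\<phi> x) w i)\<bar>
            \<le> 28 * n * (M * L) * (L2_set w {..<n})\<^sup>2" if i: "i < n" for i
        proof -
          have tr: "(\<lambda>y. transition (U, \<phi>) (V, \<psi>) y i) = (\<lambda>u. \<psi> (inv_into U \<phi> u) i)"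
            by (simp add: transition_def)
          have "\<psi> (inv_into U \<phi> (\<phi> x)) i = \<psi> x i" using good_chartD(3)[OF c] x by simp
          then have "\<bar>\<psi> y i - \<psi> x i - (\<Sum>j<n. partial_deriv j (\<lambda>u. \<psi> (inv_into U \<phi> u) i) (\<phi> x) * w j)\<bar>
              \<le> 28 * n * (M * L) * (L2_set w {..<n})\<^sup>2"
            using C11_ball_total_deriv[OF C11[OF aff[OF i]] xe w] unfolding y_def u_def by simp
          then show ?thesis using i by (simp add: differential_def tr diff_diff_eq)
        qed
        have "edist n (\<psi> y) (\<lambda>i. \<psi> x i + differential n (transition (U, \<phi>) (V, \<psi>)) (\<phi> x) w i)
            \<le> (\<Sum>i<n. 28 * n * (M * L) * (L2_set w {..<n})\<^sup>2)"
          by (rule order_trans[OF edist_le_sum sum_mono]) (use comp in auto)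
        also have "\<dots> = C * (L2_set w {..<n})\<^sup>2" by (simp add: C_def)
        finally show ?thesis using y by (intro bexI[of _ y]) (auto simp: u_def)
      qed
      moreover have "C \<ge> 0" using M L by (simp add: C_def)
      ultimately show ?thesis unfolding eq using e by (intro exI[of _ "e / 8"] conjI exI[of _ C]) auto
    qed
  qed
qed

text \<open>One distance \<open>dist x y\<close> is expanded in both charts. The point reached in
  \<open>c\<close> along \<open>t * w\<close> and the one reached in \<open>c'\<close> along
  \<open>t * D\<close> are at a distance of order \<open>t\<^sup>2\<close>, so both expansions have
  the same linear coefficient.\<close>

lemma chart_norm_change:
  assumes c: "good_chart n c" and c': "good_chart n c'" and x: "(x::'a) \<in> fst c \<inter> fst c'"
    and w: "w \<in> topspace (Euclidean_space n)"
  shows "chart_norm c' (snd c' x) (differential n (transition c c') (snd c x) w) = chart_norm c (snd c x) w"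
proof -
  define D where "D = differential n (transition c c') (snd c x) w"
  have D: "D \<in> topspace (Euclidean_space n)" unfolding D_def by (rule differential_topspace)
  obtain e1 K1 M1 H1 where 1: "sup_metric n (snd c x) e1 K1 M1 (chart_dist c) H1" "euclid_ball n (snd c x) e1 \<subseteq> snd c ` fst c"
    using chart_sup_metric[OF c] x by blast
  obtain e2 K2 M2 H2 where 2: "sup_metric n (snd c' x) e2 K2 M2 (chart_dist c') H2" "euclid_ball n (snd c' x) e2 \<subseteq> snd c' ` fst c'"
    using chart_sup_metric[OF c'] x by blast
  interpret s1: sup_metric n "snd c x" e1 K1 M1 "chart_dist c" H1 by (rule 1)
  interpret s2: sup_metric n "snd c' x" e2 K2 M2 "chart_dist c'" H2 by (rule 2)
  obtain e C where e: "e > 0" "C \<ge> 0" "\<And>w. w \<in> topspace (Euclidean_space n) \<Longrightarrow> L2_set w {..<n} < e \<Longrightarrow>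
    \<exists>y\<in>fst c \<inter> fst c'. snd c y = (\<lambda>i. snd c x i + w i) \<and>
      edist n (snd c' y) (\<lambda>i. snd c' x i + differential n (transition c c') (snd c x) w i) \<le> C * (L2_set w {..<n})\<^sup>2"
    using transition_expansion[OF c c' x] by blast
  define l where "l = L2_set w {..<n}"
  define m where "m = L2_set D {..<n}"
  have m0: "m \<ge> 0" and l0: "l \<ge> 0" by (auto simp: m_def l_def)
  have "((\<lambda>t. t * l) \<longlongrightarrow> 0) (at_right 0)" by (rule tendsto_eq_intros refl | simp)+
  then have ev1: "eventually (\<lambda>t. t * l < min e e1) (at_right 0)"
    using e(1) s1.e_pos by (intro order_tendstoD) auto
  have "((\<lambda>t. t * m + C * (t * l)\<^sup>2) \<longlongrightarrow> 0) (at_right 0)" by (rule tendsto_eq_intros refl | simp)+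
  then have ev2: "eventually (\<lambda>t. t * m + C * (t * l)\<^sup>2 < e2) (at_right 0)"
    using s2.e_pos by (intro order_tendstoD) auto
  have "eventually (\<lambda>t. \<bar>chart_dist c' (snd c' x) (\<lambda>i. snd c' x i + t * D i) - t * chart_norm c (snd c x) w\<bar>
      \<le> (M2 * (C * l\<^sup>2) + 2 * K1 * l\<^sup>2) * t\<^sup>2) (at_right 0)"
    using ev1 ev2 eventually_at_right_less[of "0::real"]
  proof eventually_elim
    case (elim t)
    then have t: "t > 0" "t * l < e" "t * l < e1" "t * m + C * (t * l)\<^sup>2 < e2" by auto
    have tw: "(\<lambda>i. t * w i) \<in> topspace (Euclidean_space n)" using w by (simp add: topspace_Euclidean_space)
    have tl: "L2_set (\<lambda>i. t * w i) {..<n} = t * l" using t by (simp add: L2_set_scale l_def)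
    obtain y where y: "y \<in> fst c" "y \<in> fst c'" "snd c y = (\<lambda>i. snd c x i + t * w i)"
      "edist n (snd c' y) (\<lambda>i. snd c' x i + t * D i) \<le> C * (t * l)\<^sup>2"
      using e(3)[OF tw] t(2) unfolding tl differential_scale D_def[symmetric] by blast
    have dxy: "chart_dist c (snd c x) (\<lambda>i. snd c x i + t * w i) = dist x y"
      using chart_dist_image[OF c, of x y] x y by simp
    have dxy': "chart_dist c' (snd c' x) (snd c' y) = dist x y"
      using chart_dist_image[OF c', of x y] x y by simp
    have "(\<lambda>i. snd c x i + t * w i) \<in> euclid_ball n (snd c x) e1"
      using s1.center w t(3) t(1) by (auto simp: euclid_ball_def edist_add_scale l_def topspace_Euclidean_space)
    then have "\<bar>dist x y - t * chart_norm c (snd c x) w\<bar> \<le> 2 * K1 * l\<^sup>2 * t\<^sup>2"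
      using s1.norm_expansion[OF center_in_euclid_ball[OF s1.center s1.e_pos] w, of t] t
      unfolding dxy l_def chart_norm_def by simp
    moreover have "\<bar>chart_dist c' (snd c' x) (\<lambda>i. snd c' x i + t * D i) - dist x y\<bar> \<le> M2 * (C * (t * l)\<^sup>2)"
    proof -
      define z where "z = (\<lambda>i. snd c' x i + t * D i)"
      have zx: "edist n (snd c' x) z = t * m" using t by (simp add: z_def edist_add_scale m_def)
      have "0 \<le> C * (t * l)\<^sup>2" using e by simp
      then have zb: "z \<in> euclid_ball n (snd c' x) e2"
        using zx t(4) s2.center D by (auto simp: euclid_ball_def z_def topspace_Euclidean_space)
      have "edist n (snd c' x) (snd c' y) < e2"
        using edist_triangle[of n "snd c' x" "snd c' y" z] zx y(4) t(4) by (simp add: z_def edist_commute)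
      then have yb: "snd c' y \<in> euclid_ball n (snd c' x) e2"
        using good_chartD(6)[of n "fst c'" "snd c'" y] c' y by (simp add: euclid_ball_def)
      have "chart_dist c' (snd c' y) z \<le> M2 * edist n (snd c' y) z" by (rule s2.rho_upper[OF yb zb])
      also have "\<dots> \<le> M2 * (C * (t * l)\<^sup>2)" using y(4) s2.M_ge by (intro mult_left_mono) (auto simp: z_def)
      finally have "chart_dist c' (snd c' y) z \<le> M2 * (C * (t * l)\<^sup>2)" .
      then show ?thesis
        using s2.rho_triangle[of "snd c' x" z "snd c' y"] s2.rho_triangle[of "snd c' x" "snd c' y" z]
        unfolding dxy' s2.rho_commute[of z "snd c' y"] z_def[symmetric] by linarith
    qed
    moreover have "M2 * (C * (t * l)\<^sup>2) + 2 * K1 * l\<^sup>2 * t\<^sup>2 = (M2 * (C * l\<^sup>2) + 2 * K1 * l\<^sup>2) * t\<^sup>2"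
      by (simp add: power_mult_distrib algebra_simps)
    ultimately show ?case by linarith
  qed
  from s2.norm_unique_eventually[OF center_in_euclid_ball[OF s2.center s2.e_pos] D this]
  show ?thesis unfolding chart_norm_def D_def .
qed

text \<open>The base point is moved first, with the vector \<open>w\<close> fixed, and then the
  vector at the base point \<open>v\<close>; hence only the length of \<open>w\<close>
  occurs.\<close>

lemma chart_norm_local:
  assumes c: "good_chart n c" and x: "(x::'a) \<in> fst c"
  shows "\<exists>e>0. \<exists>L\<ge>0. euclid_ball n (snd c x) e \<subseteq> snd c ` fst c \<and>
    (\<forall>u\<in>euclid_ball n (snd c x) e. \<forall>v\<in>euclid_ball n (snd c x) e.
      \<forall>w\<in>topspace (Euclidean_space n). \<forall>w'\<in>topspace (Euclidean_space n).
      \<bar>chart_norm c u w - chart_norm c v w'\<bar> \<le> L * (L2_set w {..<n} * edist n u v + edist n w w'))"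
proof -
  obtain e K M H where 1: "sup_metric n (snd c x) e K M (chart_dist c) H" "euclid_ball n (snd c x) e \<subseteq> snd c ` fst c"
    using chart_sup_metric[OF assms] by blast
  interpret sup_metric n "snd c x" e K M "chart_dist c" H by (rule 1)
  define L where "L = 12 * K + M"
  have L: "12 * K \<le> L" "M \<le> L" "0 \<le> L" using K_nonneg M_ge by (auto simp: L_def)
  have "\<bar>chart_norm c u w - chart_norm c v w'\<bar> \<le> L * (L2_set w {..<n} * edist n u v + edist n w w')"
    if u: "u \<in> euclid_ball n (snd c x) (e / 4)" "v \<in> euclid_ball n (snd c x) (e / 4)"
      and w: "w \<in> topspace (Euclidean_space n)" "w' \<in> topspace (Euclidean_space n)" for u v w w'
  proof -
    have "\<bar>chart_norm c u w - chart_norm c v w'\<bar> \<le> 12 * K * len w * edist n u v + M * edist n w w'"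
      using norm_base_Lipschitz[OF u w(1)] norm_Lipschitz[OF u(2) w] unfolding chart_norm_def by linarith
    also have "\<dots> = 12 * K * (len w * edist n u v) + M * edist n w w'" by simp
    also have "\<dots> \<le> L * (len w * edist n u v) + L * edist n w w'"
      using L by (intro add_mono mult_right_mono) auto
    finally show ?thesis by (simp add: distrib_left)
  qed
  moreover have "euclid_ball n (snd c x) (e / 4) \<subseteq> snd c ` fst c"
    using 1(2) euclid_ball_mono[of "e/4" e] e_pos by force
  ultimately show ?thesis using e_pos L(3) by (intro exI[of _ "e / 4"] conjI exI[of _ L] ballI) simp_all
qed

lemma chart_norm_is_norm:
  assumes c: "good_chart n c" and x: "(x::'a) \<in> fst c"
    and w: "w \<in> topspace (Euclidean_space n)" "w' \<in> topspace (Euclidean_space n)"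
  shows "0 \<le> chart_norm c (snd c x) w" "chart_norm c (snd c x) w = 0 \<longleftrightarrow> w = (\<lambda>_. 0)"
    "chart_norm c (snd c x) (\<lambda>i. r * w i) = \<bar>r\<bar> * chart_norm c (snd c x) w"
    "chart_norm c (snd c x) (\<lambda>i. w i + w' i) \<le> chart_norm c (snd c x) w + chart_norm c (snd c x) w'"
proof -
  obtain e K M H where 1: "sup_metric n (snd c x) e K M (chart_dist c) H"
    using chart_sup_metric[OF c x] by blast
  interpret sup_metric n "snd c x" e K M "chart_dist c" H by (rule 1)
  have x4: "snd c x \<in> euclid_ball n (snd c x) (e / 4)" and xe: "snd c x \<in> euclid_ball n (snd c x) e"
    using center e_pos by auto
  show "0 \<le> chart_norm c (snd c x) w" unfolding chart_norm_def by (rule norm_bounds(3)[OF xe w(1)])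
  show "chart_norm c (snd c x) (\<lambda>i. r * w i) = \<bar>r\<bar> * chart_norm c (snd c x) w"
    unfolding chart_norm_def by (rule norm_scale[OF x4 w(1)])
  show "chart_norm c (snd c x) (\<lambda>i. w i + w' i) \<le> chart_norm c (snd c x) w + chart_norm c (snd c x) w'"
    unfolding chart_norm_def by (rule norm_triangle[OF x4 w])
  show "chart_norm c (snd c x) w = 0 \<longleftrightarrow> w = (\<lambda>_. 0)"
  proof
    assume "chart_norm c (snd c x) w = 0"
    then have "len w \<le> 0" using norm_bounds(1)[OF xe w(1)] by (simp add: chart_norm_def)
    then have "w i = 0" for i
      using L2_set_component_le[of i n w] w(1) by (cases "i < n") (auto simp: topspace_Euclidean_space)
    then show "w = (\<lambda>_. 0)" by auto
  next
    assume "w = (\<lambda>_. 0)"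
    then show "chart_norm c (snd c x) w = 0"
      using norm_bounds(2,3)[OF xe w(1)] by (simp add: chart_norm_def L2_set_def)
  qed
qed

end

section \<open>Speed and length of curves\<close>

text \<open>The metric speed of a curve on \<open>{0..1}\<close> does not refer to charts, which makes the length
  of velocity vectors independent of the chart.\<close>

definition has_speed :: "(real \<Rightarrow> 'a::metric_space) \<Rightarrow> real \<Rightarrow> real \<Rightarrow> bool" where
  "has_speed \<gamma> t A \<longleftrightarrow> (\<forall>\<epsilon>>0. \<exists>d>0. \<forall>s\<in>{0..1}. \<bar>s - t\<bar> < d \<longrightarrow>
    \<bar>dist (\<gamma> t) (\<gamma> s) - \<bar>s - t\<bar> * A\<bar> \<le> \<epsilon> * \<bar>s - t\<bar>)"

lemma has_speed_unique:
  assumes "has_speed \<gamma> t A" "has_speed \<gamma> t B" and t: "t \<in> {0..1}"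
  shows "A = B"
proof -
  have "\<bar>A - B\<bar> \<le> 0"
  proof (rule field_le_epsilon)
    fix \<epsilon> :: real assume "\<epsilon> > 0"
    then have e2: "\<epsilon> / 2 > 0" by simp
    obtain d1 where d1: "d1 > 0" "\<And>s. s \<in> {0..1} \<Longrightarrow> \<bar>s - t\<bar> < d1 \<Longrightarrow>
        \<bar>dist (\<gamma> t) (\<gamma> s) - \<bar>s - t\<bar> * A\<bar> \<le> \<epsilon> / 2 * \<bar>s - t\<bar>"
      using assms(1) e2 unfolding has_speed_def by blast
    obtain d2 where d2: "d2 > 0" "\<And>s. s \<in> {0..1} \<Longrightarrow> \<bar>s - t\<bar> < d2 \<Longrightarrow>
        \<bar>dist (\<gamma> t) (\<gamma> s) - \<bar>s - t\<bar> * B\<bar> \<le> \<epsilon> / 2 * \<bar>s - t\<bar>"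
      using assms(2) e2 unfolding has_speed_def by blast
    define h where "h = min (min d1 d2 / 2) (1 / 2)"
    have h: "h > 0" "h < d1" "h < d2" "h \<le> 1 / 2" using d1 d2 by (auto simp: h_def)
    \<comment> \<open>Because \<open>h \<le> 1 / 2\<close>, at least one side of \<open>t\<close>
      has room for a step of length \<open>h\<close> within the unit interval.\<close>
    obtain s where s: "s \<in> {0..1}" "\<bar>s - t\<bar> = h"
    proof (cases "t \<le> 1 / 2")
      case True
      then show ?thesis using h t by (intro that[of "t + h"]) auto
    next
      case False
      then show ?thesis using h t by (intro that[of "t - h"]) auto
    qed
    have "\<bar>h * A - h * B\<bar> \<le> \<epsilon> * h" using d1(2)[OF s(1)] d2(2)[OF s(1)] h unfolding s(2) by linarith
    moreover have "h * A - h * B = (A - B) * h" by (simp add: algebra_simps)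
    then have "\<bar>h * A - h * B\<bar> = \<bar>A - B\<bar> * h" using h by (simp add: abs_mult)
    ultimately show "\<bar>A - B\<bar> \<le> 0 + \<epsilon>" using h by simp
  qed
  then show ?thesis by simp
qed

text \<open>The curve is compared with the ray from \<open>u\<close> in direction \<open>v\<close>:
  by differentiability their distance is small compared with the step, and along the ray the norm
  expansion applies. Each error is allotted \<open>\<epsilon> / 2\<close>. A step backwards in time
  follows a ray in the opposite direction, which has the same norm.\<close>

lemma C1_curve_speed:
  fixes \<gamma> :: "real \<Rightarrow> 'a::metric_space"
  assumes X: "semiconcave_G_space TYPE('a)"
    and c: "good_chart n c" and t: "t \<in> {0..1}" "\<gamma> t \<in> fst c" and \<gamma>: "continuous_on {0..1} \<gamma>"
    and deriv: "\<And>i. i < n \<Longrightarrow> ((\<lambda>s. snd c (\<gamma> s) i) has_real_derivative v i) (at t within {0..1})"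
    and v: "v \<in> topspace (Euclidean_space n)"
  shows "has_speed \<gamma> t (chart_norm c (snd c (\<gamma> t)) v)"
proof -
  interpret semiconcave_G_space "TYPE('a)" by (rule X)
  obtain e K M H where 1: "sup_metric n (snd c (\<gamma> t)) e K M (chart_dist c) H"
    using chart_sup_metric[OF c t(2)] by blast
  interpret sup_metric n "snd c (\<gamma> t)" e K M "chart_dist c" H by (rule 1)
  define u where "u = snd c (\<gamma> t)"
  have u: "u \<in> topspace (Euclidean_space n)" "u \<in> euclid_ball n u e" "u \<in> euclid_ball n u (e / 4)"
    using center e_pos by (auto simp: u_def)
  show ?thesis
    unfolding has_speed_def u_def[symmetric]
  proof (intro allI impI)
    fix \<epsilon> :: real assume \<epsilon>: "\<epsilon> > 0"
    \<comment> \<open>Divided by \<open>M\<close> for the passage from coordinates to distance, and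
      by \<open>n + 1\<close> for the sum over the coordinates, as \<open>n\<close> may be
      0.\<close>
    define \<epsilon>1 where "\<epsilon>1 = \<epsilon> / (2 * M) / (n + 1)"
    have \<epsilon>1: "\<epsilon>1 > 0" using \<epsilon> M_ge by (simp add: \<epsilon>1_def add_nonneg_pos)
    have "\<exists>d>0. \<forall>s\<in>{0..1}. \<bar>s - t\<bar> < d \<longrightarrow> \<bar>snd c (\<gamma> s) i - u i - v i * (s - t)\<bar> \<le> \<epsilon>1 * \<bar>s - t\<bar>" if i: "i < n" for i
      using deriv[OF i] \<epsilon>1 unfolding has_field_derivative_def has_derivative_within_alt u_def real_norm_def by blast
    then obtain d where d: "\<And>i. i < n \<Longrightarrow> d i > 0"
      "\<And>i s. i < n \<Longrightarrow> s \<in> {0..1} \<Longrightarrow> \<bar>s - t\<bar> < d i \<Longrightarrow> \<bar>snd c (\<gamma> s) i - u i - v i * (s - t)\<bar> \<le> \<epsilon>1 * \<bar>s - t\<bar>"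
      by metis
    have "open (fst c)" using c by (simp add: good_chart_def)
    then obtain r where r: "r > 0" "ball (\<gamma> t) r \<subseteq> fst c" using t(2) open_contains_ball by blast
    obtain d0 where d0: "d0 > 0" "\<And>s. s \<in> {0..1} \<Longrightarrow> dist s t < d0 \<Longrightarrow> dist (\<gamma> s) (\<gamma> t) < r"
      using \<gamma> t(1) r(1) unfolding continuous_on_iff by blast
    define C where "C = 2 * K * (len v)\<^sup>2"
    have C: "C \<ge> 0" using K_nonneg by (simp add: C_def)
    define l where "l = len v"
    have l: "l \<ge> 0" by (simp add: l_def)
    \<comment> \<open>Keeps both the curve and the ray within the ball of radius
      \<open>e\<close>.\<close>
    define d1 where "d1 = e / (2 * (\<epsilon> + l + 1))"
    have d1: "d1 > 0" using e_pos \<epsilon> l by (simp add: d1_def add_nonneg_pos)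
    define d2 where "d2 = \<epsilon> / (2 * (C + 1))"
    have d2: "d2 > 0" using \<epsilon> C by (simp add: d2_def add_nonneg_pos)
    define D where "D = Min (insert (min d0 (min d1 d2)) (d ` {..<n}))"
    have D: "D > 0" using d(1) d0 d1 d2 by (auto simp: D_def)
    have D_le: "D \<le> min d0 (min d1 d2)" "\<And>i. i < n \<Longrightarrow> D \<le> d i"
      unfolding D_def by (rule Min_le; simp)+
    have "\<bar>dist (\<gamma> t) (\<gamma> s) - \<bar>s - t\<bar> * N u v\<bar> \<le> \<epsilon> * \<bar>s - t\<bar>"
      if s: "s \<in> {0..1}" "\<bar>s - t\<bar> < D" for s
    proof -
      define h where "h = \<bar>s - t\<bar>"
      have h: "h \<ge> 0" "h < d0" "h < d1" "h < d2" using s D_le(1) by (auto simp: h_def)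
      have sU: "\<gamma> s \<in> fst c" using d0(2)[OF s(1)] h r(2) by (auto simp: h_def dist_real_def dist_commute)
      define b where "b = snd c (\<gamma> s)"
      define z where "z = (\<lambda>i. u i + (s - t) * v i)"
      have "edist n b z \<le> (\<Sum>i<n. \<bar>b i - z i\<bar>)" by (rule edist_le_sum)
      also have "\<dots> \<le> (\<Sum>i<n. \<epsilon>1 * h)"
      proof (rule sum_mono)
        fix i assume "i \<in> {..<n}"
        then have i: "i < n" by simp
        have "\<bar>b i - u i - v i * (s - t)\<bar> \<le> \<epsilon>1 * h"
          unfolding b_def h_def using d(2)[OF i s(1)] D_le(2)[OF i] s(2) by simp
        then show "\<bar>b i - z i\<bar> \<le> \<epsilon>1 * h" by (simp add: z_def algebra_simps)
      qed
      also have "\<dots> = n * \<epsilon>1 * h" by simp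
      also have "\<dots> \<le> (n + 1) * \<epsilon>1 * h" using \<epsilon>1 h by (intro mult_right_mono) auto
      also have "(n + 1) * \<epsilon>1 = \<epsilon> / (2 * M)" unfolding \<epsilon>1_def by simp
      finally have bz: "edist n b z \<le> \<epsilon> / (2 * M) * h" .
      have "\<epsilon> / (2 * M) \<le> \<epsilon> / 1" using \<epsilon> M_ge by (intro divide_left_mono) auto
      then have "\<epsilon> / (2 * M) * h \<le> \<epsilon> * h" using h by (intro mult_right_mono) auto
      then have bz': "edist n b z \<le> \<epsilon> * h" using bz by linarith
      have uz: "edist n u z = h * l" by (simp add: z_def edist_add_scale h_def l_def)
      have "h * (\<epsilon> + l + 1) \<le> d1 * (\<epsilon> + l + 1)" using h \<epsilon> l by (intro mult_right_mono) auto
      also have "\<dots> = e / 2" using \<epsilon> l by (simp add: d1_def field_simps)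
      finally have "h * \<epsilon> + h * l + h \<le> e / 2" by (simp add: distrib_left)
      then have small: "\<epsilon> * h + h * l < e" using h e_pos by (simp add: mult.commute)
      have "0 \<le> \<epsilon> * h" using \<epsilon> h by simp
      have zb: "z \<in> euclid_ball n u e"
        using uz small \<open>0 \<le> \<epsilon> * h\<close> u(1) v by (auto simp: euclid_ball_def z_def topspace_Euclidean_space)
      have "edist n u b < e" using edist_triangle[of n u b z] uz bz' small by (simp add: edist_commute)
      moreover have "b \<in> topspace (Euclidean_space n)"
        using good_chartD(6)[of n "fst c" "snd c"] c sU by (simp add: b_def)
      ultimately have bb: "b \<in> euclid_ball n u e" by (simp add: euclid_ball_def)
      have "chart_dist c b z \<le> M * edist n b z" using rho_upper bb zb unfolding u_def .
      also have "\<dots> \<le> M * (\<epsilon> / (2 * M) * h)" using bz M_ge by (intro mult_left_mono) auto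
      also have "\<dots> = \<epsilon> / 2 * h" using M_ge by simp
      finally have 1: "chart_dist c b z \<le> \<epsilon> / 2 * h" .
      have 2: "dist (\<gamma> t) (\<gamma> s) = chart_dist c u b"
        using chart_dist_image[OF c t(2) sU] by (simp add: u_def b_def)
      have 3: "\<bar>chart_dist c u z - h * N u v\<bar> \<le> C * h\<^sup>2"
      proof (cases "t \<le> s")
        case True
        then have "z = (\<lambda>i. u i + h * v i)" by (auto simp: z_def h_def)
        then show ?thesis using norm_expansion[OF u(2)[unfolded u_def] v h(1)] zb unfolding u_def C_def by simp
      next
        case False
        have mv: "(\<lambda>i. - 1 * v i) \<in> topspace (Euclidean_space n)" using v by (simp add: topspace_Euclidean_space)
        have "z = (\<lambda>i. u i + h * (- 1 * v i))" using False by (auto simp: z_def h_def algebra_simps)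
        then have "\<bar>chart_dist c u z - h * N u (\<lambda>i. - 1 * v i)\<bar> \<le> 2 * K * (len (\<lambda>i. - 1 * v i))\<^sup>2 * h\<^sup>2"
          using norm_expansion[OF u(2)[unfolded u_def] mv h(1)] zb unfolding u_def by simp
        moreover have "N u (\<lambda>i. - 1 * v i) = N u v"
          using norm_scale[OF u(3)[unfolded u_def] v, of "- 1"] unfolding u_def by simp
        moreover have "len (\<lambda>i. - 1 * v i) = len v" using L2_set_scale[of "- 1" v] by simp
        ultimately show ?thesis by (simp only: C_def)
      qed
      have "C * h \<le> \<epsilon> / 2"
      proof -
        have "C * h \<le> (C + 1) * d2" using h C by (intro mult_mono) auto
        also have "\<dots> = \<epsilon> / 2" using C by (simp add: d2_def field_simps)
        finally show ?thesis .
      qed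
      then have "C * h * h \<le> \<epsilon> / 2 * h" using h(1) by (rule mult_right_mono)
      then have 4: "C * h\<^sup>2 \<le> \<epsilon> / 2 * h" by (simp add: power2_eq_square mult.assoc)
      have "\<bar>chart_dist c u b - chart_dist c u z\<bar> \<le> chart_dist c b z"
        using rho_triangle[of u b z] rho_triangle[of u z b] unfolding rho_commute[of z b] by linarith
      then show ?thesis using 1 3 4 unfolding 2 h_def[symmetric] by linarith
    qed
    then show "\<exists>d>0. \<forall>s\<in>{0..1}. \<bar>s - t\<bar> < d \<longrightarrow>
        \<bar>dist (\<gamma> t) (\<gamma> s) - \<bar>s - t\<bar> * chart_norm c u v\<bar> \<le> \<epsilon> * \<bar>s - t\<bar>"
      using D unfolding chart_norm_def by blast
  qed
qed

text \<open>With the slack \<open>\<epsilon> * (b - a)\<close> the inequality is additive over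
  adjacent intervals, so by bisection it suffices to have it on short intervals around each
  \<open>x\<close>. There the speed at \<open>x\<close> and the continuity of \<open>I\<close> cost
  \<open>\<epsilon> / 2\<close> each.\<close>

lemma dist_le_integral_of_speed:
  fixes \<gamma> :: "real \<Rightarrow> 'a::metric_space"
  assumes I: "continuous_on {0..1} I" and speed: "\<And>t. t \<in> {0..1} \<Longrightarrow> has_speed \<gamma> t (I t)"
  shows "dist (\<gamma> 0) (\<gamma> 1) \<le> integral {0..1} I"
proof (rule field_le_epsilon)
  fix \<epsilon> :: real assume \<epsilon>: "\<epsilon> > 0"
  have int: "I integrable_on {a..b}" if "0 \<le> a" "b \<le> 1" for a b
    using that by (intro integrable_continuous_real continuous_on_subset[OF I]) auto
  define P where "P a b \<longleftrightarrow> (0 \<le> a \<and> a \<le> b \<and> b \<le> 1 \<longrightarrow> dist (\<gamma> a) (\<gamma> b) \<le> integral {a..b} I + \<epsilon> * (b - a))" for a b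
  have "P 0 1"
  proof (rule Bolzano[of 0 1 P], goal_cases)
    case 1 then show ?case by simp
  next
    case (2 a b c)
    show ?case unfolding P_def
    proof
      assume ac: "0 \<le> a \<and> a \<le> c \<and> c \<le> 1"
      then have "dist (\<gamma> a) (\<gamma> b) \<le> integral {a..b} I + \<epsilon> * (b - a)"
        "dist (\<gamma> b) (\<gamma> c) \<le> integral {b..c} I + \<epsilon> * (c - b)" using 2 unfolding P_def by auto
      moreover have "integral {a..b} I + integral {b..c} I = integral {a..c} I"
        using 2 ac by (intro Henstock_Kurzweil_Integration.integral_combine int) auto
      ultimately show "dist (\<gamma> a) (\<gamma> c) \<le> integral {a..c} I + \<epsilon> * (c - a)"
        using dist_triangle[of "\<gamma> a" "\<gamma> c" "\<gamma> b"] by (simp add: algebra_simps)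
    qed
  next
    case (3 x)
    then have x: "x \<in> {0..1}" by simp
    obtain d1 where d1: "d1 > 0" "\<And>s. s \<in> {0..1} \<Longrightarrow> \<bar>s - x\<bar> < d1 \<Longrightarrow>
        \<bar>dist (\<gamma> x) (\<gamma> s) - \<bar>s - x\<bar> * I x\<bar> \<le> \<epsilon> / 2 * \<bar>s - x\<bar>"
      using speed[OF x] \<epsilon> unfolding has_speed_def by (meson half_gt_zero)
    obtain d2 where d2: "d2 > 0" "\<And>s. s \<in> {0..1} \<Longrightarrow> dist s x < d2 \<Longrightarrow> dist (I s) (I x) < \<epsilon> / 2"
      using I x \<epsilon> unfolding continuous_on_iff by (meson half_gt_zero)
    have "P a b" if ab: "a \<le> x" "x \<le> b" "b - a < min d1 d2" for a b
      unfolding P_def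
    proof
      assume ab': "0 \<le> a \<and> a \<le> b \<and> b \<le> 1"
      have 1: "dist (\<gamma> x) (\<gamma> s) \<le> \<bar>s - x\<bar> * I x + \<epsilon> / 2 * \<bar>s - x\<bar>" if "s \<in> {0..1}" "\<bar>s - x\<bar> < d1" for s
        using d1(2)[OF that] by linarith
      have "dist (\<gamma> a) (\<gamma> b) \<le> dist (\<gamma> x) (\<gamma> a) + dist (\<gamma> x) (\<gamma> b)" by (metis dist_commute dist_triangle)
      also have "\<dots> \<le> (\<bar>a - x\<bar> * I x + \<epsilon> / 2 * \<bar>a - x\<bar>) + (\<bar>b - x\<bar> * I x + \<epsilon> / 2 * \<bar>b - x\<bar>)"
        using ab ab' by (intro add_mono 1) auto
      also have "\<bar>a - x\<bar> = x - a" using ab by simp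
      also have "\<bar>b - x\<bar> = b - x" using ab by simp
      also have "((x - a) * I x + \<epsilon> / 2 * (x - a)) + ((b - x) * I x + \<epsilon> / 2 * (b - x)) = (b - a) * (I x + \<epsilon> / 2)"
        by (simp add: algebra_simps add_divide_distrib diff_divide_distrib)
      finally have up: "dist (\<gamma> a) (\<gamma> b) \<le> (b - a) * (I x + \<epsilon> / 2)" .
      have "integral {a..b} (\<lambda>_. I x - \<epsilon> / 2) \<le> integral {a..b} I"
      proof (rule integral_le)
        show "I integrable_on {a..b}" using ab' by (intro int) auto
        fix s assume s: "s \<in> {a..b}"
        then have "dist (I s) (I x) < \<epsilon> / 2" using ab ab' by (intro d2(2)) (auto simp: dist_real_def)
        then show "I x - \<epsilon> / 2 \<le> I s" unfolding dist_real_def by linarith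
      qed (rule integrable_const_ivl)
      then have "(b - a) * (I x - \<epsilon> / 2) \<le> integral {a..b} I" using ab' by simp
      moreover have "(b - a) * (I x + \<epsilon> / 2) = (b - a) * (I x - \<epsilon> / 2) + \<epsilon> * (b - a)"
        by (simp add: field_simps)
      ultimately show "dist (\<gamma> a) (\<gamma> b) \<le> integral {a..b} I + \<epsilon> * (b - a)" using up by linarith
    qed
    then show ?case using d1(1) d2(1) by (intro exI[of _ "min d1 d2"]) auto
  qed
  then show "dist (\<gamma> 0) (\<gamma> 1) \<le> integral {0..1} I + \<epsilon>" unfolding P_def by simp
qed

text \<open>Shortest paths have unit speed, while the curves of the length functional run over the
  unit interval. The case \<open>l = 0\<close> belongs to a constant path.\<close>

lemma midpoint_bounded_rescale:
  assumes g: "midpoint_bounded K (l * a) (l * b) g" and l: "l \<ge> 0"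
  shows "midpoint_bounded (K * l\<^sup>2) a b (\<lambda>s. g (l * s))"
  unfolding midpoint_bounded_def
proof (intro conjI allI impI)
  have "continuous_on {l * a..l * b} g" using g by (simp add: midpoint_bounded_def)
  then show "continuous_on {a..b} (\<lambda>s. g (l * s))"
    by (rule continuous_on_compose2) (use l in \<open>auto intro!: continuous_intros mult_left_mono\<close>)
  fix s h :: real assume h: "0 < h" "a \<le> s - h" "s + h \<le> b"
  show "\<bar>g (l * (s + h)) + g (l * (s - h)) - 2 * g (l * s)\<bar> \<le> 2 * (K * l\<^sup>2) * h\<^sup>2"
  proof (cases "l = 0")
    case False
    then have lh: "0 < l * h" using l h by simp
    have "l * a \<le> l * s - l * h" "l * s + l * h \<le> l * b"
      using mult_left_mono[OF h(2) l] mult_left_mono[OF h(3) l] by (simp_all add: algebra_simps)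
    then have "\<bar>g (l * s + l * h) + g (l * s - l * h) - 2 * g (l * s)\<bar> \<le> 2 * K * (l * h)\<^sup>2"
      using g lh unfolding midpoint_bounded_def by blast
    then show ?thesis by (simp add: algebra_simps power_mult_distrib)
  qed simp
qed

lemma midpoint_bounded_derivative:
  fixes g :: "real \<Rightarrow> real"
  assumes g: "midpoint_bounded K a b g" and K: "K \<ge> 0" and t: "t \<in> {a..b}" and S: "d > 0" "\<And>s. s \<in> S \<Longrightarrow> \<bar>s - t\<bar> < d \<Longrightarrow> s \<in> {a..b}"
  shows "\<exists>A. (g has_real_derivative A) (at t within S) \<and> (\<forall>s\<in>{a..b}. \<bar>g s - g t - A * (s - t)\<bar> \<le> 2 * K * (s - t)\<^sup>2)"
proof -
  obtain A where A: "\<And>s. s \<in> {a..b} \<Longrightarrow> \<bar>g s - g t - A * (s - t)\<bar> \<le> 2 * K * (s - t)\<^sup>2"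
    using midpoint_bounded_expansion[OF g K t] by blast
  have "(g has_real_derivative A) (at t within S)"
    by (rule has_field_derivative_of_quadratic_error[of S t d g A "2 * K"]) (use A S in auto)
  then show ?thesis using A by blast
qed

section \<open>The Finsler metric\<close>

locale good_manifold = semiconcave_G_space space_type for space_type :: "'a::metric_space itself" +
  fixes n :: nat
  assumes cover: "\<And>x::'a. \<exists>c. good_chart n c \<and> x \<in> fst c"
begin

abbreviation \<A> :: "'a chart set" where "\<A> \<equiv> good_atlas n"

definition base_chart :: "'a \<Rightarrow> 'a chart" where
  "base_chart p = (SOME c. good_chart n c \<and> p \<in> fst c)"

lemma base_chart: "good_chart n (base_chart p)" "p \<in> fst (base_chart p)"
  using someI_ex[OF cover[of p]] by (auto simp: base_chart_def)

text \<open>On tangent vectors the chart chosen at \<open>p\<close> has no influence, by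
  \<open>chart_norm_change\<close>. The choice may jump from point to point, so continuity is always
  verified after rewriting in one fixed chart.\<close>

definition finsler :: "'a \<times> 'a tvec \<Rightarrow> real" where
  "finsler = (\<lambda>(p, v). chart_norm (base_chart p) (snd (base_chart p) p) (v (base_chart p)))"

lemma finsler_tangent_space:
  assumes v: "v \<in> tangent_space n \<A> p" and c: "good_chart n c" "p \<in> fst c"
  shows "finsler (p, v) = chart_norm c (snd c p) (v c)"
proof -
  have "v (base_chart p) = differential n (transition c (base_chart p)) (snd c p) (v c)"
    using v c base_chart[of p] unfolding tangent_space_def good_atlas_def by blast
  moreover have "v c \<in> topspace (Euclidean_space n)"
    using v c unfolding tangent_space_def good_atlas_def by blast
  ultimately show ?thesis
    using chart_norm_change[OF c(1) base_chart(1), of p p] c(2) base_chart(2)[of p] by (simp add: finsler_def)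
qed

lemma finsler_tangent_vector:
  assumes c: "good_chart n c" "p \<in> fst c" and w: "w \<in> topspace (Euclidean_space n)"
  shows "finsler (p, tangent_vector n \<A> c p w) = chart_norm c (snd c p) w"
  using chart_norm_change[OF c(1) base_chart(1), of p p] c(2) base_chart[of p] w
  by (simp add: finsler_def tangent_vector_def good_atlas_def)

lemma Finsler_metric_finsler: "Finsler_metric n \<A> finsler"
  unfolding Finsler_metric_def norm_on_def
proof (intro allI conjI ballI)
  fix p :: 'a
  define c where "c = base_chart p"
  have c: "good_chart n c" "p \<in> fst c" "c \<in> \<A>" using base_chart[of p] by (auto simp: c_def good_atlas_def)
  have F: "finsler (p, v) = chart_norm c (snd c p) (v c)" for v by (simp add: finsler_def c_def)
  fix v assume v: "v \<in> tangent_space n \<A> p"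
  have vc: "v c \<in> topspace (Euclidean_space n)" using v c unfolding tangent_space_def by blast
  show "0 \<le> finsler (p, v)" unfolding F by (rule chart_norm_is_norm(1)[OF c(1,2) vc vc])
  show "finsler (p, v) = 0 \<longleftrightarrow> v = (\<lambda>_ _. 0)"
  proof
    assume "finsler (p, v) = 0"
    then have v0: "v c = (\<lambda>_. 0)" using chart_norm_is_norm(2)[OF c(1,2) vc vc] F by simp
    have "v c' = (\<lambda>_. 0)" for c'
    proof (cases "c' \<in> \<A> \<and> p \<in> fst c'")
      case True
      then have "v c' = differential n (transition c c') (snd c p) (v c)"
        using v c unfolding tangent_space_def by blast
      then show ?thesis by (auto simp: v0 differential_def)
    next
      case False
      then show ?thesis using v unfolding tangent_space_def by blast
    qed
    then show "v = (\<lambda>_ _. 0)" by auto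
  next
    assume "v = (\<lambda>_ _. 0)"
    then show "finsler (p, v) = 0" using chart_norm_is_norm(2)[OF c(1,2) vc vc] F by simp
  qed
  show "finsler (p, \<lambda>c i. r * v c i) = \<bar>r\<bar> * finsler (p, v)" for r
    unfolding F by (rule chart_norm_is_norm(3)[OF c(1,2) vc vc])
  fix w assume "w \<in> tangent_space n \<A> p"
  then have wc: "w c \<in> topspace (Euclidean_space n)" using c unfolding tangent_space_def by blast
  show "finsler (p, \<lambda>c i. v c i + w c i) \<le> finsler (p, v) + finsler (p, w)"
    unfolding F by (rule chart_norm_is_norm(4)[OF c(1,2) vc wc])
qed

lemma chart_norm_jointly_continuous:
  assumes c: "good_chart n c" "(x::'a) \<in> fst c" and w: "w \<in> topspace (Euclidean_space n)" and \<epsilon>: "\<epsilon> > 0"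
  shows "\<exists>d>0. \<forall>v\<in>euclid_ball n (snd c x) d. \<forall>w'\<in>euclid_ball n w d.
    v \<in> snd c ` fst c \<and> \<bar>chart_norm c (snd c x) w - chart_norm c v w'\<bar> < \<epsilon>"
proof -
  obtain e L where eL: "e > 0" "L \<ge> 0" "euclid_ball n (snd c x) e \<subseteq> snd c ` fst c"
    "\<And>u v w w'. u \<in> euclid_ball n (snd c x) e \<Longrightarrow> v \<in> euclid_ball n (snd c x) e \<Longrightarrow>
      w \<in> topspace (Euclidean_space n) \<Longrightarrow> w' \<in> topspace (Euclidean_space n) \<Longrightarrow>
      \<bar>chart_norm c u w - chart_norm c v w'\<bar> \<le> L * (L2_set w {..<n} * edist n u v + edist n w w')"
    using chart_norm_local[OF c] by blast
  define l where "l = L2_set w {..<n} + 1"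
  have l: "l > 0" by (simp add: l_def add_nonneg_pos)
  \<comment> \<open>The summand 1 makes the final inequality strict.\<close>
  define q where "q = L * l + L + 1"
  have q: "q > 0" using eL(2) l by (simp add: q_def add_nonneg_pos)
  define d where "d = min e (\<epsilon> / q)"
  have d: "d > 0" "d \<le> e" "d \<le> \<epsilon> / q" using eL(1) \<epsilon> q by (auto simp: d_def)
  have x: "snd c x \<in> topspace (Euclidean_space n)" using good_chartD(6)[of n "fst c" "snd c"] c by simp
  have "v \<in> snd c ` fst c \<and> \<bar>chart_norm c (snd c x) w - chart_norm c v w'\<bar> < \<epsilon>"
    if v: "v \<in> euclid_ball n (snd c x) d" and w': "w' \<in> euclid_ball n w d" for v w'
  proof -
    have ve: "v \<in> euclid_ball n (snd c x) e" using v euclid_ball_mono[OF d(2), of n "snd c x"] by blast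
    have "\<bar>chart_norm c (snd c x) w - chart_norm c v w'\<bar> \<le> L * (L2_set w {..<n} * edist n (snd c x) v + edist n w w')"
      using w' by (intro eL(4) center_in_euclid_ball[OF x eL(1)] ve w) (simp add: euclid_ball_def)
    also have "\<dots> \<le> L * (l * d + d)"
    proof (intro mult_left_mono[OF _ eL(2)] add_mono mult_mono)
      show "edist n (snd c x) v \<le> d" "edist n w w' \<le> d" using v w' by (simp_all add: euclid_ball_def)
    qed (use l in \<open>simp_all add: l_def\<close>)
    also have "\<dots> = (q - 1) * d" by (simp add: q_def algebra_simps)
    also have "\<dots> < q * d" using d(1) by simp
    also have "\<dots> \<le> \<epsilon>" using d(3) q by (simp add: field_simps)
    finally show ?thesis using ve eL(3) by blast
  qed
  then show ?thesis using d(1) by blast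
qed

text \<open>Over a single chart \<open>finsler\<close> is \<open>chart_norm\<close> in coordinates
  and jointly continuous there; the set \<open>W\<close> of coordinates with value in
  \<open>O'\<close> is open, and the vectors with coordinates in \<open>W\<close> form a generator
  of the tangent topology.\<close>

lemma continuous_finsler: "continuous_map (tangent_topology n \<A>) euclideanreal finsler"
  unfolding continuous_map_def
proof (intro conjI allI impI)
  define T where "T = tangent_topology n \<A>"
  fix O' :: "real set" assume "openin euclideanreal O'"
  then have O': "open O'" by simp
  show "openin (tangent_topology n \<A>) {z \<in> topspace (tangent_topology n \<A>). finsler z \<in> O'}"
    unfolding T_def[symmetric]
  proof (subst openin_subopen, intro ballI)
    fix z assume "z \<in> {z \<in> topspace T. finsler z \<in> O'}"
    then have z: "z \<in> topspace T" "finsler z \<in> O'" by auto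
    obtain p v where zpv: "z = (p, v)" by (cases z)
    obtain c where c: "c \<in> \<A>" "p \<in> fst c" "(p, v) \<in> tangent_bundle n \<A>"
      using z(1) unfolding T_def tangent_topology_def topology_generated_by_topspace zpv by blast
    have gc: "good_chart n c" using c(1) by (simp add: good_atlas_def)
    define W where "W = {(u, w) \<in> snd c ` fst c \<times> topspace (Euclidean_space n). chart_norm c u w \<in> O'}"
    have "openin (prod_topology (Euclidean_space n) (Euclidean_space n)) W"
      unfolding openin_prod_topology_alt
    proof (intro allI impI)
      fix u w assume uw: "(u, w) \<in> W"
      then obtain y where y: "y \<in> fst c" "u = snd c y" by (auto simp: W_def)
      have w: "w \<in> topspace (Euclidean_space n)" "chart_norm c u w \<in> O'" using uw by (auto simp: W_def)
      obtain \<epsilon> where \<epsilon>: "\<epsilon> > 0" "ball (chart_norm c u w) \<epsilon> \<subseteq> O'" using O' w(2) open_contains_ball by blast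
      obtain d where d: "d > 0" "\<And>v w'. v \<in> euclid_ball n u d \<Longrightarrow> w' \<in> euclid_ball n w d \<Longrightarrow>
          v \<in> snd c ` fst c \<and> \<bar>chart_norm c u w - chart_norm c v w'\<bar> < \<epsilon>"
        using chart_norm_jointly_continuous[OF gc y(1) w(1) \<epsilon>(1)] unfolding y(2) by blast
      have uT: "u \<in> topspace (Euclidean_space n)" using good_chartD(6)[of n "fst c" "snd c" y] gc y by simp
      have "euclid_ball n u d \<times> euclid_ball n w d \<subseteq> W"
      proof clarify
        fix v w' assume vw: "v \<in> euclid_ball n u d" "w' \<in> euclid_ball n w d"
        from d(2)[OF this] have "v \<in> snd c ` fst c" "chart_norm c v w' \<in> ball (chart_norm c u w) \<epsilon>"
          by (auto simp: dist_real_def)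
        then show "(v, w') \<in> W" using \<epsilon>(2) vw(2) by (auto simp: W_def euclid_ball_def)
      qed
      then show "\<exists>U V. openin (Euclidean_space n) U \<and> openin (Euclidean_space n) V \<and> u \<in> U \<and> w \<in> V \<and> U \<times> V \<subseteq> W"
        using openin_euclid_ball[of n u d] openin_euclid_ball[of n w d]
          center_in_euclid_ball[OF uT d(1)] center_in_euclid_ball[OF w(1) d(1)] by blast
    qed
    then have op: "openin T {(p, v) \<in> tangent_bundle n \<A>. p \<in> fst c \<and> (snd c p, v c) \<in> W}"
      unfolding T_def tangent_topology_def using c(1) by (intro topology_generated_by_Basis) blast
    have F: "finsler (q, u) = chart_norm c (snd c q) (u c)" if "(q, u) \<in> tangent_bundle n \<A>" "q \<in> fst c" for q u
      using finsler_tangent_space[OF _ gc that(2), of u] that(1) by (simp add: tangent_bundle_def)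
    have vc: "v c \<in> topspace (Euclidean_space n)"
      using c unfolding tangent_bundle_def tangent_space_def by blast
    have "z \<in> {(p, v) \<in> tangent_bundle n \<A>. p \<in> fst c \<and> (snd c p, v c) \<in> W}"
      using c vc z(2) F[OF c(3,2)] by (simp add: zpv W_def)
    moreover have "{(p, v) \<in> tangent_bundle n \<A>. p \<in> fst c \<and> (snd c p, v c) \<in> W} \<subseteq> {z \<in> topspace T. finsler z \<in> O'}"
    proof
      fix z' assume z': "z' \<in> {(p, v) \<in> tangent_bundle n \<A>. p \<in> fst c \<and> (snd c p, v c) \<in> W}"
      then have "z' \<in> topspace T" using openin_subset[OF op] by blast
      moreover have "finsler z' \<in> O'" using z' F by (auto simp: W_def)
      ultimately show "z' \<in> {z \<in> topspace T. finsler z \<in> O'}" by simp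
    qed
    ultimately show "\<exists>S. openin T S \<and> z \<in> S \<and> S \<subseteq> {z \<in> topspace T. finsler z \<in> O'}" using op by blast
  qed
qed simp

text \<open>On the vectors with constant coordinates \<open>v\<close>, \<open>finsler\<close> is
  \<open>chart_norm c y v\<close>, which is Lipschitz in \<open>y\<close>; on balls of diameter at
  most 1 this is also a 1/2-Hoelder bound.\<close>

lemma base_Holder_finsler: "base_locally_half_Holder n \<A> finsler"
  unfolding base_locally_half_Holder_def locally_Holder_def
proof (clarify, goal_cases)
  case (1 U \<phi> v _ x)
  define c where "c = (U, \<phi>)"
  have c: "good_chart n c" "x \<in> fst c" using 1 by (simp_all add: c_def good_atlas_def)
  have inj: "inj_on \<phi> U" using good_chartD(3)[of n U \<phi>] c(1) by (simp add: c_def)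
  define f where "f y = (let p = inv_into U \<phi> y in finsler (p, tangent_vector n \<A> (U, \<phi>) p v))" for y
  have f: "f y = chart_norm c y v" if y: "y \<in> \<phi> ` U" for y
  proof -
    obtain q where q: "q \<in> U" "y = \<phi> q" using y by blast
    then show ?thesis using finsler_tangent_vector[OF c(1), of q v] 1(2) inj by (simp add: f_def c_def)
  qed
  obtain e L where eL: "e > 0" "L \<ge> 0" "euclid_ball n (snd c x) e \<subseteq> snd c ` fst c"
    "\<And>u v w w'. u \<in> euclid_ball n (snd c x) e \<Longrightarrow> v \<in> euclid_ball n (snd c x) e \<Longrightarrow>
      w \<in> topspace (Euclidean_space n) \<Longrightarrow> w' \<in> topspace (Euclidean_space n) \<Longrightarrow>
      \<bar>chart_norm c u w - chart_norm c v w'\<bar> \<le> L * (L2_set w {..<n} * edist n u v + edist n w w')"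
    using chart_norm_local[OF c] by blast
  define d where "d = min e (1 / 2)"
  have d: "d > 0" "d \<le> e" "d \<le> 1 / 2" using eL(1) by (auto simp: d_def)
  have sub: "euclid_ball n (\<phi> x) d \<subseteq> euclid_ball n (\<phi> x) e" by (rule euclid_ball_mono[OF d(2)])
  have bound: "\<bar>f y - f z\<bar> \<le> (L * L2_set v {..<n}) * edist n y z powr (1 / 2)"
    if yz: "y \<in> euclid_ball n (\<phi> x) d" "z \<in> euclid_ball n (\<phi> x) d" for y z
  proof -
    have yze: "y \<in> euclid_ball n (\<phi> x) e" "z \<in> euclid_ball n (\<phi> x) e" using yz sub by auto
    then have im: "y \<in> \<phi> ` U" "z \<in> \<phi> ` U" using eL(3) by (auto simp: c_def)
    have "\<bar>f y - f z\<bar> \<le> L * (L2_set v {..<n} * edist n y z + edist n v v)"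
      unfolding f[OF im(1)] f[OF im(2)] using yze 1(2) by (intro eL(4)) (simp_all add: c_def)
    also have "\<dots> = (L * L2_set v {..<n}) * edist n y z" by simp
    also have "\<dots> \<le> (L * L2_set v {..<n}) * edist n y z powr (1 / 2)"
    proof (rule mult_left_mono)
      have "edist n y z \<le> 1" using yz d(3) edist_triangle[of n y z "\<phi> x"] edist_commute[of n y "\<phi> x"]
        by (simp add: euclid_ball_def)
      then show "edist n y z \<le> edist n y z powr (1 / 2)" by (rule le_powr_half[OF edist_nonneg])
    qed (use eL(2) in simp)
    finally show ?thesis .
  qed
  show ?case
    unfolding f_def[symmetric]
  proof (intro exI conjI ballI)
    show "openin (Euclidean_space n) (euclid_ball n (\<phi> x) d)" by (rule openin_euclid_ball)
    show "\<phi> x \<in> euclid_ball n (\<phi> x) d"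
      using good_chartD(6)[of n U \<phi> x] c d(1) by (simp add: c_def)
    show "euclid_ball n (\<phi> x) d \<subseteq> \<phi> ` U" using sub eL(3) by (simp add: c_def)
  qed (rule bound)
qed

section \<open>Velocities, lengths of curves and compatibility with the distance\<close>

lemma velocity_derivative:
  assumes \<gamma>: "C1_curve n \<A> \<gamma>" and t: "t \<in> {0..1}" and c: "good_chart n c" "\<gamma> t \<in> fst c"
  shows "velocity \<A> \<gamma> t c \<in> topspace (Euclidean_space n)"
    "i < n \<Longrightarrow> ((\<lambda>s. snd c (\<gamma> s) i) has_real_derivative velocity \<A> \<gamma> t c i) (at t within {0..1})"
proof -
  have cA: "c \<in> \<A>" using c(1) by (simp add: good_atlas_def)
  have vel: "velocity \<A> \<gamma> t c i = vector_derivative (\<lambda>s. snd c (\<gamma> s) i) (at t within {0..1})" for i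
    using cA c(2) by (simp add: velocity_def)
  show "((\<lambda>s. snd c (\<gamma> s) i) has_real_derivative velocity \<A> \<gamma> t c i) (at t within {0..1})" if i: "i < n"
  proof -
    have "(\<lambda>s. snd c (\<gamma> s) i) differentiable (at t within {0..1})"
      using \<gamma> cA c(2) t i unfolding C1_curve_def by blast
    then obtain D where D: "((\<lambda>s. snd c (\<gamma> s) i) has_real_derivative D) (at t within {0..1})"
      using real_differentiable_def by (auto simp: real_differentiableE)
    then have "((\<lambda>s. snd c (\<gamma> s) i) has_vector_derivative D) (at t within {0..1})"
      by (simp add: has_real_derivative_iff_has_vector_derivative)
    then have "velocity \<A> \<gamma> t c i = D"
      unfolding vel using t by (intro vector_derivative_within_closed_interval) auto
    then show ?thesis using D by simp
  qed
  \<comment> \<open>\<open>C1_curve\<close> speaks of the coordinates below \<open>n\<close>, while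
    membership in Euclidean n-space requires the other components to vanish; they are derivatives of
    functions that are 0 near \<open>t\<close>.\<close>
  have "velocity \<A> \<gamma> t c i = 0" if i: "i \<ge> n" for i
  proof -
    have "open (fst c)" using c(1) by (simp add: good_chart_def)
    then obtain r where r: "r > 0" "ball (\<gamma> t) r \<subseteq> fst c" using c(2) open_contains_ball by blast
    have "continuous_on {0..1} \<gamma>" using \<gamma> by (simp add: C1_curve_def)
    then obtain d where d: "d > 0" "\<And>s. s \<in> {0..1} \<Longrightarrow> dist s t < d \<Longrightarrow> dist (\<gamma> s) (\<gamma> t) < r"
      using t r(1) unfolding continuous_on_iff by blast
    have zero: "snd c y i = 0" if "y \<in> fst c" for y
      using good_chartD(6)[of n "fst c" "snd c" y] c(1) that i by (simp add: topspace_Euclidean_space)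
    have "((\<lambda>s. snd c (\<gamma> s) i) has_real_derivative 0) (at t within {0..1})"
    proof (rule has_field_derivative_of_quadratic_error[where C = 0 and d = d])
      fix s :: real assume s: "s \<in> {0..1}" "\<bar>s - t\<bar> < d"
      then have "\<gamma> s \<in> ball (\<gamma> t) r" using d(2)[of s] by (simp add: dist_real_def dist_commute)
      then have "snd c (\<gamma> s) i = 0" using r(2) zero by blast
      then show "\<bar>snd c (\<gamma> s) i - snd c (\<gamma> t) i - 0 * (s - t)\<bar> \<le> 0 * (s - t)\<^sup>2" using zero[OF c(2)] by simp
    qed (rule d(1))
    then have "((\<lambda>s. snd c (\<gamma> s) i) has_vector_derivative 0) (at t within {0..1})"
      by (simp add: has_real_derivative_iff_has_vector_derivative)
    then show ?thesis unfolding vel using t by (intro vector_derivative_within_closed_interval) auto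
  qed
  then show "velocity \<A> \<gamma> t c \<in> topspace (Euclidean_space n)" by (simp add: topspace_Euclidean_space)
qed

text \<open>Every chart around \<open>\<gamma> t\<close> computes the same metric speed, and that
  speed is unique; this takes the place of a chain rule for the velocity under transition
  maps.\<close>

lemma finsler_velocity_speed:
  assumes \<gamma>: "C1_curve n \<A> \<gamma>" and t: "t \<in> {0..1}"
  shows "has_speed \<gamma> t (finsler (\<gamma> t, velocity \<A> \<gamma> t))"
    "good_chart n c \<Longrightarrow> \<gamma> t \<in> fst c \<Longrightarrow>
      finsler (\<gamma> t, velocity \<A> \<gamma> t) = chart_norm c (snd c (\<gamma> t)) (velocity \<A> \<gamma> t c)"
proof -
  have X: "semiconcave_G_space TYPE('a)" by (rule semiconcave_G_space.intro[OF G_space semiconcave])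
  have cont: "continuous_on {0..1} \<gamma>" using \<gamma> by (simp add: C1_curve_def)
  have sp: "has_speed \<gamma> t (chart_norm c (snd c (\<gamma> t)) (velocity \<A> \<gamma> t c))" if c: "good_chart n c" "\<gamma> t \<in> fst c" for c
    by (rule C1_curve_speed[OF X c(1) t c(2) cont velocity_derivative(2)[OF \<gamma> t c] velocity_derivative(1)[OF \<gamma> t c]])
  show 1: "has_speed \<gamma> t (finsler (\<gamma> t, velocity \<A> \<gamma> t))"
    using sp[OF base_chart] by (simp add: finsler_def)
  show "finsler (\<gamma> t, velocity \<A> \<gamma> t) = chart_norm c (snd c (\<gamma> t)) (velocity \<A> \<gamma> t c)"
    if "good_chart n c" "\<gamma> t \<in> fst c"
    by (rule has_speed_unique[OF 1 sp[OF that] t])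
qed

text \<open>In one fixed chart around \<open>\<gamma> t\<close> both the point and the velocity vary
  continuously with time, and the norm is jointly continuous in them.\<close>

lemma continuous_finsler_velocity:
  assumes \<gamma>: "C1_curve n \<A> \<gamma>"
  shows "continuous_on {0..1} (\<lambda>t. finsler (\<gamma> t, velocity \<A> \<gamma> t))"
  unfolding continuous_on_iff
proof (intro ballI allI impI)
  fix t \<epsilon> :: real assume t: "t \<in> {0..1}" and \<epsilon>: "\<epsilon> > 0"
  obtain c where c: "good_chart n c" "\<gamma> t \<in> fst c" using cover by blast
  have cA: "c \<in> \<A>" using c(1) by (simp add: good_atlas_def)
  define w where "w s = velocity \<A> \<gamma> s c" for s
  have w: "w t \<in> topspace (Euclidean_space n)" unfolding w_def by (rule velocity_derivative(1)[OF \<gamma> t c])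
  obtain d where d: "d > 0" "\<And>v w'. v \<in> euclid_ball n (snd c (\<gamma> t)) d \<Longrightarrow> w' \<in> euclid_ball n (w t) d \<Longrightarrow>
      \<bar>chart_norm c (snd c (\<gamma> t)) (w t) - chart_norm c v w'\<bar> < \<epsilon>"
    using chart_norm_jointly_continuous[OF c w \<epsilon>] by blast
  have cont: "continuous_on {0..1} \<gamma>" using \<gamma> by (simp add: C1_curve_def)
  obtain d' C where d': "d' > 0" "C \<ge> 1" "ball (\<gamma> t) d' \<subseteq> fst c"
    "\<And>y z. y \<in> ball (\<gamma> t) d' \<Longrightarrow> z \<in> ball (\<gamma> t) d' \<Longrightarrow> edist n (snd c y) (snd c z) \<le> C * dist y z"
    using good_chart_local[of n "fst c" "snd c" "\<gamma> t"] c by (metis prod.collapse)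
  define S where "S = {s \<in> {0..1}. \<gamma> s \<in> fst c}"
  have tS: "t \<in> S" using t c by (simp add: S_def)
  have vc: "continuous_on S (\<lambda>s. w s i)" if "i < n" for i
    using \<gamma> cA that unfolding C1_curve_def w_def S_def by blast
  have "continuous_on S (\<lambda>s. L2_set (\<lambda>i. w t i - w s i) {..<n})"
    unfolding L2_set_def by (intro continuous_intros vc) simp
  then have "continuous_on S (\<lambda>s. edist n (w t) (w s))" unfolding edist_def .
  then obtain d1 where d1: "d1 > 0" "\<And>s. s \<in> S \<Longrightarrow> dist s t < d1 \<Longrightarrow> dist (edist n (w t) (w s)) (edist n (w t) (w t)) < d"
    using tS d(1) unfolding continuous_on_iff by blast
  have "min d' (d / C) > 0" using d d' by simp
  then obtain d2 where d2: "d2 > 0" "\<And>s. s \<in> {0..1} \<Longrightarrow> dist s t < d2 \<Longrightarrow> dist (\<gamma> s) (\<gamma> t) < min d' (d / C)"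
    using cont t unfolding continuous_on_iff by blast
  have "dist (finsler (\<gamma> s, velocity \<A> \<gamma> s)) (finsler (\<gamma> t, velocity \<A> \<gamma> t)) < \<epsilon>"
    if s: "s \<in> {0..1}" "dist s t < min d1 d2" for s
  proof -
    have sb: "\<gamma> s \<in> ball (\<gamma> t) d'" "dist (\<gamma> t) (\<gamma> s) < d / C"
      using d2(2)[OF s(1)] s(2) by (simp_all add: dist_commute)
    then have sc: "\<gamma> s \<in> fst c" using d'(3) by blast
    have "edist n (snd c (\<gamma> t)) (snd c (\<gamma> s)) \<le> C * dist (\<gamma> t) (\<gamma> s)" using d'(1) sb by (intro d'(4)) auto
    also have "\<dots> < d" using sb(2) d'(2) by (simp add: field_simps)
    finally have 1: "snd c (\<gamma> s) \<in> euclid_ball n (snd c (\<gamma> t)) d"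
      using good_chartD(6)[of n "fst c" "snd c" "\<gamma> s"] c(1) sc by (simp add: euclid_ball_def)
    have "edist n (w t) (w s) < d" using d1(2)[of s] s sc by (simp add: S_def dist_real_def)
    then have 2: "w s \<in> euclid_ball n (w t) d"
      using velocity_derivative(1)[OF \<gamma> s(1) c(1) sc] by (simp add: euclid_ball_def w_def)
    show ?thesis
      using d(2)[OF 1 2] unfolding finsler_velocity_speed(2)[OF \<gamma> s(1) c(1) sc]
        finsler_velocity_speed(2)[OF \<gamma> t c] w_def by (simp add: dist_real_def abs_minus_commute)
  qed
  then show "\<exists>d>0. \<forall>s\<in>{0..1}. dist s t < d \<longrightarrow>
      dist (finsler (\<gamma> s, velocity \<A> \<gamma> s)) (finsler (\<gamma> t, velocity \<A> \<gamma> t)) < \<epsilon>"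
    using d1(1) d2(1) by (intro exI[of _ "min d1 d2"]) auto
qed

text \<open>The coordinates of a good chart are almost affine, hence midpoint bounded along the
  path, and so have a derivative with quadratic remainder at each time. Comparing the expansions at
  two times shows that this derivative varies continuously.\<close>

lemma geodesic_C1_curve:
  assumes \<sigma>: "shortest_path 0 l \<sigma>"
  shows "C1_curve n \<A> (\<lambda>s. \<sigma> (l * s))"
  unfolding C1_curve_def
proof (intro conjI ballI allI impI)
  define \<gamma> where "\<gamma> s = \<sigma> (l * s)" for s
  have l: "l \<ge> 0" using \<sigma> by (simp add: shortest_path_def)
  have dist_\<gamma>: "dist (\<gamma> s) (\<gamma> t) = l * \<bar>s - t\<bar>" if "s \<in> {0..1}" "t \<in> {0..1}" for s t
  proof -
    have "l * s \<le> l" "l * t \<le> l" using that mult_left_mono[of _ 1 l] l by auto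
    then have "dist (\<gamma> s) (\<gamma> t) = \<bar>l * s - l * t\<bar>"
      unfolding \<gamma>_def using that l by (intro shortest_path_dist[OF \<sigma>]) auto
    then show ?thesis using l by (simp add: abs_mult flip: right_diff_distrib)
  qed
  show "continuous_on {0..1} (\<lambda>s. \<sigma> (l * s))"
    unfolding \<gamma>_def[symmetric]
    by (rule lipschitz_on_continuous_on[of l], rule lipschitz_onI) (use dist_\<gamma> l in \<open>auto simp: dist_real_def\<close>)
  have local: "\<exists>d>0. \<exists>K. \<exists>A. \<forall>s\<in>{0..1}. \<bar>s - t\<bar> < d \<longrightarrow>
      ((\<lambda>s. snd c (\<gamma> s) i) has_real_derivative A s) (at s within {0..1}) \<and> \<bar>A s - A t\<bar> \<le> K * \<bar>s - t\<bar>"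
    if c: "good_chart n c" and t: "t \<in> {0..1}" "\<gamma> t \<in> fst c" and i: "i < n" for c t i
  proof -
    have "locally_almost_affine (fst c) (\<lambda>x. snd c x i)" using c i by (simp add: good_chart_def)
    then obtain d C where d: "d > 0" "ball (\<gamma> t) d \<subseteq> fst c" "almost_affine (ball (\<gamma> t) d) C (\<lambda>x. snd c x i)"
      using t(2) unfolding locally_almost_affine_def by blast
    have C: "C \<ge> 0" by (rule almost_affineD(1)[OF d(3)])
    \<comment> \<open>Within time \<open>r\<close> the path moves by at most \<open>d / 2\<close>;
      the added 1 covers \<open>l = 0\<close>.\<close>
    define r where "r = d / (2 * (l + 1))"
    have r: "r > 0" using d(1) l by (simp add: r_def add_nonneg_pos)
    define a where "a = max 0 (t - r)"
    define b where "b = min 1 (t + r)"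
    have ab: "0 \<le> a" "b \<le> 1" "a \<le> t" "t \<le> b" "t - r \<le> a" "b \<le> t + r" using t(1) r by (auto simp: a_def b_def)
    have in_ball: "\<gamma> s \<in> ball (\<gamma> t) d" if s: "s \<in> {a..b}" for s
    proof -
      have "dist (\<gamma> t) (\<gamma> s) = l * \<bar>t - s\<bar>" using s ab t(1) by (intro dist_\<gamma>) auto
      also have "\<dots> \<le> (l + 1) * r" using s ab l by (intro mult_mono) auto
      also have "\<dots> = d / 2" using l by (simp add: r_def field_simps)
      finally show ?thesis using d(1) by simp
    qed
    define f where "f x = snd c x i" for x
    define K where "K = 2 * C * l\<^sup>2"
    have K: "K \<ge> 0" using C by (simp add: K_def)
    have "l * a \<le> l * b" "l * b \<le> l * 1" "0 \<le> l * a"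
      using ab l by (intro mult_left_mono mult_nonneg_nonneg; simp)+
    then have "l * a \<le> l * b" "{l * a..l * b} \<subseteq> {0..l}" by auto
    then have "shortest_path (l * a) (l * b) \<sigma>"
      using \<sigma> unfolding shortest_path_def by blast
    moreover have "\<sigma> ` {l * a..l * b} \<subseteq> ball (\<gamma> t) d"
    proof clarify
      fix u assume u: "u \<in> {l * a..l * b}"
      show "\<sigma> u \<in> ball (\<gamma> t) d"
      proof (cases "l = 0")
        case True
        then show ?thesis using u d(1) by (simp add: \<gamma>_def)
      next
        case False
        then have "u / l \<in> {a..b}" using u l by (auto simp: field_simps)
        from in_ball[OF this] show ?thesis using False by (simp add: \<gamma>_def)
      qed
    qed
    ultimately have "midpoint_bounded (2 * C) (l * a) (l * b) (f \<circ> \<sigma>)"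
      using d(3) unfolding f_def[symmetric] by (intro almost_affine_shortest_path) (simp_all add: f_def[abs_def])
    from midpoint_bounded_rescale[OF this l]
    have mb: "midpoint_bounded K a b (\<lambda>s. f (\<gamma> s))" by (simp add: K_def \<gamma>_def)
    have "\<exists>A. ((\<lambda>s. f (\<gamma> s)) has_real_derivative A) (at s within {0..1}) \<and>
        (\<forall>u\<in>{a..b}. \<bar>f (\<gamma> u) - f (\<gamma> s) - A * (u - s)\<bar> \<le> 2 * K * (u - s)\<^sup>2)"
      if s: "s \<in> {0..1}" "\<bar>s - t\<bar> < r" for s
    proof (rule midpoint_bounded_derivative[OF mb K, of s "r - \<bar>s - t\<bar>"])
      show "s \<in> {a..b}" using s by (auto simp: a_def b_def)
      show "r - \<bar>s - t\<bar> > 0" using s by simp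
      fix u assume "u \<in> {0..1}" "\<bar>u - s\<bar> < r - \<bar>s - t\<bar>"
      then show "u \<in> {a..b}" by (auto simp: a_def b_def)
    qed
    then obtain A where A: "\<And>s. s \<in> {0..1} \<Longrightarrow> \<bar>s - t\<bar> < r \<Longrightarrow> ((\<lambda>s. f (\<gamma> s)) has_real_derivative A s) (at s within {0..1})"
      "\<And>s u. s \<in> {0..1} \<Longrightarrow> \<bar>s - t\<bar> < r \<Longrightarrow> u \<in> {a..b} \<Longrightarrow> \<bar>f (\<gamma> u) - f (\<gamma> s) - A s * (u - s)\<bar> \<le> 2 * K * (u - s)\<^sup>2"
      by metis
    \<comment> \<open>Adding the expansion at \<open>t\<close> evaluated in \<open>s\<close> and the
      one at \<open>s\<close> evaluated in \<open>t\<close> cancels the values of \<open>f\<close>;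
      division by \<open>\<bar>s - t\<bar>\<close> leaves \<open>4 * K\<close>.\<close>
    have "\<bar>A s - A t\<bar> \<le> 4 * K * \<bar>s - t\<bar>" if s: "s \<in> {0..1}" "\<bar>s - t\<bar> < r" for s
    proof (cases "s = t")
      case False
      have "s \<in> {a..b}" using s by (auto simp: a_def b_def)
      then have "\<bar>f (\<gamma> s) - f (\<gamma> t) - A t * (s - t)\<bar> \<le> 2 * K * (s - t)\<^sup>2" using A(2)[OF t(1), of s] r by simp
      moreover have "\<bar>f (\<gamma> t) - f (\<gamma> s) - A s * (t - s)\<bar> \<le> 2 * K * (t - s)\<^sup>2" using A(2)[OF s, of t] ab by simp
      ultimately have "\<bar>A s * (s - t) - A t * (s - t)\<bar> \<le> 4 * K * (s - t)\<^sup>2"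
        by (simp add: abs_le_iff power2_commute algebra_simps)
      moreover have "A s * (s - t) - A t * (s - t) = (A s - A t) * (s - t)" by (simp add: algebra_simps)
      ultimately have "\<bar>A s - A t\<bar> * \<bar>s - t\<bar> \<le> 4 * K * \<bar>s - t\<bar> * \<bar>s - t\<bar>"
        by (simp add: abs_mult power2_eq_square mult.assoc)
      then show ?thesis using False by simp
    qed simp
    then show ?thesis using A(1) r unfolding f_def
      by (intro exI[of _ r] conjI exI[of _ "4 * K"] exI[of _ A]) auto
  qed
  fix c i assume c: "c \<in> \<A>" and i: "i < n"
  have gc: "good_chart n c" using c by (simp add: good_atlas_def)
  show "(\<lambda>s. snd c (\<sigma> (l * s)) i) differentiable (at t within {0..1})"
    if "t \<in> {0..1}" "\<sigma> (l * t) \<in> fst c" for t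
    using local[OF gc, of t i] that i unfolding \<gamma>_def real_differentiable_def by fastforce
  show "continuous_on {t \<in> {0..1}. \<sigma> (l * t) \<in> fst c} (\<lambda>t. velocity \<A> (\<lambda>s. \<sigma> (l * s)) t c i)"
    unfolding \<gamma>_def[symmetric] continuous_on_iff
  proof (intro ballI allI impI)
    fix t \<epsilon> :: real assume "t \<in> {t \<in> {0..1}. \<gamma> t \<in> fst c}" and \<epsilon>: "\<epsilon> > 0"
    then have t: "t \<in> {0..1}" "\<gamma> t \<in> fst c" by auto
    obtain d K A where d: "d > 0" "\<And>s. s \<in> {0..1} \<Longrightarrow> \<bar>s - t\<bar> < d \<Longrightarrow>
      ((\<lambda>s. snd c (\<gamma> s) i) has_real_derivative A s) (at s within {0..1}) \<and> \<bar>A s - A t\<bar> \<le> K * \<bar>s - t\<bar>"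
      using local[OF gc t i] by blast
    have vel: "velocity \<A> \<gamma> s c i = A s" if s: "s \<in> {0..1}" "\<bar>s - t\<bar> < d" "\<gamma> s \<in> fst c" for s
    proof -
      have "((\<lambda>s. snd c (\<gamma> s) i) has_vector_derivative A s) (at s within {0..1})"
        using d(2)[OF s(1,2)] by (simp add: has_real_derivative_iff_has_vector_derivative)
      then have "vector_derivative (\<lambda>s. snd c (\<gamma> s) i) (at s within {0..1}) = A s"
        using s(1) by (intro vector_derivative_within_closed_interval) auto
      then show ?thesis using c s(3) by (simp add: velocity_def)
    qed
    define d' where "d' = min d (\<epsilon> / (\<bar>K\<bar> + 1))"
    have d': "d' > 0" "d' \<le> d" "d' \<le> \<epsilon> / (\<bar>K\<bar> + 1)" using d(1) \<epsilon> by (auto simp: d'_def)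
    have "dist (velocity \<A> \<gamma> s c i) (velocity \<A> \<gamma> t c i) < \<epsilon>"
      if s: "s \<in> {t \<in> {0..1}. \<gamma> t \<in> fst c}" "dist s t < d'" for s
    proof -
      have s': "s \<in> {0..1}" "\<bar>s - t\<bar> < d" "\<gamma> s \<in> fst c" using s d' by (auto simp: dist_real_def)
      have "\<bar>A s - A t\<bar> \<le> K * \<bar>s - t\<bar>" using d(2)[OF s'(1,2)] by blast
      also have "\<dots> \<le> (\<bar>K\<bar> + 1) * \<bar>s - t\<bar>" by (intro mult_right_mono) auto
      also have "\<dots> < \<epsilon>"
      proof -
        have "\<bar>s - t\<bar> < \<epsilon> / (\<bar>K\<bar> + 1)" using s(2) d'(3) unfolding dist_real_def by linarith
        then show ?thesis by (simp add: pos_less_divide_eq mult.commute)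
      qed
      finally show ?thesis using vel[OF s'] vel[OF t(1) _ t(2)] d(1) by (simp add: dist_real_def)
    qed
    then show "\<exists>d>0. \<forall>s\<in>{t \<in> {0..1}. \<gamma> t \<in> fst c}. dist s t < d \<longrightarrow>
        dist (velocity \<A> \<gamma> s c i) (velocity \<A> \<gamma> t c i) < \<epsilon>" using d'(1) by blast
  qed
qed

text \<open>The rescaled path has metric speed exactly \<open>l\<close> at every time, with no error
  term, and speeds are unique.\<close>

lemma geodesic_finsler_length:
  assumes \<sigma>: "shortest_path 0 l \<sigma>" and t: "t \<in> {0..1}"
  shows "finsler (\<sigma> (l * t), velocity \<A> (\<lambda>s. \<sigma> (l * s)) t) = l"
proof -
  have l: "l \<ge> 0" using \<sigma> by (simp add: shortest_path_def)
  have "has_speed (\<lambda>s. \<sigma> (l * s)) t l"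
    unfolding has_speed_def
  proof (intro allI impI exI[of _ "1::real"] conjI ballI)
    fix \<epsilon> s :: real assume \<epsilon>: "\<epsilon> > 0" and s: "s \<in> {0..1}"
    have "l * s \<le> l" "l * t \<le> l" using s t mult_left_mono[of _ 1 l] l by auto
    then have "dist (\<sigma> (l * t)) (\<sigma> (l * s)) = \<bar>l * t - l * s\<bar>"
      using s t l by (intro shortest_path_dist[OF \<sigma>]) auto
    also have "\<dots> = \<bar>s - t\<bar> * l"
      using l by (simp add: abs_mult abs_minus_commute mult.commute flip: right_diff_distrib)
    finally show "\<bar>dist (\<sigma> (l * t)) (\<sigma> (l * s)) - \<bar>s - t\<bar> * l\<bar> \<le> \<epsilon> * \<bar>s - t\<bar>" using \<epsilon> by simp
  qed simp
  then show ?thesis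
    using has_speed_unique[OF finsler_velocity_speed(1)[OF geodesic_C1_curve[OF \<sigma>] t] _ t] by simp
qed

text \<open>Integrating the speed bounds the distance by the length of any admissible curve. A
  shortest path run over the unit interval is admissible with the constant integrand
  \<open>dist p q\<close>, so the infimum is attained.\<close>

lemma compatible_finsler: "compatible_Finsler_metric n \<A> finsler"
  unfolding compatible_Finsler_metric_def
proof (intro allI antisym)
  fix p q :: 'a
  show "ereal (dist p q) \<le> (INF \<gamma>\<in>{\<gamma>. C1_curve n \<A> \<gamma> \<and> \<gamma> 0 = p \<and> \<gamma> 1 = q}.
      ereal (integral {0..1} (\<lambda>t. finsler (\<gamma> t, velocity \<A> \<gamma> t))))"
  proof (rule INF_greatest)
    fix \<gamma> assume "\<gamma> \<in> {\<gamma>. C1_curve n \<A> \<gamma> \<and> \<gamma> 0 = p \<and> \<gamma> 1 = q}"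
    then have \<gamma>: "C1_curve n \<A> \<gamma>" "\<gamma> 0 = p" "\<gamma> 1 = q" by auto
    show "ereal (dist p q) \<le> ereal (integral {0..1} (\<lambda>t. finsler (\<gamma> t, velocity \<A> \<gamma> t)))"
      using dist_le_integral_of_speed[OF continuous_finsler_velocity[OF \<gamma>(1)] finsler_velocity_speed(1)[OF \<gamma>(1)]]
        \<gamma>(2,3) by simp
  qed
  obtain \<sigma> where \<sigma>: "shortest_path 0 (dist p q) \<sigma>" "\<sigma> 0 = p" "\<sigma> (dist p q) = q" by (rule geodesic_exists)
  define \<gamma> where "\<gamma> s = \<sigma> (dist p q * s)" for s
  have "\<gamma> \<in> {\<gamma>. C1_curve n \<A> \<gamma> \<and> \<gamma> 0 = p \<and> \<gamma> 1 = q}"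
    using geodesic_C1_curve[OF \<sigma>(1)] \<sigma>(2,3) by (simp add: \<gamma>_def[abs_def])
  then have "(INF \<gamma>\<in>{\<gamma>. C1_curve n \<A> \<gamma> \<and> \<gamma> 0 = p \<and> \<gamma> 1 = q}.
      ereal (integral {0..1} (\<lambda>t. finsler (\<gamma> t, velocity \<A> \<gamma> t))))
      \<le> ereal (integral {0..1} (\<lambda>t. finsler (\<gamma> t, velocity \<A> \<gamma> t)))" by (rule INF_lower)
  also have "integral {0..1} (\<lambda>t. finsler (\<gamma> t, velocity \<A> \<gamma> t)) = integral {0..1} (\<lambda>_::real. dist p q)"
    using geodesic_finsler_length[OF \<sigma>(1)] by (intro integral_cong) (simp add: \<gamma>_def[abs_def])
  finally show "(INF \<gamma>\<in>{\<gamma>. C1_curve n \<A> \<gamma> \<and> \<gamma> 0 = p \<and> \<gamma> 1 = q}.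
      ereal (integral {0..1} (\<lambda>t. finsler (\<gamma> t, velocity \<A> \<gamma> t)))) \<le> ereal (dist p q)" by simp
qed

end

theorem theorem1p1:
  assumes "G_space TYPE('a::metric_space)"
    and "locally_semiconcave_space TYPE('a)"
  shows "\<exists>n. topological_manifold n (euclidean :: 'a topology) \<and>
    (\<exists>A :: 'a chart set. C1_half_atlas n A \<and> DC_atlas n A \<and> canonical_atlas n A \<and>
      (\<exists>F :: 'a \<times> 'a tvec \<Rightarrow> real.
        continuous_Finsler_metric n A F \<and>
        compatible_Finsler_metric n A F \<and>
        base_locally_half_Holder n A F))"
proof -
  interpret semiconcave_G_space "TYPE('a)" by (rule semiconcave_G_space.intro[OF assms])
  obtain n where cover: "\<And>x::'a. \<exists>c. good_chart n c \<and> x \<in> fst c" using good_chart_cover by blast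
  interpret good_manifold "TYPE('a)" n by unfold_locales (rule cover)
  have "continuous_Finsler_metric n (good_atlas n) finsler"
    unfolding continuous_Finsler_metric_def using Finsler_metric_finsler continuous_finsler by blast
  then show ?thesis
    using topological_manifold_of_good_charts[OF cover] good_atlas_structure(2-4)[OF cover]
      compatible_finsler base_Holder_finsler by blast
qed

end
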